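(* Assume the Generalized Riemann Hypothesis and that $\sum_{0<\gamma\le X}|\zeta'(\rho)|^{-2}\ll X$. Fix $\delta\in[1,2)$. If $\delta\in[\tfrac32,2)$, fix $0<\varepsilon<(\delta-1)/2$ and put $\theta=\delta-1-2\varepsilon$; if $\delta\in[1,\tfrac32)$, fix $0<\varepsilon<1/4$ and put $\theta=\tfrac12-2\varepsilon$. Let $N\ge4$ be a natural number, let $\beta>0$ be such that $N\beta$ is a positive integer, and let $f:\mathbb R\to\mathbb C$ have support in $[0,\beta)$ and belong to the H\"older--Zygmund space $\mathcal C^\delta(\mathbb R)$. Then $$\sum_{\substack{1<q\le N^\theta\\ (N,q)=1}}\frac1{\varphi(q)}\left|\sum_{\chi\ne\chi_0}\overline{\chi^*}(N)\sum_{n\le N\beta}\ \sum_{m\le N\beta-n}\Lambda(n)\chi^*(n)\mu(m)\log(m)f\!\left(\frac{n+m}N\right)\right|\ll_{f,\beta,\varepsilon,\delta}N^{2-\varepsilon}.$$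
   Context: $\Lambda$ is the von Mangoldt function, $\mu$ the M\"obius function, $\varphi$ Euler's totient. Sums $\sum_{n\le A}$ run over integers $0<n\le A$. $\sum_{\chi\ne\chi_0}$ is over all non-principal Dirichlet characters modulo $q$, and $\chi^*$ denotes the primitive character inducing $\chi$. GRH: all non-trivial zeros (those with $0<\mathrm{Re}(s)<1$) of $\zeta(s)$ and of all Dirichlet $L$-functions have real part $1/2$. $\rho=\frac12+i\gamma$ runs over the non-trivial zeros of $\zeta(s)$. The assumption $\sum_{0<\gamma\le X}|\zeta'(\rho)|^{-2}\ll X$ (a weak form of the Gonek--Hejhal conjecture) is for $X\to\infty$ and includes that all non-trivial zeros of $\zeta$ are simple. Forward differences: $\Delta_h^r(f,x):=\sum_{k=0}^r\binom rk(-1)^{r-k}f(x+hk)$. H\"older--Zygmund spaces: $\mathcal C^1(\mathbb R)$ is the set of bounded continuous $f$ on $\mathbb R$ with $\|f\|_\infty+\sup_{x,\,h\ne0}|\Delta_h^2(f,x)|/|h|<\infty$. For $0<s<1$, $\|f\|_{\mathcal C^{s}}:=\|f\|_\infty+\sup_{x,\,h\neq0}|\Delta_h^1(f,x)|/|h|^{s}$. For $1<\delta<2$, $\mathcal C^\delta(\mathbb R)$ is the set of bounded $f\in C^1(\mathbb R)$ with $\|f\|_{\mathcal C^{\delta-1}}+\|f'\|_{\mathcal C^{\delta-1}}<\infty$. *)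

theory Defs
  imports
    "HOL-Complex_Analysis.Complex_Analysis"
    "HOL-Number_Theory.Number_Theory"
    "HOL-Computational_Algebra.Squarefree"
    "HOL-Library.Landau_Symbols"
begin

definition moebius_mu :: "nat \<Rightarrow> int" where
  "moebius_mu n = (if squarefree n then (-1) ^ card (prime_factors n) else 0)"


section \<open>Dirichlet characters\<close>

(* Characters are given on the natural numbers only; by periodicity this determines them on the
   integers.  For q = 1 the only character is the constant function 1. *)

definition dirichlet_character :: "nat \<Rightarrow> (nat \<Rightarrow> complex) \<Rightarrow> bool" where
  "dirichlet_character q chi \<longleftrightarrow>
     q > 0 \<and>
     (\<forall>a b. chi (a * b) = chi a * chi b) \<and>
     (\<forall>a. chi (a + q) = chi a) \<and>
     (\<forall>a. chi a \<noteq> 0 \<longleftrightarrow> coprime a q)"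

definition principal_character :: "nat \<Rightarrow> nat \<Rightarrow> complex" where
  "principal_character q a = (if coprime a q then 1 else 0)"

definition character_induced_by ::
    "nat \<Rightarrow> (nat \<Rightarrow> complex) \<Rightarrow> nat \<Rightarrow> (nat \<Rightarrow> complex) \<Rightarrow> bool" where
  "character_induced_by q chi d psi \<longleftrightarrow>
     dirichlet_character q chi \<and> dirichlet_character d psi \<and> d dvd q \<and>
     (\<forall>a. coprime a q \<longrightarrow> chi a = psi a)"

definition primitive_character :: "nat \<Rightarrow> (nat \<Rightarrow> complex) \<Rightarrow> bool" where
  "primitive_character q chi \<longleftrightarrow>
     dirichlet_character q chi \<and> \<not> (\<exists>d psi. d < q \<and> character_induced_by q chi d psi)"

definition inducing_character :: "nat \<Rightarrow> (nat \<Rightarrow> complex) \<Rightarrow> nat \<Rightarrow> complex" where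
  "inducing_character q chi =
     (THE psi. \<exists>d. primitive_character d psi \<and> character_induced_by q chi d psi)"


section \<open>The zeta function and Dirichlet L-functions\<close>

(* Analytic continuation to the plane minus the point 1 of the Dirichlet series with coefficients
   a 1, a 2, ...  The set - {1} is connected, so the continuation is unique on it whenever it
   exists; the value at 1 is left unspecified, also when the continuation is regular there. *)
definition dirichlet_continuation :: "(nat \<Rightarrow> complex) \<Rightarrow> complex \<Rightarrow> complex" where
  "dirichlet_continuation a =
     (SOME F. F holomorphic_on (- {1}) \<and>
        (\<forall>s. Re s > 1 \<longrightarrow> (\<lambda>n. a (Suc n) / of_nat (Suc n) powr s) sums F s))"

definition zeta :: "complex \<Rightarrow> complex" where
  "zeta = dirichlet_continuation (\<lambda>_. 1)"

definition dirichlet_L :: "(nat \<Rightarrow> complex) \<Rightarrow> complex \<Rightarrow> complex" where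
  "dirichlet_L chi = dirichlet_continuation chi"

definition nontrivial_zeros :: "(complex \<Rightarrow> complex) \<Rightarrow> complex set" where
  "nontrivial_zeros F = {s. 0 < Re s \<and> Re s < 1 \<and> F s = 0}"

definition GRH :: bool where
  "GRH \<longleftrightarrow>
     (\<forall>\<rho>\<in>nontrivial_zeros zeta. Re \<rho> = 1 / 2) \<and>
     (\<forall>q chi. dirichlet_character q chi \<longrightarrow>
        (\<forall>\<rho>\<in>nontrivial_zeros (dirichlet_L chi). Re \<rho> = 1 / 2))"

(* Simplicity is a separate conjunct: division by 0 yields 0, so the estimate alone would ignore
   multiple zeros. *)
definition weak_Gonek_Hejhal :: bool where
  "weak_Gonek_Hejhal \<longleftrightarrow>
     (\<forall>\<rho>\<in>nontrivial_zeros zeta. deriv zeta \<rho> \<noteq> 0) \<and>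
     (\<lambda>X::real. \<Sum>\<rho> | \<rho> \<in> nontrivial_zeros zeta \<and> 0 < Im \<rho> \<and> Im \<rho> \<le> X.
        1 / (cmod (deriv zeta \<rho>))\<^sup>2) \<in> O[at_top](\<lambda>X. X)"


section \<open>Hoelder--Zygmund spaces\<close>

definition forward_difference ::
    "nat \<Rightarrow> real \<Rightarrow> (real \<Rightarrow> complex) \<Rightarrow> real \<Rightarrow> complex" where
  "forward_difference r h f x =
     (\<Sum>k\<le>r. of_nat (r choose k) * (-1) ^ (r - k) * f (x + h * real k))"

definition sup_norm :: "(real \<Rightarrow> complex) \<Rightarrow> ennreal" where
  "sup_norm f = (SUP x. ennreal (cmod (f x)))"

definition difference_seminorm :: "nat \<Rightarrow> real \<Rightarrow> (real \<Rightarrow> complex) \<Rightarrow> ennreal" where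
  "difference_seminorm r s f =
     (SUP x. SUP h\<in>- {0}. ennreal (cmod (forward_difference r h f x) / \<bar>h\<bar> powr s))"

(* For 0 < s < 1. *)
definition holder_norm :: "real \<Rightarrow> (real \<Rightarrow> complex) \<Rightarrow> ennreal" where
  "holder_norm s f = sup_norm f + difference_seminorm 1 s f"

(* Only meaningful for 1 \<le> \<delta> < 2; for other \<delta> the set is empty. *)
definition holder_zygmund :: "real \<Rightarrow> (real \<Rightarrow> complex) set" where
  "holder_zygmund \<delta> =
     {f. bounded (range f) \<and>
         (\<delta> = 1 \<and> continuous_on UNIV f \<and> sup_norm f + difference_seminorm 2 1 f < \<infinity> \<or>
          1 < \<delta> \<and> \<delta> < 2 \<and> f C1_differentiable_on UNIV \<and>
            holder_norm (\<delta> - 1) f + holder_norm (\<delta> - 1) (\<lambda>x. vector_derivative f (at x)) < \<infinity>)}"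

end

theory Submission
  imports Defs
begin

text \<open>
  Write the double sum as \<open>\<Sum>\<^sub>n \<Lambda>(n) \<chi>\<^sup>*(n) g(n)\<close> with \<open>g(n) = \<Sum>\<^sub>m \<mu>(m) log m f((n + m) / N)\<close>.  The Riemann
  hypothesis for zeta gives \<open>\<Sum>\<^sub>m\<^sub>\<le>\<^sub>x \<mu>(m) \<lless> x powr (1 / 2 + \<kappa>)\<close>, and since the
  increments of \<open>f\<close> over \<open>1 / N\<close> are \<open>\<lless> log N / N\<close>, partial summation yields
  \<open>g(n) \<lless> N powr (1 / 2 + 2 * \<kappa>)\<close>, uniformly in \<open>n\<close>.  The cancellation in the sum over \<open>n\<close> comes from
  averaging over the characters: by Cauchy-Schwarz and Bessel's inequality for the orthogonal
  system of characters modulo \<open>q\<close>, the average of \<open>\<bar>\<Sum>\<^sub>n \<Lambda>(n) \<chi>\<^sup>*(n) g(n)\<bar>\<close> is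
  \<open>\<lless> N / sqrt q * max \<bar>g\<bar>\<close> up to logarithms.  Summing over \<open>q \<le> N powr \<theta>\<close> gives
  \<open>N powr (3 / 2 + \<theta> / 2)\<close> up to a small power of \<open>N\<close>, which is admissible because \<open>\<theta> + 2 * \<epsilon> < 1\<close>.

  For the bound on the Mertens function, the holomorphic logarithm of \<open>(s - 1) \<zeta>(s) / s\<close> on discs
  around \<open>2 + i t\<close> shows that \<open>1 / \<zeta>(s)\<close> grows more slowly than any power of \<open>\<bar>t\<bar>\<close> to the right of the
  critical line, and Perron's formula for the Cesaro means of \<open>\<mu>\<close> can be shifted to
  \<open>Re s = 1 / 2 + \<delta>\<close>; differencing over an interval of length \<open>sqrt x\<close> removes the smoothing.
\<close>

section \<open>Dirichlet characters\<close>

text \<open>Two definitions by choice shape the proof. \<open>zeta\<close> is chosen by a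
  specification on all of \<open>- {1}\<close>, so a continuation to the whole punctured plane has
  to be exhibited before anything can be said about it on \<open>Re s > 1 / 2\<close>; and
  \<open>inducing_character\<close> is a definite description, which has content only once a
  primitive inducing character is known to exist and to be unique. \<open>GRH\<close> speaks of
  zeros with \<open>0 < Re s < 1\<close>, while the shifted contour crosses the line
  \<open>Re s = 1\<close>, so that line is treated by the classical 3-4-1 argument. In the function
  whose logarithm is taken, the factor s - 1 removes the pole, and the division by s keeps the
  function bounded near 2 + i t uniformly in t. The weights \<open>mangoldt n\<close> enter through
  their size alone. The saving \<open>sqrt q\<close> for each modulus reflects that a residue class
  has about N / q members; passing from the primitive character back to the one modulo
  \<open>q\<close> changes only terms with \<open>n\<close> not coprime to \<open>q\<close>, which
  contribute a power of a logarithm. All logarithms and the loss in the Mertens bound are paid from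
  the gap \<open>1 - \<theta> - 2 * \<epsilon>\<close>.\<close>

lemma dirichlet_character_one:
  assumes "dirichlet_character q chi"
  shows "chi (Suc 0) = 1"
proof -
  have "chi (1 * 1) = chi 1 * chi 1" using assms unfolding dirichlet_character_def by blast
  moreover have "chi 1 \<noteq> 0" using assms by (simp add: dirichlet_character_def)
  ultimately show ?thesis by simp
qed

lemma dirichlet_character_mult:
  assumes "dirichlet_character q chi"
  shows "chi (a * b) = chi a * chi b"
  using assms unfolding dirichlet_character_def by blast

lemma dirichlet_character_power:
  assumes "dirichlet_character q chi"
  shows "chi (a ^ n) = chi a ^ n"
  using assms by (induction n) (auto simp: dirichlet_character_one dirichlet_character_mult)

lemma dirichlet_character_cong:
  assumes "dirichlet_character q chi" "[a = b] (mod q)"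
  shows "chi a = chi b"
proof -
  have shift: "chi (x + k * q) = chi x" for x k
  proof (induction k)
    case (Suc k)
    have "chi (x + k * q + q) = chi (x + k * q)" using assms unfolding dirichlet_character_def by blast
    then show ?case using Suc by (simp add: algebra_simps)
  qed auto
  have "chi x = chi (x mod q)" for x
    using shift[of "x mod q" "x div q"] by (simp add: algebra_simps)
  then show ?thesis using assms(2) unfolding cong_def by metis
qed

lemma dirichlet_character_norm:
  assumes "dirichlet_character q chi" "coprime a q"
  shows "cmod (chi a) = 1"
proof -
  have "[a ^ totient q = 1] (mod q)" using assms(2) by (rule euler_theorem)
  then have "chi (a ^ totient q) = 1"
    using dirichlet_character_cong[OF assms(1)] dirichlet_character_one[OF assms(1)] by fastforce
  then have "cmod (chi a) ^ totient q = 1"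
    by (metis dirichlet_character_power[OF assms(1)] norm_one norm_power)
  moreover have "totient q > 0" using assms(1) by (simp add: dirichlet_character_def)
  ultimately show ?thesis using power_eq_imp_eq_base[of "cmod (chi a)" "totient q" 1] by simp
qed

lemma dirichlet_character_eq_0:
  assumes "dirichlet_character q chi" "\<not> coprime a q"
  shows "chi a = 0"
  using assms unfolding dirichlet_character_def by blast

lemma dirichlet_character_norm_le:
  assumes "dirichlet_character q chi"
  shows "cmod (chi a) \<le> 1"
  using dirichlet_character_norm[OF assms] dirichlet_character_eq_0[OF assms]
  by (cases "coprime a q") auto

lemma mod_totatives:
  assumes "1 < (q::nat)" "coprime a q"
  shows "a mod q \<in> totatives q"
proof -
  have c: "coprime (a mod q) q" using assms by simp
  then have "a mod q \<noteq> 0" using assms by (intro notI) simp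
  with c show ?thesis using assms by (simp add: totatives_def mod_le_divisor less_imp_le)
qed

text \<open>Multiplication by \<open>b\<close> permutes the reduced residues, so the sum reproduces
  itself with the factor \<open>chi b * cnj (psi b)\<close>. At a \<open>b\<close> where the
  characters differ this factor is not 1, because \<open>psi b\<close> has modulus 1.\<close>

lemma dirichlet_character_orthogonal:
  assumes q: "1 < q" and chi: "dirichlet_character q chi" and psi: "dirichlet_character q psi"
    and ne: "chi \<noteq> psi"
  shows "(\<Sum>r\<in>totatives q. chi r * cnj (psi r)) = 0"
proof -
  obtain b where b: "chi b \<noteq> psi b" using ne by blast
  have cb: "coprime b q"
    using b dirichlet_character_eq_0[OF chi, of b] dirichlet_character_eq_0[OF psi, of b] by metis
  define xi where "xi r = chi r * cnj (psi r)" for r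
  have xb: "xi b \<noteq> 1"
  proof
    assume "xi b = 1"
    then have "chi b * (cnj (psi b) * psi b) = psi b" by (simp add: xi_def)
    moreover have "cnj (psi b) * psi b = 1"
      using dirichlet_character_norm[OF psi cb] complex_norm_square[of "psi b"] by (simp add: mult.commute)
    ultimately show False using b by simp
  qed
  have inj: "inj_on (\<lambda>r. b * r mod q) (totatives q)"
  proof (rule inj_onI)
    fix r s assume rs: "r \<in> totatives q" "s \<in> totatives q" "b * r mod q = b * s mod q"
    then have "[b * r = b * s] (mod q)" by (simp add: cong_def)
    then have "[r = s] (mod q)" using cb by (simp add: cong_mult_lcancel_nat)
    then show "r = s" using rs(1,2) q by (metis cong_less_modulus_unique_nat totatives_less)
  qed
  have sub: "(\<lambda>r. b * r mod q) ` totatives q \<subseteq> totatives q"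
    using cb by (force intro!: mod_totatives[OF q] simp del: coprime_mod_left_iff simp: in_totatives_iff)
  have img: "(\<lambda>r. b * r mod q) ` totatives q = totatives q"
    using endo_inj_surj[OF _ sub inj] by simp
  have xm: "xi (b * r mod q) = xi b * xi r" for r
    using dirichlet_character_cong[OF chi, of "b * r mod q" "b * r"]
      dirichlet_character_cong[OF psi, of "b * r mod q" "b * r"]
    by (simp add: xi_def dirichlet_character_mult[OF chi] dirichlet_character_mult[OF psi])
  have "sum xi (totatives q) = (\<Sum>r\<in>totatives q. xi (b * r mod q))"
    using sum.reindex[OF inj, of xi] unfolding img by simp
  also have "\<dots> = xi b * sum xi (totatives q)" by (simp add: xm sum_distrib_left)
  finally have "(1 - xi b) * sum xi (totatives q) = 0" by (simp add: algebra_simps)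
  then show ?thesis using xb by (simp add: xi_def)
qed

text \<open>\<open>G / P\<close> is the orthogonal projection of \<open>F\<close> to the span of the
  conjugates of the \<open>u x\<close>. The squared distance from \<open>F\<close> to it, a
  nonnegative number, equals \<open>T - S / P\<close>.\<close>

lemma bessel_finite:
  fixes F :: "'b \<Rightarrow> complex" and u :: "'a \<Rightarrow> 'b \<Rightarrow> complex" and P :: real
  assumes X: "finite X" and R: "finite R" and P: "P > 0"
    and diag: "\<And>x. x \<in> X \<Longrightarrow> (\<Sum>r\<in>R. u x r * cnj (u x r)) = of_real P"
    and orth: "\<And>x y. x \<in> X \<Longrightarrow> y \<in> X \<Longrightarrow> x \<noteq> y \<Longrightarrow> (\<Sum>r\<in>R. u x r * cnj (u y r)) = 0"
  shows "(\<Sum>x\<in>X. (cmod (\<Sum>r\<in>R. F r * u x r))\<^sup>2) \<le> P * (\<Sum>r\<in>R. (cmod (F r))\<^sup>2)"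
proof -
  define c where "c x = (\<Sum>r\<in>R. F r * u x r)" for x
  define G where "G r = (\<Sum>x\<in>X. c x * cnj (u x r))" for r
  define S where "S = (\<Sum>x\<in>X. (cmod (c x))\<^sup>2)"
  define T where "T = (\<Sum>r\<in>R. (cmod (F r))\<^sup>2)"
  have FG: "(\<Sum>r\<in>R. F r * cnj (G r)) = of_real S"
  proof -
    have "(\<Sum>r\<in>R. F r * cnj (G r)) = (\<Sum>r\<in>R. \<Sum>x\<in>X. F r * u x r * cnj (c x))"
      by (simp add: G_def sum_distrib_left mult_ac)
    also have "\<dots> = (\<Sum>x\<in>X. c x * cnj (c x))"
      by (subst sum.swap) (simp only: sum_distrib_right[symmetric] c_def[symmetric])
    also have "\<dots> = of_real S"
      by (simp add: S_def flip: complex_norm_square)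
    finally show ?thesis .
  qed
  have GF: "(\<Sum>r\<in>R. G r * cnj (F r)) = of_real S"
    using arg_cong[OF FG, of cnj] by (simp add: mult.commute)
  have GG: "(\<Sum>r\<in>R. G r * cnj (G r)) = of_real (P * S)"
  proof -
    have "(\<Sum>r\<in>R. G r * cnj (G r)) = (\<Sum>r\<in>R. \<Sum>x\<in>X. c x * cnj (u x r) * cnj (G r))"
      by (simp add: G_def sum_distrib_right)
    also have "\<dots> = (\<Sum>x\<in>X. c x * (\<Sum>r\<in>R. cnj (u x r) * cnj (G r)))"
      by (subst sum.swap) (simp add: sum_distrib_left mult_ac)
    also have "\<dots> = (\<Sum>x\<in>X. c x * (cnj (c x) * of_real P))"
    proof (intro sum.cong refl, goal_cases)
      case (1 x)
      have "(\<Sum>r\<in>R. cnj (u x r) * cnj (G r)) = (\<Sum>r\<in>R. \<Sum>y\<in>X. cnj (c y) * (u y r * cnj (u x r)))"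
        by (simp add: G_def sum_distrib_left mult_ac)
      also have "\<dots> = (\<Sum>y\<in>X. cnj (c y) * (\<Sum>r\<in>R. u y r * cnj (u x r)))"
        by (subst sum.swap) (simp add: sum_distrib_left)
      also have "\<dots> = (\<Sum>y\<in>X. if y = x then cnj (c x) * of_real P else 0)"
        using 1 by (intro sum.cong refl) (auto simp: diag orth)
      also have "\<dots> = cnj (c x) * of_real P" using 1 X by simp
      finally show ?case by simp
    qed
    also have "\<dots> = of_real (P * S)"
      by (simp add: S_def sum_distrib_left mult_ac flip: complex_norm_square mult.assoc)
    finally show ?thesis .
  qed
  have FF: "(\<Sum>r\<in>R. F r * cnj (F r)) = of_real T"
    by (simp add: T_def flip: complex_norm_square)
  have "complex_of_real (\<Sum>r\<in>R. (cmod (F r - G r / of_real P))\<^sup>2)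
      = (\<Sum>r\<in>R. F r * cnj (F r) - F r * cnj (G r) / of_real P - G r * cnj (F r) / of_real P
           + G r * cnj (G r) / (of_real P)\<^sup>2)"
    unfolding of_real_sum complex_norm_square using P
    by (intro sum.cong refl) (simp add: field_simps power2_eq_square)
  also have "\<dots> = of_real T - of_real S / of_real P - of_real S / of_real P + of_real (P * S) / (of_real P)\<^sup>2"
    by (simp only: sum.distrib sum_subtractf sum_divide_distrib[symmetric] FF FG GF GG)
  also have "\<dots> = of_real (T - S / P)"
    using P by (simp add: field_simps power2_eq_square)
  finally have "(\<Sum>r\<in>R. (cmod (F r - G r / of_real P))\<^sup>2) = T - S / P"
    using of_real_eq_iff by blast
  moreover have "0 \<le> (\<Sum>r\<in>R. (cmod (F r - G r / of_real P))\<^sup>2)" by (rule sum_nonneg) simp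
  ultimately have "0 \<le> T - S / P" by simp
  then have "S \<le> P * T" using P by (simp add: field_simps)
  then show ?thesis by (simp add: S_def T_def c_def)
qed

lemma card_residue_class_le:
  fixes q k r :: nat
  assumes "q > 0"
  shows "real (card {n\<in>{1..k}. n mod q = r}) \<le> real k / real q + 1"
proof -
  have "inj_on (\<lambda>n. n div q) {n\<in>{1..k}. n mod q = r}"
    by (rule inj_onI) (metis (mono_tags, lifting) mem_Collect_eq div_mult_mod_eq)
  moreover have "(\<lambda>n. n div q) ` {n\<in>{1..k}. n mod q = r} \<subseteq> {0..k div q}"
    by (auto simp: div_le_mono)
  ultimately have "card {n\<in>{1..k}. n mod q = r} \<le> card {0..k div q}"
    by (intro card_inj_on_le) auto
  then have "real (card {n\<in>{1..k}. n mod q = r}) \<le> real (k div q) + 1" by simp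
  also have "real (k div q) \<le> real k / real q" by (rule of_nat_div_le_of_nat)
  finally show ?thesis by simp
qed

text \<open>Cauchy-Schwarz over \<open>X\<close>, Bessel on the reduced residues, and Cauchy-Schwarz
  once more within each residue class, whose size is at most \<open>k / q + 1\<close>.\<close>

lemma character_sum_mean:
  fixes a :: "nat \<Rightarrow> complex" and k :: nat
  assumes q: "1 < q" and X: "finite X" "\<And>chi. chi \<in> X \<Longrightarrow> dirichlet_character q chi"
  defines "A \<equiv> {n\<in>{1..k}. coprime n q}"
  shows "(\<Sum>chi\<in>X. cmod (\<Sum>n\<in>A. a n * chi n))
    \<le> real (totient q) * sqrt ((real k / real q + 1) * (\<Sum>n\<in>A. (cmod (a n))\<^sup>2))"
    and "card X \<le> totient q"
proof -
  let ?R = "totatives q"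
  have tot: "real (totient q) > 0" using q by simp
  have A: "finite A" by (simp add: A_def)
  have diag: "(\<Sum>r\<in>?R. chi r * cnj (chi r)) = of_real (real (totient q))" if "chi \<in> X" for chi
  proof -
    have "(\<Sum>r\<in>?R. chi r * cnj (chi r)) = (\<Sum>r\<in>?R. 1)"
      using dirichlet_character_norm[OF X(2)[OF that]]
      by (intro sum.cong refl) (auto simp: totatives_def complex_norm_square[symmetric])
    then show ?thesis by (simp add: totient_def)
  qed
  note bessel = bessel_finite[where u = "\<lambda>chi. chi", OF X(1) finite_totatives tot diag
      dirichlet_character_orthogonal[OF q X(2) X(2)]]
  have one: "1 \<in> ?R" using q by (simp add: totatives_def)
  \<comment> \<open>Bessel for the indicator of the residue 1, where every character has the value
    1, bounds the number of characters in \<open>X\<close> by \<open>totient q\<close>.\<close>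
  have "(\<Sum>chi\<in>X. (cmod (\<Sum>r\<in>?R. (if r = 1 then 1 else 0) * chi r))\<^sup>2)
      \<le> real (totient q) * (\<Sum>r\<in>?R. (cmod (if r = 1 then 1 else 0))\<^sup>2)"
    by (rule bessel)
  moreover have "(\<Sum>chi\<in>X. (cmod (\<Sum>r\<in>?R. (if r = 1 then 1 else 0) * chi r))\<^sup>2) = (\<Sum>chi\<in>X. 1)"
    using one by (intro sum.cong refl)
      (simp add: if_distrib[where f = "\<lambda>x. x * _"] dirichlet_character_one[OF X(2)] cong: if_cong)
  moreover have "(\<Sum>r\<in>?R. (cmod (if r = 1 then 1 else 0))\<^sup>2) = 1"
    using one by (simp add: if_distrib[where f = "\<lambda>x. (cmod x)\<^sup>2"] cong: if_cong)
  ultimately show card: "card X \<le> totient q" by simp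
  define F where "F r = (\<Sum>n | n \<in> A \<and> n mod q = r. a n)" for r
  have AR: "n mod q \<in> ?R" if "n \<in> A" for n
    using that by (intro mod_totatives[OF q]) (simp add: A_def)
  have rew: "(\<Sum>n\<in>A. a n * chi n) = (\<Sum>r\<in>?R. F r * chi r)" if "chi \<in> X" for chi
  proof -
    have "chi (n mod q) = chi n" for n
      by (rule dirichlet_character_cong[OF X(2)[OF that]]) (simp add: cong_def)
    then have "(\<Sum>r\<in>?R. F r * chi r) = (\<Sum>r\<in>?R. \<Sum>n | n \<in> A \<and> n mod q = r. a n * chi n)"
      unfolding F_def sum_distrib_right
      by (intro sum.cong refl) auto
    also have "\<dots> = (\<Sum>n\<in>A. a n * chi n)"
      by (rule sum.group[OF A]) (use AR in auto)
    finally show ?thesis by simp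
  qed
  have Fr: "(cmod (F r))\<^sup>2 \<le> (real k / real q + 1) * (\<Sum>n | n \<in> A \<and> n mod q = r. (cmod (a n))\<^sup>2)" for r
  proof -
    let ?A = "{n. n \<in> A \<and> n mod q = r}"
    have "cmod (F r) \<le> (\<Sum>n\<in>?A. cmod (a n))" unfolding F_def by (rule norm_sum)
    then have "(cmod (F r))\<^sup>2 \<le> (\<Sum>n\<in>?A. cmod (a n))\<^sup>2" by (simp add: power_mono)
    also have "\<dots> \<le> (\<Sum>n\<in>?A. (cmod (a n))\<^sup>2) * real (card ?A)"
      by (rule sum_squared_le_sum_of_squares)
    also have "\<dots> \<le> (\<Sum>n\<in>?A. (cmod (a n))\<^sup>2) * (real k / real q + 1)"
    proof (intro mult_left_mono sum_nonneg)
      have "card ?A \<le> card {n\<in>{1..k}. n mod q = r}"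
        by (intro card_mono) (auto simp: A_def)
      then show "real (card ?A) \<le> real k / real q + 1"
        using card_residue_class_le[of q k r] q by linarith
    qed auto
    finally show ?thesis by (simp add: mult.commute)
  qed
  let ?S = "\<Sum>n\<in>A. (cmod (a n))\<^sup>2"
  have "(\<Sum>chi\<in>X. cmod (\<Sum>n\<in>A. a n * chi n))\<^sup>2
      \<le> (\<Sum>chi\<in>X. (cmod (\<Sum>n\<in>A. a n * chi n))\<^sup>2) * real (card X)"
    by (rule sum_squared_le_sum_of_squares)
  also have "(\<Sum>chi\<in>X. (cmod (\<Sum>n\<in>A. a n * chi n))\<^sup>2) = (\<Sum>chi\<in>X. (cmod (\<Sum>r\<in>?R. F r * chi r))\<^sup>2)"
    by (intro sum.cong refl) (simp add: rew)
  also have "\<dots> * real (card X) \<le> (real (totient q) * (\<Sum>r\<in>?R. (cmod (F r))\<^sup>2)) * real (totient q)"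
    by (intro mult_mono bessel) (use card in \<open>auto intro!: mult_nonneg_nonneg sum_nonneg\<close>)
  also have "\<dots> \<le> (real (totient q) * (\<Sum>r\<in>?R. (real k / real q + 1) * (\<Sum>n | n \<in> A \<and> n mod q = r. (cmod (a n))\<^sup>2))) * real (totient q)"
    by (intro mult_right_mono mult_left_mono sum_mono Fr) auto
  also have "(\<Sum>r\<in>?R. (real k / real q + 1) * (\<Sum>n | n \<in> A \<and> n mod q = r. (cmod (a n))\<^sup>2))
      = (real k / real q + 1) * ?S"
    unfolding sum_distrib_left[symmetric]
    by (intro arg_cong[where f = "\<lambda>x. _ * x"] sum.group[OF A]) (use AR in auto)
  also have "(real (totient q) * ((real k / real q + 1) * ?S)) * real (totient q)
      = (real (totient q) * sqrt ((real k / real q + 1) * ?S))\<^sup>2"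
    by (simp add: power_mult_distrib power2_eq_square sum_nonneg mult_ac)
  finally show "(\<Sum>chi\<in>X. cmod (\<Sum>n\<in>A. a n * chi n)) \<le> real (totient q) * sqrt ((real k / real q + 1) * ?S)"
    by (rule power2_le_imp_le) (simp add: sum_nonneg)
qed

section \<open>Existence and uniqueness of the inducing primitive character\<close>

lemma ex_coprime_lift:
  fixes a d q :: nat
  assumes "coprime a d" "q > 0"
  shows "\<exists>a'. coprime a' q \<and> [a' = a] (mod d)"
proof -
  \<comment> \<open>Every prime factor of \<open>q\<close> divides exactly one of \<open>a\<close>
    and \<open>d * m\<close>: those dividing \<open>a\<close> miss \<open>d\<close> by coprimality
    and \<open>m\<close> by construction, the others divide \<open>m\<close>. Hence none divides the
    sum.\<close>
  define m where "m = \<Prod>{p\<in>prime_factors q. \<not> p dvd a}"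
  have fin: "finite {p\<in>prime_factors q. \<not> p dvd a}" by simp
  have "coprime (a + d * m) q"
  proof (rule ccontr)
    assume "\<not> coprime (a + d * m) q"
    then have "gcd (a + d * m) q \<noteq> 1" using coprime_iff_gcd_eq_1 by blast
    then obtain p where "prime p" "p dvd gcd (a + d * m) q" using prime_factor_nat by blast
    then have p: "prime p" "p dvd a + d * m" "p dvd q" by (auto dest: dvd_gcdD1 dvd_gcdD2)
    have pq: "p \<in> prime_factors q" using p assms(2) by (simp add: prime_factors_dvd)
    show False
    proof (cases "p dvd a")
      case True
      then have "p dvd d * m" using p(2) by (simp add: dvd_add_right_iff)
      then have "p dvd d \<or> p dvd m" using p(1) by (simp add: prime_dvd_mult_iff)
      then show False
      proof
        assume "p dvd d"
        then show False using True assms(1) p(1) coprime_common_divisor[of a d p] not_prime_unit by blast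
      next
        assume "p dvd m"
        then obtain r where r: "r \<in> prime_factors q" "\<not> r dvd a" "p dvd r"
          unfolding m_def using prime_dvd_prod_iff[OF fin p(1), of "\<lambda>x. x"] by auto
        then have "r = p" using p(1) primes_dvd_imp_eq[of p r] in_prime_factors_imp_prime[of r q] by simp
        then show False using r True by simp
      qed
    next
      case False
      then have "p dvd m" unfolding m_def using pq dvd_prodI[OF fin, of p "\<lambda>x. x"] by simp
      then have "p dvd d * m" by simp
      then show False using False p(2) dvd_add_left_iff[of p "d * m" a] by simp
    qed
  qed
  moreover have "[a + d * m = a] (mod d)" by (simp add: cong_def)
  ultimately show ?thesis by blast
qed

text \<open>Chinese remainder theorem for moduli with a common factor. The witness is
  \<open>a + m * x * t\<close>, where \<open>m * x\<close> is congruent to the gcd modulo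
  \<open>n\<close> and the gcd times \<open>t\<close> is the difference of the prescribed
  residues.\<close>

lemma ex_cong_cong:
  fixes a b m n :: nat
  assumes "[a = b] (mod gcd m n)" "m > 0" "n > 0"
  shows "\<exists>c. [c = a] (mod m) \<and> [c = b] (mod n)"
proof -
  let ?g = "gcd m n"
  obtain x where x: "[m * x = ?g] (mod n)" using cong_solve_nat[of m n] assms(2) by auto
  \<comment> \<open>A multiple of \<open>n\<close> lifts \<open>b\<close> above \<open>a\<close>, so
    that \<open>b' - a\<close> is a genuine subtraction of natural numbers.\<close>
  define b' where "b' = b + a * n"
  have le: "a \<le> b'" using assms(3) by (simp add: b'_def trans_le_add2)
  have "[b + a * n = b + 0] (mod ?g)"
    by (intro cong_add cong_refl) (simp add: cong_0_iff)
  then have "[b' = a] (mod ?g)"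
    using assms(1) by (auto simp: b'_def intro: cong_trans cong_sym)
  then have "?g dvd b' - a" using le cong_altdef_nat by blast
  then obtain t where t: "b' - a = ?g * t" by blast
  have "[a + m * x * t = a + ?g * t] (mod n)"
    using x by (intro cong_add cong_mult cong_refl)
  also have "a + ?g * t = b'" using t le by simp
  finally have "[a + m * x * t = b] (mod n)" by (simp add: b'_def cong_def)
  moreover have "[a + m * x * t = a] (mod m)" by (simp add: cong_def mult.assoc)
  ultimately show ?thesis by blast
qed

lemma character_induced_by_trans:
  assumes "character_induced_by q chi d psi" "character_induced_by d psi e xi"
  shows "character_induced_by q chi e xi"
  using assms unfolding character_induced_by_def
  by (metis coprime_divisors dvd_refl dvd_trans)

text \<open>On the units modulo \<open>q\<close> the values of \<open>chi\<close> depend only on the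
  residue modulo \<open>d = gcd d1 d2\<close>, so \<open>chi\<close> comes from a character
  \<open>psi\<close> modulo \<open>d\<close>. This \<open>psi\<close> induces both
  \<open>psi1\<close> and \<open>psi2\<close>, and primitivity excludes \<open>d < d1\<close> and
  \<open>d < d2\<close>.\<close>

lemma primitive_character_induced_unique:
  assumes p1: "primitive_character d1 psi1" and i1: "character_induced_by q chi d1 psi1"
    and p2: "primitive_character d2 psi2" and i2: "character_induced_by q chi d2 psi2"
  shows "psi1 = psi2"
proof -
  have chi: "dirichlet_character q chi" and c1: "dirichlet_character d1 psi1"
    and c2: "dirichlet_character d2 psi2" and d1: "d1 dvd q" and d2: "d2 dvd q"
    using i1 i2 by (auto simp: character_induced_by_def)
  have pos: "q > 0" "d1 > 0" "d2 > 0"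
    using chi c1 c2 by (auto simp: dirichlet_character_def)
  have e1: "chi a = psi1 a" and e2: "chi a = psi2 a" if "coprime a q" for a
    using i1 i2 that by (auto simp: character_induced_by_def)
  define d where "d = gcd d1 d2"
  have dpos: "d > 0" using pos by (simp add: d_def)
  have dq: "d dvd q" using d1 by (auto simp: d_def)
  \<comment> \<open>A unit \<open>c'\<close> modulo \<open>q\<close> that is congruent to
    \<open>a\<close> modulo \<open>d1\<close> and to \<open>b\<close> modulo \<open>d2\<close> links
    the two values: chi a = psi1 c' = chi c' = psi2 c' = chi b.\<close>
  have wd: "chi a = chi b" if a: "coprime a q" and b: "coprime b q" and ab: "[a = b] (mod d)" for a b
  proof -
    obtain c where c: "[c = a] (mod d1)" "[c = b] (mod d2)"
      using ex_cong_cong[of a b d1 d2] ab pos by (auto simp: d_def)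
    have "coprime a d1" "coprime b d2" using a b d1 d2 by (meson coprime_divisors dvd_refl)+
    then have "coprime c d1" "coprime c d2" using c by (meson cong_imp_coprime cong_sym)+
    then have "coprime c (d1 * d2)" by simp
    then have "coprime c (lcm d1 d2)"
      by (rule coprime_divisors[rotated -1]) (simp_all add: lcm_least)
    then obtain c' where c': "coprime c' q" "[c' = c] (mod lcm d1 d2)"
      using ex_coprime_lift pos(1) by blast
    have "[c' = a] (mod d1)" "[c' = b] (mod d2)"
      using c c'(2) by (meson cong_dvd_modulus_nat cong_trans dvd_lcm1 dvd_lcm2)+
    then have "psi1 c' = psi1 a" "psi2 c' = psi2 b"
      using dirichlet_character_cong c1 c2 by blast+
    then show ?thesis using e1 e2 a b c'(1) by metis
  qed
  \<comment> \<open>A residue coprime to \<open>d\<close> may share factors with \<open>q\<close>,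
    where \<open>chi\<close> vanishes; hence the detour through a representative coprime to
    \<open>q\<close>.\<close>
  define lift where "lift a = (SOME a'. coprime a' q \<and> [a' = a] (mod d))" for a
  have lift: "coprime (lift a) q \<and> [lift a = a] (mod d)" if "coprime a d" for a
    unfolding lift_def using someI_ex[OF ex_coprime_lift[OF that pos(1)]] .
  define psi where "psi a = (if coprime a d then chi (lift a) else 0)" for a
  have psi_eq: "psi a = chi b" if "coprime b q" "[b = a] (mod d)" for a b
  proof -
    have "coprime b d" using that(1) dq by (meson coprime_divisors dvd_refl)
    then have "coprime a d" using that(2) by (meson cong_imp_coprime)
    then show ?thesis
      using wd[of "lift a" b] lift[of a] that by (auto simp: psi_def intro: cong_trans cong_sym)
  qed
  have "dirichlet_character d psi" unfolding dirichlet_character_def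
  proof (intro conjI allI dpos)
    fix a b
    show "psi (a * b) = psi a * psi b"
    proof (cases "coprime a d \<and> coprime b d")
      case True
      then have "psi (a * b) = chi (lift a * lift b)"
        using lift by (intro psi_eq) (auto intro: cong_mult)
      then show ?thesis using True by (simp add: psi_def dirichlet_character_mult[OF chi])
    next
      case False
      then show ?thesis by (auto simp: psi_def)
    qed
    have "coprime (a + d) d = coprime a d"
      by (metis coprime_iff_gcd_eq_1 gcd_add1)
    moreover have "psi (a + d) = psi a" if "coprime a d"
    proof -
      have "[lift a = a + d] (mod d)" using lift[OF that] by (simp add: cong_def)
      then have "psi (a + d) = chi (lift a)" using lift[OF that] by (intro psi_eq) auto
      then show ?thesis using that by (simp add: psi_def)
    qed
    ultimately show "psi (a + d) = psi a" by (cases "coprime a d") (auto simp: psi_def)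
    show "(psi a \<noteq> 0) = coprime a d"
      using lift[of a] chi by (auto simp: psi_def dirichlet_character_def)
  qed
  note psi = this
  have key: "psi' = psi"
    if p': "primitive_character d' psi'" and d': "d' dvd q" "d dvd d'"
      and e': "\<And>a. coprime a q \<Longrightarrow> chi a = psi' a" for d' psi'
  proof -
    have c': "dirichlet_character d' psi'" using p' by (simp add: primitive_character_def)
    have eq: "psi' a = psi a" if a: "coprime a d'" for a
    proof -
      obtain b where b: "coprime b q" "[b = a] (mod d')"
        using ex_coprime_lift[OF a pos(1)] by blast
      then have "psi a = chi b" using d'(2) by (intro psi_eq) (auto intro: cong_dvd_modulus_nat)
      also have "\<dots> = psi' b" using e' b by simp
      also have "\<dots> = psi' a" using dirichlet_character_cong[OF c' b(2)] .
      finally show ?thesis by simp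
    qed
    then have "character_induced_by d' psi' d psi"
      using c' psi d'(2) by (simp add: character_induced_by_def)
    then have "\<not> d < d'" using p' by (auto simp: primitive_character_def)
    moreover have "d \<le> d'" using d' pos(1) by (meson dvd_imp_le dvd_pos_nat)
    ultimately have "d = d'" by simp
    then show ?thesis
      using eq dirichlet_character_eq_0[OF c'] by (auto simp: psi_def fun_eq_iff)
  qed
  have "d dvd d1" "d dvd d2" by (simp_all add: d_def)
  then have "psi1 = psi" "psi2 = psi" using key[OF p1 d1] key[OF p2 d2] e1 e2 by blast+
  then show ?thesis by simp
qed

text \<open>The least modulus carrying an inducing character yields a primitive one: a character
  inducing \<open>psi\<close> from a smaller modulus would by transitivity induce \<open>chi\<close>
  as well. With uniqueness, the definite description denotes this character.\<close>

lemma inducing_character_props: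
  assumes chi: "dirichlet_character q chi"
  shows "coprime a q \<Longrightarrow> inducing_character q chi a = chi a"
    and "cmod (inducing_character q chi b) \<le> 1"
proof -
  let ?P = "\<lambda>d. \<exists>psi. character_induced_by q chi d psi"
  have "?P q" using chi by (auto simp: character_induced_by_def)
  then have "?P (LEAST d. ?P d)" by (rule LeastI)
  then obtain d psi where d: "d = (LEAST d. ?P d)" and psi: "character_induced_by q chi d psi" by blast
  have "primitive_character d psi" unfolding primitive_character_def
  proof (intro conjI notI)
    show "dirichlet_character d psi" using psi by (simp add: character_induced_by_def)
    assume "\<exists>e xi. e < d \<and> character_induced_by d psi e xi"
    then obtain e xi where e: "e < d" "character_induced_by d psi e xi" by blast
    have "?P e" using character_induced_by_trans[OF psi e(2)] by blast
    then have "d \<le> e" unfolding d by (rule Least_le)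
    then show False using e(1) by simp
  qed
  then have ex: "\<exists>d. primitive_character d psi \<and> character_induced_by q chi d psi" using psi by blast
  have "\<exists>d. primitive_character d (inducing_character q chi) \<and>
      character_induced_by q chi d (inducing_character q chi)"
    unfolding inducing_character_def
    by (rule theI[where a = psi], rule ex) (use psi \<open>primitive_character d psi\<close> primitive_character_induced_unique in blast)
  then obtain d' where d': "character_induced_by q chi d' (inducing_character q chi)" by blast
  show "coprime a q \<Longrightarrow> inducing_character q chi a = chi a"
    using d' by (simp add: character_induced_by_def)
  show "cmod (inducing_character q chi b) \<le> 1"
    using d' by (auto simp: character_induced_by_def intro: dirichlet_character_norm_le)
qed

section \<open>Bounds for holomorphic logarithms\<close>

text \<open>The map taking w to w / (2 B - w) fixes 0 and sends the half-plane
  \<open>Re w < B\<close> into the unit disc. Schwarz's lemma, applied to its composition with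
  \<open>L\<close> rescaled to the unit disc, gives an inequality that is solved for
  \<open>cmod (L w)\<close>.\<close>

lemma Borel_Caratheodory:
  fixes L :: "complex \<Rightarrow> complex"
  assumes hol: "L holomorphic_on ball p R" and L0: "L p = 0"
    and B: "B > 0" and Re: "\<And>z. z \<in> ball p R \<Longrightarrow> Re (L z) < B"
    and w: "cmod (w - p) \<le> r" and r: "0 < r" "r < R"
  shows "cmod (L w) \<le> 2 * B * r / (R - r)"
proof -
  have R: "R > 0" using r by simp
  have inb: "p + of_real R * z \<in> ball p R" if "z \<in> ball 0 1" for z
    using that R by (simp add: dist_norm norm_mult)
  define A where "A z = L (p + of_real R * z)" for z
  have "L \<circ> (\<lambda>z. p + of_real R * z) holomorphic_on ball 0 1"
    using inb by (intro holomorphic_on_compose_gen[OF _ hol] holomorphic_intros) auto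
  then have A: "A holomorphic_on ball 0 1" by (simp add: A_def[abs_def] o_def)
  have ReA: "Re (A z) < B" if "z \<in> ball 0 1" for z using Re inb that by (simp add: A_def)
  have nz: "2 * of_real B - A z \<noteq> 0" if "z \<in> ball 0 1" for z
  proof
    assume "2 * of_real B - A z = 0"
    then have "Re (2 * of_real B - A z) = 0" by simp
    then show False using ReA[OF that] B by simp
  qed
  define h where "h z = A z / (2 * of_real B - A z)" for z
  have h: "h holomorphic_on ball 0 1" unfolding h_def
    using A nz by (intro holomorphic_intros) auto
  have lt: "cmod (h z) < 1" if "z \<in> ball 0 1" for z
  proof -
    have "(Re (A z))\<^sup>2 < (2 * B - Re (A z))\<^sup>2"
      using ReA[OF that] B by (simp add: power2_eq_square algebra_simps)
    then have "cmod (A z) < cmod (2 * of_real B - A z)"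
      by (simp add: cmod_def)
    then show ?thesis using nz[OF that] by (simp add: h_def norm_divide)
  qed
  define x where "x = (w - p) / of_real R"
  have cx: "cmod x \<le> r / R" using w R by (simp add: x_def norm_divide divide_right_mono)
  have rR: "r / R < 1" using r R by simp
  have x1: "x \<in> ball 0 1" using cx rR by simp
  have Ax: "A x = L w" using R by (simp add: A_def x_def)
  have "cmod (h x) \<le> cmod x"
    using Schwarz_Lemma(1)[OF h, of x] lt x1 L0 by (simp add: h_def A_def)
  then have "cmod (h x) \<le> r / R" using cx by simp
  then have "cmod (A x) \<le> r / R * cmod (2 * of_real B - A x)"
    using nz[OF x1] by (simp add: h_def norm_divide field_simps)
  also have "\<dots> \<le> r / R * (2 * B + cmod (A x))"
    using norm_triangle_ineq4[of "2 * of_real B" "A x"] B r R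
    by (intro mult_left_mono) (auto simp: norm_mult)
  finally have "cmod (A x) * (R - r) \<le> 2 * B * r" using R by (simp add: field_simps)
  then show ?thesis using r by (simp add: Ax pos_le_divide_eq)
qed

text \<open>Only finitely many Taylor coefficients of the logarithm are controlled by the bound on the
  small disc; the remaining ones, taken from the large disc, form a geometric tail.  This replaces
  the three circles theorem.\<close>
lemma norm_log_quotient_bound:
  fixes V :: "complex \<Rightarrow> complex"
  assumes hol: "V holomorphic_on ball z0 R" and nz: "\<And>z. z \<in> ball z0 R \<Longrightarrow> V z \<noteq> 0"
    and b: "b > 0" "\<And>z. z \<in> ball z0 r \<Longrightarrow> cmod (V z / V z0) < exp b"
    and B: "B > 0" "\<And>z. z \<in> ball z0 R \<Longrightarrow> cmod (V z / V z0) < exp B"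
    and r: "0 < r" "r \<le> R" and \<rho>: "0 < \<rho>" "\<rho> < R'" "R' < R"
    and w: "cmod (w - z0) \<le> \<rho>"
  shows "cmod (V z0 / V w) \<le>
    exp ((\<Sum>n<K. 2 * b * (2 * \<rho> / r) ^ n) + 2 * B * R' / (R - R') * (\<rho> / R') ^ K / (1 - \<rho> / R'))"
proof -
  have z0: "z0 \<in> ball z0 R" using \<rho> by simp
  have quot: "(\<lambda>z. V z / V z0) holomorphic_on ball z0 R"
    using hol nz[OF z0] by (intro holomorphic_intros) auto
  obtain g where g: "g holomorphic_on ball z0 R" "\<And>z. z \<in> ball z0 R \<Longrightarrow> V z / V z0 = exp (g z)"
    using contractible_imp_holomorphic_log[OF quot convex_imp_contractible] nz z0 by auto
  define L where "L z = g z - g z0" for z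
  have L: "L holomorphic_on ball z0 R" "L z0 = 0"
    unfolding L_def using g(1) by (auto intro!: holomorphic_intros)
  have eL: "V z / V z0 = exp (L z)" if "z \<in> ball z0 R" for z
    using g(2)[OF that] g(2)[OF z0] nz[OF z0] by (simp add: L_def exp_diff)
  have Re: "Re (L z) < c" if "z \<in> ball z0 R" "cmod (V z / V z0) < exp c" for z c
    using that eL by simp
  define a where "a n = (deriv ^^ n) L z0 / fact n" for n
  \<comment> \<open>Borel-Caratheodory on the ball of radius \<open>s\<close>, then Cauchy's
    inequality on the circle of radius \<open>t\<close>. The choice s = r, t = r / 2 with
    \<open>b\<close> serves the first \<open>K\<close> coefficients, s = R, t = R' with
    \<open>B\<close> the tail.\<close>
  have coeff: "cmod (a n) \<le> (2 * c * t / (s - t)) / t ^ n"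
    if "c > 0" "0 < t" "t < s" "s \<le> R" "\<And>z. z \<in> ball z0 s \<Longrightarrow> cmod (V z / V z0) < exp c" for c s t n
  proof -
    have sub: "ball z0 s \<subseteq> ball z0 R" using that by (simp add: subset_ball)
    have sub': "cball z0 t \<subseteq> ball z0 R" using that by auto
    have "cmod (L z) \<le> 2 * c * t / (s - t)" if "cmod (z0 - z) = t" for z
    proof (rule Borel_Caratheodory[where L = L and p = z0 and w = z])
      show "L holomorphic_on ball z0 s" using L(1) sub holomorphic_on_subset by blast
      show "Re (L z) < c" if "z \<in> ball z0 s" for z
        using Re sub that \<open>\<And>z. z \<in> ball z0 s \<Longrightarrow> cmod (V z / V z0) < exp c\<close> by blast
      show "cmod (z - z0) \<le> t" using that by (simp add: norm_minus_commute)
    qed (use \<open>c > 0\<close> \<open>0 < t\<close> \<open>t < s\<close> L in auto)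
    then have "cmod ((deriv ^^ n) L z0) \<le> fact n * (2 * c * t / (s - t)) / t ^ n"
    proof (intro Cauchy_inequality)
      show "L holomorphic_on ball z0 t" "continuous_on (cball z0 t) L"
        using L(1) sub' ball_subset_cball[of z0 t]
        by (meson holomorphic_on_subset holomorphic_on_imp_continuous_on order.trans)+
    qed (use \<open>0 < t\<close> in auto)
    then show ?thesis by (simp add: a_def norm_divide field_simps)
  qed
  have small: "cmod (a n) \<le> 2 * b * (2 / r) ^ n" for n
    using coeff[of b "r / 2" r n] b r by (simp add: field_simps power_divide)
  have large: "cmod (a n) \<le> 2 * B * R' / (R - R') / R' ^ n" for n
    using coeff[of B R' R n] B \<rho> by simp
  have wb: "w \<in> ball z0 R" using w \<rho> by (simp add: dist_norm norm_minus_commute)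
  have sums: "(\<lambda>n. a n * (w - z0) ^ n) sums L w"
    unfolding a_def using holomorphic_power_series[OF L(1) wb] .
  have q: "0 \<le> \<rho> / R'" "\<rho> / R' < 1" using \<rho> by auto
  let ?M = "2 * B * R' / (R - R')"
  have tb: "cmod (a n * (w - z0) ^ n) \<le> ?M * (\<rho> / R') ^ n" for n
  proof -
    have "cmod (a n * (w - z0) ^ n) \<le> (?M / R' ^ n) * \<rho> ^ n"
      unfolding norm_mult norm_power using large w \<rho> B
      by (intro mult_mono power_mono) auto
    then show ?thesis by (simp add: power_divide)
  qed
  have hb: "cmod (a n * (w - z0) ^ n) \<le> 2 * b * (2 * \<rho> / r) ^ n" for n
  proof -
    have "cmod (a n * (w - z0) ^ n) \<le> (2 * b * (2 / r) ^ n) * \<rho> ^ n"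
      unfolding norm_mult norm_power using small w \<rho> b r
      by (intro mult_mono power_mono) auto
    then show ?thesis by (simp add: power_divide power_mult_distrib)
  qed
  have geo: "(\<lambda>n. ?M * (\<rho> / R') ^ (n + K)) sums (?M * (\<rho> / R') ^ K / (1 - \<rho> / R'))"
    using sums_mult[OF geometric_sums[of "\<rho> / R'"], of "?M * (\<rho> / R') ^ K"] q
    by (simp add: power_add mult_ac)
  have "L w - (\<Sum>n<K. a n * (w - z0) ^ n) = (\<Sum>n. a (n + K) * (w - z0) ^ (n + K))"
    using suminf_minus_initial_segment[OF sums_summable[OF sums], of K] sums_unique[OF sums] by simp
  also have "cmod \<dots> \<le> (\<Sum>n. ?M * (\<rho> / R') ^ (n + K))"
    by (rule norm_suminf_le[OF _ sums_summable[OF geo]]) (rule tb)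
  also have "\<dots> = ?M * (\<rho> / R') ^ K / (1 - \<rho> / R')" using sums_unique[OF geo] by simp
  finally have tail: "cmod (L w - (\<Sum>n<K. a n * (w - z0) ^ n)) \<le> ?M * (\<rho> / R') ^ K / (1 - \<rho> / R')" .
  have "cmod (\<Sum>n<K. a n * (w - z0) ^ n) \<le> (\<Sum>n<K. 2 * b * (2 * \<rho> / r) ^ n)"
    by (rule order.trans[OF norm_sum sum_mono]) (rule hb)
  then have "cmod (L w) \<le> (\<Sum>n<K. 2 * b * (2 * \<rho> / r) ^ n) + ?M * (\<rho> / R') ^ K / (1 - \<rho> / R')"
    using tail norm_triangle_sub[of "L w" "\<Sum>n<K. a n * (w - z0) ^ n"] by linarith
  moreover have "cmod (V z0 / V w) = exp (- Re (L w))"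
  proof -
    have "V z0 / V w = exp (- L w)"
      using eL[OF wb] nz[OF z0] nz[OF wb] by (simp add: exp_minus field_simps)
    then show ?thesis by simp
  qed
  moreover have "- Re (L w) \<le> cmod (L w)" using abs_Re_le_cmod[of "L w"] by linarith
  ultimately show ?thesis by simp
qed

section \<open>Continuation of the zeta function\<close>

lemma holomorphic_on_suminf:
  fixes f :: "nat \<Rightarrow> complex \<Rightarrow> complex"
  assumes S: "open S" and hol: "\<And>n. f n holomorphic_on S"
    and bound: "\<And>x. x \<in> S \<Longrightarrow> \<exists>d h. 0 < d \<and> summable h \<and>
       (\<forall>\<^sub>F n in sequentially. \<forall>y\<in>ball x d \<inter> S. cmod (f n y) \<le> h n)"
  shows "(\<lambda>s. \<Sum>n. f n s) holomorphic_on S"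
proof -
  have "\<exists>g g'. \<forall>x\<in>S. ((\<lambda>n. f n x) sums g x) \<and> ((\<lambda>n. deriv (f n) x) sums g' x) \<and>
          (g has_field_derivative g' x) (at x)"
  proof (rule series_and_derivative_comparison_local[OF S _ bound])
    show "(f n has_field_derivative deriv (f n) x) (at x)" if "x \<in> S" for n x
      using holomorphic_derivI[OF hol S that] .
  qed
  then obtain g g' where g: "\<And>x. x \<in> S \<Longrightarrow> (\<lambda>n. f n x) sums g x"
      "\<And>x. x \<in> S \<Longrightarrow> (g has_field_derivative g' x) (at x)" by blast
  have "g holomorphic_on S"
    using g(2) S by (auto simp: holomorphic_on_open)
  then show ?thesis
    by (rule holomorphic_transform) (use g(1) sums_unique in blast)
qed

text \<open>The product bound makes the double family absolutely summable, so the interchange is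
  that of unordered sums; the remaining work identifies \<open>suminf\<close> with
  \<open>infsum\<close>.\<close>

lemma suminf_swap_product_bound:
  fixes f :: "nat \<Rightarrow> nat \<Rightarrow> complex"
  assumes bound: "\<And>m k. cmod (f m k) \<le> a m * b k" and a: "summable a" and b: "summable b"
    and nonneg: "\<And>m. a m \<ge> 0" "\<And>k. b k \<ge> 0"
  shows "(\<Sum>m. \<Sum>k. f m k) = (\<Sum>k. \<Sum>m. f m k)"
proof -
  have sr: "summable (\<lambda>k. norm (f m k))" for m
    by (rule summable_comparison_test[OF _ summable_mult[OF b, of "a m"]]) (use bound in auto)
  have sc: "summable (\<lambda>m. norm (f m k))" for k
    by (rule summable_comparison_test[OF _ summable_mult2[OF a, of "b k"]]) (use bound in auto)
  have rows: "cmod (\<Sum>k. f m k) \<le> a m * suminf b" for m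
    using norm_suminf_le[OF bound summable_mult[OF b]] suminf_mult[OF b] by simp
  have cols: "cmod (\<Sum>m. f m k) \<le> suminf a * b k" for k
    using norm_suminf_le[OF bound summable_mult2[OF a]] suminf_mult2[OF a] by simp
  have srow: "summable (\<lambda>m. norm (\<Sum>k. f m k))"
    by (rule summable_comparison_test[OF _ summable_mult2[OF a, of "suminf b"]]) (use rows in auto)
  have scol: "summable (\<lambda>k. norm (\<Sum>m. f m k))"
    by (rule summable_comparison_test[OF _ summable_mult[OF b, of "suminf a"]]) (use cols in auto)
  have inf: "infsum g UNIV = suminf g" if "summable (\<lambda>n. norm (g n))" for g :: "nat \<Rightarrow> complex"
    using norm_summable_imp_has_sum[OF that summable_sums[OF summable_norm_cancel[OF that]]]
    by (rule infsumI)
  have ab: "(\<lambda>(m, k). a m * b k) summable_on (UNIV \<times> UNIV)"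
  proof (rule summable_on_SigmaI[where g = "\<lambda>m. a m * suminf b"])
    show "((\<lambda>k. case (m, k) of (m, k) \<Rightarrow> a m * b k) has_sum a m * suminf b) UNIV" for m
      using sums_nonneg_imp_has_sum[OF sums_mult[OF summable_sums[OF b], of "a m"]] nonneg by simp
    show "(\<lambda>m. a m * suminf b) summable_on UNIV"
      using summable_nonneg_imp_summable_on[OF summable_mult2[OF a, of "suminf b"]] nonneg b
      by (simp add: suminf_nonneg)
  qed (use nonneg in auto)
  have "(\<lambda>x. norm (case x of (m, k) \<Rightarrow> f m k)) summable_on (UNIV \<times> UNIV)"
    by (rule summable_on_comparison_test[OF ab]) (use bound in auto)
  then have "(\<lambda>(m, k). f m k) summable_on (UNIV \<times> UNIV)" by (rule abs_summable_summable)
  then have "(\<Sum>\<^sub>\<infinity>m. \<Sum>\<^sub>\<infinity>k. f m k) = (\<Sum>\<^sub>\<infinity>k. \<Sum>\<^sub>\<infinity>m. f m k)"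
    by (rule infsum_swap_banach)
  then show "(\<Sum>m. \<Sum>k. f m k) = (\<Sum>k. \<Sum>m. f m k)"
    by (simp add: inf[OF sr] inf[OF sc] inf[OF srow] inf[OF scol])
qed

definition zeta_series :: "complex \<Rightarrow> complex" where
  "zeta_series s = (\<Sum>n. 1 / of_nat (Suc n) powr s)"

lemma norm_Suc_powr: "cmod (of_nat (Suc n) powr s) = real (Suc n) powr Re s"
  using norm_powr_real_powr[of "of_nat (Suc n)" s] by simp

lemma summable_Suc_powr:
  assumes "1 < \<sigma>" shows "summable (\<lambda>n. real (Suc n) powr (-\<sigma>))"
  using assms summable_Suc_iff[of "\<lambda>n. real n powr (-\<sigma>)"] summable_real_powr_iff[of "-\<sigma>"] by simp

lemma norm_summable_zeta_series:
  assumes "Re s > 1" shows "summable (\<lambda>n. cmod (1 / of_nat (Suc n) powr s))"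
  using summable_Suc_powr[OF assms] by (simp add: norm_divide norm_Suc_powr powr_minus_divide del: of_nat_Suc)

lemma zeta_series_sums:
  assumes "Re s > 1" shows "(\<lambda>n. 1 / of_nat (Suc n) powr s) sums zeta_series s"
  unfolding zeta_series_def
  by (rule summable_sums[OF summable_norm_cancel[OF norm_summable_zeta_series[OF assms]]])

text \<open>With \<open>a = n + 1\<close> this is \<open>s - 1\<close> times the difference between
  \<open>a powr (- s)\<close> and the integral of \<open>u powr (- s)\<close> over
  \<open>[a, a + 1]\<close>. The factor \<open>s - 1\<close> clears the denominator of that
  integral, so each term is entire.\<close>

definition zeta_term :: "nat \<Rightarrow> complex \<Rightarrow> complex" where
  "zeta_term n s = (s - 1) * of_nat (Suc n) powr (-s) +
     (of_nat (Suc (Suc n)) powr (1 - s) - of_nat (Suc n) powr (1 - s))"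

lemma mem_closed_segment_of_real:
  assumes "u \<in> closed_segment (complex_of_real a) (complex_of_real b)" "a \<le> b"
  shows "\<exists>t. u = of_real t \<and> a \<le> t \<and> t \<le> b"
proof -
  have "Im u = 0" "Re u \<in> closed_segment a b" using assms(1) by (simp_all add: closed_segment_same_Im)
  then show ?thesis using assms(2)
    by (intro exI[of _ "Re u"]) (simp add: complex_eq_iff closed_segment_eq_real_ivl)
qed

text \<open>The term is the remainder of the first-order Taylor expansion of
  \<open>u powr (1 - s)\<close> from \<open>a\<close> to \<open>a + 1\<close>. The second derivative
  carries \<open>u powr (- s - 1)\<close>, which for \<open>Re s \<ge> 0\<close> is largest in
  modulus at \<open>a\<close>; this makes the series converge for \<open>Re s > 0\<close>.\<close>

lemma zeta_term_bound:
  assumes "Re s \<ge> 0"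
  shows "cmod (zeta_term n s) \<le> cmod (s - 1) * cmod s * real (Suc n) powr (- Re s - 1)"
proof -
  define a :: real where "a = real (Suc n)"
  have a: "a > 0" by (simp add: a_def)
  define f where "f i u = (if i = 0 then u powr (1 - s) else if i = 1 then (1 - s) * u powr (- s)
      else (1 - s) * (- s) * u powr (- s - 1))" for i :: nat and u :: complex
  let ?S = "closed_segment (complex_of_real a) (complex_of_real (a + 1))"
  have S: "\<exists>t. u = complex_of_real t \<and> a \<le> t" if "u \<in> ?S" for u
    using mem_closed_segment_of_real[OF that] by auto
  have np: "of_real t \<notin> \<real>\<^sub>\<le>\<^sub>0" if "a \<le> t" for t
    using that a by (simp add: complex_nonpos_Reals_iff)
  have "cmod (f 0 (of_real (a + 1)) - (\<Sum>i\<le>1. f i (of_real a) * (of_real (a + 1) - of_real a) ^ i / fact i))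
     \<le> cmod (s - 1) * cmod s * a powr (- Re s - 1) * cmod (of_real (a + 1) - of_real a) ^ Suc 1 / fact 1"
  proof (rule complex_Taylor)
    show "(f i has_field_derivative f (Suc i) x) (at x within ?S)" if "x \<in> ?S" "i \<le> 1" for i x
    proof -
      have x: "x \<notin> \<real>\<^sub>\<le>\<^sub>0" using S[OF that(1)] np by auto
      have "i = 0 \<or> i = 1" using that by auto
      then show ?thesis
      proof
        assume "i = 0"
        then show ?thesis using has_field_derivative_powr[OF x, of "1 - s"]
          by (auto simp: f_def[abs_def] intro: has_field_derivative_at_within)
      next
        assume "i = 1"
        then show ?thesis
          using DERIV_cmult[OF has_field_derivative_powr[OF x, of "- s"], of "1 - s"]
          by (auto simp: f_def[abs_def] mult.assoc intro: has_field_derivative_at_within)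
      qed
    qed
    show "cmod (f (Suc 1) x) \<le> cmod (s - 1) * cmod s * a powr (- Re s - 1)" if x: "x \<in> ?S" for x
    proof -
      obtain t where t: "x = of_real t" "a \<le> t" using S[OF x] by blast
      have "cmod (x powr (- s - 1)) = t powr (- Re s - 1)"
        using t a norm_powr_real_powr[of x "- s - 1"] by simp
      also have "\<dots> \<le> a powr (- Re s - 1)" using t a assms by (intro powr_mono2') auto
      finally show ?thesis
        by (simp add: f_def norm_mult mult_left_mono norm_minus_commute mult_mono)
    qed
  qed (auto simp: f_def)
  then show ?thesis
    by (simp add: f_def zeta_term_def a_def algebra_simps norm_minus_commute)
qed

text \<open>The value of \<open>(s - 1) \<zeta>(s)\<close> for \<open>Re s > 0\<close>.\<close>
definition zeta_reg :: "complex \<Rightarrow> complex" where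
  "zeta_reg s = 1 + (\<Sum>n. zeta_term n s)"

lemma norm_zeta_reg_le:
  assumes s: "1 / 2 \<le> Re s"
  shows "cmod (zeta_reg s) \<le> 1 + cmod (s - 1) * cmod s * (\<Sum>n. real (Suc n) powr (- 3 / 2))"
proof -
  have sm: "summable (\<lambda>n. cmod (s - 1) * cmod s * real (Suc n) powr (- 3 / 2))"
    using summable_Suc_powr[of "3/2"] by (intro summable_mult) simp
  have "cmod (zeta_term n s) \<le> cmod (s - 1) * cmod s * real (Suc n) powr (- 3 / 2)" for n
    using s by (intro order.trans[OF zeta_term_bound] mult_left_mono powr_mono) auto
  then have "cmod (\<Sum>n. zeta_term n s) \<le> (\<Sum>n. cmod (s - 1) * cmod s * real (Suc n) powr (- 3 / 2))"
    by (rule norm_suminf_le[OF _ sm])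
  also have "\<dots> = cmod (s - 1) * cmod s * (\<Sum>n. real (Suc n) powr (- 3 / 2))"
    using summable_Suc_powr[of "3/2"] by (subst suminf_mult) simp_all
  finally show ?thesis unfolding zeta_reg_def using norm_triangle_ineq[of 1 "\<Sum>n. zeta_term n s"] by simp
qed

lemma open_Re_gt: "open {s. Re s > c}"
  using open_halfspace_Re_gt[of c] by simp

lemma holomorphic_zeta_reg: "zeta_reg holomorphic_on {s. Re s > 0}"
proof -
  have "(\<lambda>s. \<Sum>n. zeta_term n s) holomorphic_on {s. Re s > 0}"
  proof (rule holomorphic_on_suminf[OF open_Re_gt])
    show "zeta_term n holomorphic_on {s. Re s > 0}" for n
      unfolding zeta_term_def[abs_def] by (intro holomorphic_intros)
    fix x assume "x \<in> {s. Re s > 0}"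
    then have x: "Re x > 0" by simp
    define c where "c = Re x / 2"
    have c: "c > 0" using x by (simp add: c_def)
    define M where "M = cmod x + c + 1"
    show "\<exists>d h. 0 < d \<and> summable h \<and>
       (\<forall>\<^sub>F n in sequentially. \<forall>y\<in>ball x d \<inter> {s. Re s > 0}. cmod (zeta_term n y) \<le> h n)"
    proof (intro exI conjI eventuallyI ballI)
      show "0 < c" by fact
      show "summable (\<lambda>n. M * M * real (Suc n) powr (- (1 + c)))"
        using summable_Suc_powr[of "1 + c"] c by (intro summable_mult) simp
      fix n y assume "y \<in> ball x c \<inter> {s. Re s > 0}"
      then have y: "cmod (y - x) < c" by (simp add: dist_norm norm_minus_commute)
      have Rey: "Re y \<ge> c" using abs_Re_le_cmod[of "y - x"] y by (simp add: c_def)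
      have "cmod y \<le> M" "cmod (y - 1) \<le> M"
        using norm_triangle_sub[of y x] norm_triangle_ineq4[of y 1] y by (simp_all add: M_def)
      moreover have "M \<ge> 0" using c by (simp add: M_def)
      ultimately show "cmod (zeta_term n y) \<le> M * M * real (Suc n) powr (- (1 + c))"
        using Rey c by (intro order.trans[OF zeta_term_bound] mult_mono powr_mono) auto
    qed
  qed
  then show ?thesis unfolding zeta_reg_def[abs_def] by (intro holomorphic_intros)
qed

lemma zeta_reg_eq_series:
  assumes s: "Re s > 1"
  shows "zeta_reg s = (s - 1) * zeta_series s"
proof -
  have "(\<lambda>n. of_nat (Suc n) powr (1 - s)) \<longlonglongrightarrow> 0"
    using s by (intro tendsto_neg_powr_complex_of_nat filterlim_Suc) auto
  from telescope_sums[OF this]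
  have "(\<lambda>n. of_nat (Suc (Suc n)) powr (1 - s) - of_nat (Suc n) powr (1 - s)) sums (-1)" by simp
  moreover have "(\<lambda>n. (s - 1) * of_nat (Suc n) powr (- s)) sums ((s - 1) * zeta_series s)"
    using sums_mult[OF zeta_series_sums[OF s], of "s - 1"] by (simp add: powr_minus_divide)
  ultimately have "(\<lambda>n. zeta_term n s) sums ((s - 1) * zeta_series s + (-1))"
    unfolding zeta_term_def by (intro sums_add)
  then show ?thesis by (simp add: zeta_reg_def sums_iff)
qed

section \<open>Continuation of zeta to the punctured plane\<close>

lemma gbinomial_minus_power:
  fixes a x :: complex
  shows "((- a) gchoose n) * (- x) ^ n = pochhammer a n / fact n * x ^ n"
proof -
  have "((- a) gchoose n) * (- x) ^ n = pochhammer a n / fact n * ((- 1) ^ n * (- x) ^ n)"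
    by (simp add: gbinomial_pochhammer)
  also have "(- 1) ^ n * (- x) ^ n = x ^ n" by (simp flip: power_mult_distrib)
  finally show ?thesis .
qed

text \<open>The binomial series of \<open>(1 - 1 / m) powr (1 - s)\<close>, multiplied by
  \<open>m powr (1 - s)\<close>, with the terms of degree 0 and 1 moved to the right-hand side. In
  this form the right-hand side telescopes over \<open>m\<close>, apart from the summand with
  \<open>m powr (- s)\<close>.\<close>

lemma binomial_shift:
  fixes s :: complex
  assumes m: "2 \<le> (m::nat)"
  shows "(\<lambda>k. pochhammer (s - 1) (k + 2) / fact (k + 2) * of_nat m powr (- s - of_nat k - 1))
    sums (of_nat (m - 1) powr (1 - s) - of_nat m powr (1 - s) - (s - 1) * of_nat m powr (- s))"
proof -
  let ?M = "of_nat m :: complex"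
  have M: "?M \<noteq> 0" using m by simp
  have lt: "cmod (- 1 / ?M) < 1" using m by (simp add: norm_divide)
  have "(\<lambda>n. ((1 - s) gchoose n) * (- 1 / ?M) ^ n) sums (1 + (- 1 / ?M)) powr (1 - s)"
    by (rule gen_binomial_complex[OF lt])
  moreover have "((1 - s) gchoose n) * (- 1 / ?M) ^ n = pochhammer (s - 1) n / fact n / ?M ^ n" for n
    using gbinomial_minus_power[of "s - 1" n "1 / ?M"] by (simp add: power_divide)
  ultimately have "(\<lambda>n. pochhammer (s - 1) n / fact n / ?M ^ n) sums (1 + (- 1 / ?M)) powr (1 - s)"
    by simp
  from sums_mult[OF this, of "?M powr (1 - s)"]
  have "(\<lambda>n. pochhammer (s - 1) n / fact n * ?M powr (1 - s - of_nat n)) sums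
      (?M powr (1 - s) * (1 + (- 1 / ?M)) powr (1 - s))"
    using M by (simp add: powr_diff powr_nat' mult_ac)
  also have "?M powr (1 - s) * (1 + (- 1 / ?M)) powr (1 - s) = (?M * (1 + (- 1 / ?M))) powr (1 - s)"
    by (rule powr_times_real_left[symmetric]) auto
  also have "?M * (1 + (- 1 / ?M)) = of_nat (m - 1)"
    using M m by (simp add: field_simps of_nat_diff)
  finally have "(\<lambda>n. pochhammer (s - 1) n / fact n * ?M powr (1 - s - of_nat n)) sums (of_nat (m - 1) powr (1 - s))" .
  from sums_split_initial_segment[OF this, of 2]
  have "(\<lambda>k. pochhammer (s - 1) (k + 2) / fact (k + 2) * ?M powr (1 - s - of_nat (k + 2))) sums
    (of_nat (m - 1) powr (1 - s) - (\<Sum>n<2. pochhammer (s - 1) n / fact n * ?M powr (1 - s - of_nat n)))" .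
  moreover have "1 - s - of_nat (k + 2) = - s - of_nat k - 1" for k by simp
  moreover have "(\<Sum>n<2. pochhammer (s - 1) n / fact n * ?M powr (1 - s - of_nat n))
      = ?M powr (1 - s) + (s - 1) * ?M powr (- s)"
    by (simp add: eval_nat_numeral)
  ultimately show ?thesis by (simp only: diff_diff_add)
qed

lemma norm_pochhammer_le:
  fixes z :: complex
  assumes "cmod z \<le> R"
  shows "cmod (pochhammer z n) \<le> pochhammer R n"
proof (induction n)
  case (Suc n)
  have "cmod (z + of_nat n) \<le> R + of_nat n"
    using norm_triangle_ineq[of z "of_nat n"] assms by simp
  moreover have "R \<ge> 0" using order.trans[OF norm_ge_zero assms] .
  ultimately show ?case using Suc
    by (simp add: pochhammer_rec' norm_mult mult_mono)
qed auto

lemma pochhammer_nonneg_real: "(R::real) \<ge> 0 \<Longrightarrow> pochhammer R n \<ge> 0"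
  using order.trans[OF norm_ge_zero norm_pochhammer_le[of 0 R n]] by simp

text \<open>Up to a shift by two indices, compensated by the factor 4, this is the binomial series
  of \<open>(1 - 1 / 2) powr (- R)\<close>.\<close>

lemma summable_pochhammer_half:
  fixes R :: real
  assumes "R \<ge> 0"
  shows "summable (\<lambda>k. pochhammer R (k + 2) / fact (k + 2) * (1 / 2) ^ k)"
proof -
  have "(\<lambda>n. (of_real (- R) gchoose n) * (- 1 / 2) ^ n) sums (1 + (- 1 / 2 :: complex)) powr (of_real (- R))"
    by (rule gen_binomial_complex) simp
  then have "summable (\<lambda>n. (of_real (- R) gchoose n) * (- 1 / 2 :: complex) ^ n)" by (simp add: sums_iff)
  moreover have "(of_real (- R) gchoose n) * (- 1 / 2 :: complex) ^ n = of_real (pochhammer R n / fact n * (1 / 2) ^ n)" for n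
    using gbinomial_minus_power[of "of_real R" n "1 / 2"] by (simp add: pochhammer_of_real)
  ultimately have "summable (\<lambda>n. complex_of_real (pochhammer R n / fact n * (1 / 2) ^ n))" by simp
  then have "summable (\<lambda>n. pochhammer R n / fact n * (1 / 2) ^ n)"
    by (simp only: summable_complex_of_real)
  then have "summable (\<lambda>k. pochhammer R (k + 2) / fact (k + 2) * (1 / 2) ^ (k + 2))"
    by (rule summable_ignore_initial_segment)
  from summable_mult[OF this, of 4]
  have "summable (\<lambda>k. 4 * (pochhammer R (k + 2) / fact (k + 2) * (1 / 2) ^ (k + 2)))" .
  moreover have "4 * (pochhammer R (k + 2) / fact (k + 2) * (1 / 2) ^ (k + 2))
      = pochhammer R (k + 2) / fact (k + 2) * (1 / 2) ^ k" for k
    unfolding power_add by (simp add: power2_eq_square del: fact_Suc add_2_eq_Suc')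
  ultimately show ?thesis by simp
qed

lemma zeta_series_minus_1_sums:
  assumes "Re s > 1"
  shows "(\<lambda>n. of_nat (n + 2) powr (- s)) sums (zeta_series s - 1)"
  using sums_split_initial_segment[OF zeta_series_sums[OF assms], of 1]
  by (simp add: powr_minus_divide)

text \<open>The expansions of \<open>binomial_shift\<close> are summed over
  \<open>m = n + 2\<close>: the rows telescope, the columns are zeta values. All zeta values on the
  right belong to points at least one unit further to the right, so the formula continues zeta strip
  by strip. Subtracting 1 drops the term of \<open>m = 1\<close>, after which the columns decay like
  \<open>(1 / 2) ^ k\<close>.\<close>

lemma zeta_series_recurrence:
  assumes s: "Re s > 1"
  shows "(s - 1) * (zeta_series s - 1) =
    1 - (\<Sum>k. pochhammer (s - 1) (k + 2) / fact (k + 2) * (zeta_series (s + of_nat (k + 1)) - 1))"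
proof -
  let ?c = "\<lambda>k. pochhammer (s - 1) (k + 2) / fact (k + 2)"
  define f where "f n k = ?c k * of_nat (n + 2) powr (- s - of_nat k - 1)"
    for n k :: nat
  define R where "R = cmod (s - 1)"
  define a where "a n = real (n + 2) powr (- Re s)" for n
  define b where "b k = pochhammer R (k + 2) / fact (k + 2) * (1 / 2) ^ k" for k
  have R: "R \<ge> 0" by (simp add: R_def)
  have bound: "cmod (f n k) \<le> a n * b k" for n k
  proof -
    have "cmod (of_nat (n + 2) powr (- s - of_nat k - 1) :: complex) = real (n + 2) powr (- Re s - real k - 1)"
      using norm_Suc_powr[of "n + 1" "- s - of_nat k - 1"] by (simp add: add_ac)
    also have "\<dots> = real (n + 2) powr (- Re s + - real (k + 1))"
      by (intro arg_cong[where f = "\<lambda>x. _ powr x"]) simp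
    also have "\<dots> = a n * real (n + 2) powr (- real (k + 1))"
      unfolding a_def by (rule powr_add)
    also have "real (n + 2) powr (- real (k + 1)) = 1 / real (n + 2) ^ (k + 1)"
      by (subst powr_minus_divide, subst powr_realpow) auto
    also have "\<dots> \<le> 1 / 2 ^ (k + 1)"
      by (intro divide_left_mono power_mono) auto
    also have "\<dots> \<le> (1 / 2) ^ k" by (simp add: power_divide divide_simps)
    finally have 1: "cmod (of_nat (n + 2) powr (- s - of_nat k - 1) :: complex) \<le> a n * (1 / 2) ^ k"
      by (simp add: a_def mult_left_mono)
    have "cmod (?c k) \<le> pochhammer R (k + 2) / fact (k + 2)"
      using norm_pochhammer_le[of "s - 1" R "k + 2"] by (simp add: R_def norm_divide divide_right_mono del: fact_Suc)
    then have "cmod (f n k) \<le> pochhammer R (k + 2) / fact (k + 2) * (a n * (1 / 2) ^ k)"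
      unfolding f_def norm_mult using 1 R by (intro mult_mono) (auto intro!: divide_nonneg_nonneg pochhammer_nonneg_real simp del: fact_Suc)
    then show ?thesis by (simp add: b_def mult_ac)
  qed
  have sa: "summable a" unfolding a_def
    using summable_ignore_initial_segment[OF summable_Suc_powr[OF s], of 1] by (simp add: add_ac)
  have sb: "summable b" unfolding b_def by (rule summable_pochhammer_half[OF R])
  have b0: "b k \<ge> 0" for k using R by (auto simp: b_def intro!: mult_nonneg_nonneg divide_nonneg_nonneg pochhammer_nonneg_real simp del: fact_Suc)
  have rows: "(\<Sum>k. f n k) = of_nat (Suc n) powr (1 - s) - of_nat (Suc (Suc n)) powr (1 - s) - (s - 1) * of_nat (n + 2) powr (- s)" for n
    using binomial_shift[of "n + 2" s] by (simp add: f_def sums_iff add_ac)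
  have "(\<lambda>n. of_nat (Suc n) powr (1 - s)) \<longlonglongrightarrow> 0"
    using s by (intro tendsto_neg_powr_complex_of_nat filterlim_Suc) auto
  from telescope_sums'[OF this]
  have "(\<lambda>n. of_nat (Suc n) powr (1 - s) - of_nat (Suc (Suc n)) powr (1 - s) - (s - 1) * of_nat (n + 2) powr (- s))
      sums (1 - (s - 1) * (zeta_series s - 1))"
    by (intro sums_diff sums_mult zeta_series_minus_1_sums s) simp
  then have "(\<Sum>n. \<Sum>k. f n k) = 1 - (s - 1) * (zeta_series s - 1)"
    by (simp add: rows sums_iff)
  moreover have "(\<Sum>n. f n k) = ?c k * (zeta_series (s + of_nat (k + 1)) - 1)" for k
  proof -
    have "Re (s + of_nat (k + 1)) > 1" using s by simp
    note sums_mult[OF zeta_series_minus_1_sums[OF this], of "?c k"]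
    moreover have "- (s + of_nat (k + 1)) = - s - of_nat k - 1" by simp
    ultimately show ?thesis unfolding f_def by (simp only: sums_iff)
  qed
  ultimately show ?thesis
    using suminf_swap_product_bound[of f a b, OF bound sa sb] b0 by (simp add: a_def)
qed

text \<open>The recurrence read as a definition, with \<open>W\<close> in the role of
  \<open>(s - 1) * (zeta s - 1)\<close>. The last factor \<open>s + k\<close> of the Pochhammer
  symbol is the one already contained in \<open>W (s + k + 1)\<close>; hence the length
  \<open>k + 1\<close> in \<open>t\<close>, and no pole appears.\<close>

lemma zeta_continuation_step:
  fixes c :: nat
  assumes W: "W holomorphic_on {s. Re s > - real c}"
    and eq: "\<And>s. Re s > 1 \<Longrightarrow> W s = (s - 1) * (zeta_series s - 1)"
  shows "\<exists>W'. W' holomorphic_on {s. Re s > - real (Suc c)} \<and>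
    (\<forall>s. Re s > 1 \<longrightarrow> W' s = (s - 1) * (zeta_series s - 1))"
proof -
  define t where "t k s = pochhammer (s - 1) (k + 1) / fact (k + 2) * W (s + of_nat (k + 1))" for k s
  let ?S = "{s. Re s > - real (Suc c)}"
  let ?Z = "\<Sum>n. real (Suc n) powr (- 2)"
  \<comment> \<open>For \<open>Re z \<ge> 2\<close> the zeta series without its first term decays
    like \<open>2 powr (- Re z)\<close>. Two powers of \<open>n\<close> are held back for
    summability, which produces the 4.\<close>
  have Wb: "cmod (W z) \<le> cmod (z - 1) * (4 * (1/2) powr Re z * ?Z)" if z: "Re z \<ge> 2" for z
  proof -
    have sm: "summable (\<lambda>n. 4 * (1/2) powr Re z * real (Suc n) powr (- 2))"
      using summable_Suc_powr[of 2] by (intro summable_mult) simp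
    have "cmod (of_nat (n + 2) powr (- z) :: complex) \<le> 4 * (1/2) powr Re z * real (Suc n) powr (- 2)" for n
    proof -
      have "cmod (of_nat (n + 2) powr (- z) :: complex) = real (n + 2) powr (- 2) * real (n + 2) powr (- (Re z - 2))"
        using norm_Suc_powr[of "n + 1" "- z"] by (simp add: add_ac flip: powr_add)
      also have "\<dots> \<le> real (Suc n) powr (- 2) * 2 powr (- (Re z - 2))"
        using z by (intro mult_mono powr_mono2') auto
      also have "2 powr (- (Re z - 2)) = 4 * (1/2) powr Re z"
        by (simp add: powr_diff powr_divide)
      finally show ?thesis by (simp add: mult_ac)
    qed
    then have "cmod (\<Sum>n. of_nat (n + 2) powr (- z)) \<le> (\<Sum>n. 4 * (1/2) powr Re z * real (Suc n) powr (- 2))"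
      by (rule norm_suminf_le[OF _ sm])
    also have "\<dots> = 4 * (1/2) powr Re z * ?Z"
      using summable_Suc_powr[of 2] by (subst suminf_mult) simp_all
    finally have "cmod (zeta_series z - 1) \<le> 4 * (1/2) powr Re z * ?Z"
      using zeta_series_minus_1_sums[of z] z by (simp add: sums_iff)
    then show ?thesis using eq[of z] z by (simp add: norm_mult mult_left_mono)
  qed
  have Z: "?Z \<ge> 0" using summable_Suc_powr[of 2] by (intro suminf_nonneg) auto
  have "(\<lambda>s. \<Sum>k. t k s) holomorphic_on ?S"
  proof (rule holomorphic_on_suminf[OF open_Re_gt])
    show "t k holomorphic_on ?S" for k
    proof -
      have "W \<circ> (\<lambda>s. s + of_nat (k + 1)) holomorphic_on ?S"
        by (rule holomorphic_on_compose_gen[OF _ W]) (auto intro!: holomorphic_intros)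
      then have "(\<lambda>s. W (s + of_nat (k + 1))) holomorphic_on ?S" by (simp add: o_def)
      then show ?thesis unfolding t_def[abs_def] pochhammer_prod
        by (intro holomorphic_intros) auto
    qed
    fix x assume "x \<in> ?S"
    define R where "R = cmod x + 2"
    define C where "C = 4 * ?Z * 2 powr real (c + 2)"
    show "\<exists>d h. 0 < d \<and> summable h \<and>
       (\<forall>\<^sub>F n in sequentially. \<forall>y\<in>ball x d \<inter> ?S. cmod (t n y) \<le> h n)"
    proof (intro exI conjI)
      show "0 < (1::real)" by simp
      show "summable (\<lambda>k. C * (pochhammer R (k + 2) / fact (k + 2) * (1 / 2) ^ k))"
        by (intro summable_mult summable_pochhammer_half) (simp add: R_def)
      show "\<forall>\<^sub>F k in sequentially. \<forall>y\<in>ball x 1 \<inter> ?S.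
          cmod (t k y) \<le> C * (pochhammer R (k + 2) / fact (k + 2) * (1 / 2) ^ k)"
        \<comment> \<open>From \<open>k = c + 2\<close> on, the shifted argument has real part at
          least 2 on the whole half-plane, so \<open>Wb\<close> applies; finitely many earlier terms
          do not affect convergence.\<close>
        using eventually_ge_at_top[of "c + 2"]
      proof eventually_elim
        case (elim k)
        show ?case
        proof
          fix y assume y: "y \<in> ball x 1 \<inter> ?S"
          then have "cmod (y - x) < 1" by (simp add: dist_norm norm_minus_commute)
          then have yR: "cmod (y - 1) \<le> R" "cmod y \<le> R"
            using norm_triangle_sub[of y x] norm_triangle_ineq4[of y 1] by (simp_all add: R_def)
          let ?z = "y + of_nat (k + 1)"
          have Rez: "Re ?z \<ge> real k - real c" using y by simp
          have z2: "Re ?z \<ge> 2" using Rez elim by linarith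
          have "(1/2::real) powr Re ?z \<le> (1/2) powr (real k - real c)"
            using Rez by (intro powr_mono') auto
          also have "\<dots> = (1/2) ^ k * 2 powr real c"
            by (simp add: powr_diff powr_divide powr_realpow field_simps)
          also have "\<dots> \<le> (1/2) ^ k * 2 powr real (c + 2)" by (intro mult_left_mono powr_mono) auto
          finally have "4 * (1/2) powr Re ?z * ?Z \<le> 4 * ((1/2) ^ k * 2 powr real (c + 2)) * ?Z"
            using Z by (intro mult_right_mono mult_left_mono) auto
          also have "\<dots> = C * (1/2) ^ k" by (simp add: C_def)
          finally have 1: "4 * (1/2) powr Re ?z * ?Z \<le> C * (1/2) ^ k" .
          have "cmod (?z - 1) \<le> R + real (k + 1)"
            using norm_triangle_ineq[of y "of_nat k"] yR by simp
          then have W1: "cmod (W ?z) \<le> (R + real (k + 1)) * (C * (1/2) ^ k)"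
            by (intro order.trans[OF Wb[OF z2]] mult_mono 1 mult_nonneg_nonneg Z) (auto simp: R_def)
          have "cmod (t k y) \<le> (pochhammer R (k + 1) / fact (k + 2)) * ((R + real (k + 1)) * (C * (1/2) ^ k))"
            unfolding t_def norm_mult norm_divide using norm_pochhammer_le[OF yR(1), of "k + 1"] W1
            by (intro mult_mono divide_mono) (auto simp: R_def C_def Z intro!: divide_nonneg_nonneg pochhammer_nonneg_real simp del: fact_Suc)
          also have "\<dots> = C * (pochhammer R (k + 2) / fact (k + 2) * (1 / 2) ^ k)"
            using pochhammer_rec'[of R "k + 1"] by (simp add: mult_ac del: fact_Suc)
          finally show "cmod (t k y) \<le> C * (pochhammer R (k + 2) / fact (k + 2) * (1 / 2) ^ k)" .
        qed
      qed
    qed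
  qed
  then have "(\<lambda>s. 1 - (\<Sum>k. t k s)) holomorphic_on ?S" by (intro holomorphic_intros)
  moreover have "1 - (\<Sum>k. t k s) = (s - 1) * (zeta_series s - 1)" if s: "Re s > 1" for s
  proof -
    have "t k s = pochhammer (s - 1) (k + 2) / fact (k + 2) * (zeta_series (s + of_nat (k + 1)) - 1)" for k
      using eq[of "s + of_nat (k + 1)"] pochhammer_rec'[of "s - 1" "k + 1"] s
      by (simp add: t_def mult_ac add_ac del: fact_Suc)
    then show ?thesis using zeta_series_recurrence[OF s] by simp
  qed
  ultimately show ?thesis by blast
qed

text \<open>The recursion starts from \<open>zeta_reg s - (s - 1)\<close> on
  \<open>Re s > 0\<close>. The functions obtained agree on common half-planes by the identity
  theorem, since all are prescribed on \<open>Re s > 1\<close>, and so they glue; \<open>k s\<close>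
  selects a half-plane containing \<open>s\<close>.\<close>

lemma zeta_continuation_exists:
  "\<exists>W. W holomorphic_on UNIV \<and> (\<forall>s. Re s > 1 \<longrightarrow> W s = (s - 1) * (zeta_series s - 1))"
proof -
  have ex: "\<exists>W. W holomorphic_on {s. Re s > - real c} \<and>
      (\<forall>s. Re s > 1 \<longrightarrow> W s = (s - 1) * (zeta_series s - 1))" for c
  proof (induction c)
    case 0
    show ?case using holomorphic_zeta_reg zeta_reg_eq_series
      by (intro exI[of _ "\<lambda>s. zeta_reg s - (s - 1)"]) (auto intro!: holomorphic_intros simp: algebra_simps)
  next
    case (Suc c)
    then show ?case using zeta_continuation_step by blast
  qed
  then obtain W where W: "\<And>c. W c holomorphic_on {s. Re s > - real c}"
    "\<And>c s. Re s > 1 \<Longrightarrow> W c s = (s - 1) * (zeta_series s - 1)"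
    using choice[of "\<lambda>c W. W holomorphic_on {s. Re s > - real c} \<and>
      (\<forall>s. Re s > 1 \<longrightarrow> W s = (s - 1) * (zeta_series s - 1))"] by blast
  have agree: "W c s = W d s" if "c \<le> d" "Re s > - real c" for c d s
  proof (rule analytic_continuation_open[where s = "{s. Re s > 1}" and s' = "{s. Re s > - real c}"
      and f = "W c" and g = "W d"])
    show "{s. Re s > 1} \<noteq> {}" by (auto intro!: exI[of _ 2])
    show "connected {s. Re s > - real c}" by (intro convex_connected convex_halfspace_Re_gt)
    show "W d holomorphic_on {s. Re s > - real c}"
      using W(1) by (rule holomorphic_on_subset) (use that in auto)
  qed (use W that open_Re_gt in auto)
  define k where "k s = nat \<lceil>\<bar>Re s\<bar>\<rceil> + 1" for s
  have k: "Re s > - real (k s)" for s unfolding k_def by linarith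
  define F where "F s = W (k s) s" for s
  have F: "F s = W c s" if "Re s > - real c" for s c
  proof (cases "c \<le> k s")
    case True
    show ?thesis unfolding F_def by (rule agree[OF True that, symmetric])
  next
    case False
    then have "k s \<le> c" by simp
    from agree[OF this k] show ?thesis unfolding F_def .
  qed
  have "F holomorphic_on UNIV"
  proof -
    have "F field_differentiable at s" for s
    proof -
      have "F holomorphic_on {z. Re z > - real (k s)}"
        using W(1) by (rule holomorphic_transform) (auto simp: F)
      then show ?thesis using k[of s] open_Re_gt
        by (auto intro: holomorphic_on_imp_differentiable_at)
    qed
    then show ?thesis by (simp add: holomorphic_on_def field_differentiable_at_within)
  qed
  moreover have "F s = (s - 1) * (zeta_series s - 1)" if "Re s > 1" for s
    using F[of 0 s] W(2)[of s 0] that by simp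
  ultimately show ?thesis by blast
qed

text \<open>As \<open>zeta\<close> is a choice, its properties become available once some function
  meets the specification; \<open>W s / (s - 1) + 1\<close> does.\<close>

lemma zeta_holomorphic: "zeta holomorphic_on - {1}"
  and zeta_eq_series: "Re s > 1 \<Longrightarrow> zeta s = zeta_series s"
proof -
  let ?P = "\<lambda>F. F holomorphic_on (- {1}) \<and>
     (\<forall>s. Re s > 1 \<longrightarrow> (\<lambda>n. (\<lambda>_. 1) (Suc n) / of_nat (Suc n) powr s) sums F s)"
  obtain W where W: "W holomorphic_on UNIV" "\<And>s. Re s > 1 \<Longrightarrow> W s = (s - 1) * (zeta_series s - 1)"
    using zeta_continuation_exists by blast
  have "W s / (s - 1) + 1 = zeta_series s" if "Re s > 1" for s
    using W(2)[OF that] that by auto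
  moreover have "(\<lambda>s. W s / (s - 1) + 1) holomorphic_on - {1}"
    using W(1) by (intro holomorphic_intros) (auto intro: holomorphic_on_subset)
  ultimately have "?P (\<lambda>s. W s / (s - 1) + 1)" using zeta_series_sums by simp
  then have P: "?P zeta" unfolding zeta_def dirichlet_continuation_def by (rule someI[where P = ?P])
  then show "zeta holomorphic_on - {1}" by blast
  show "zeta s = zeta_series s" if "Re s > 1"
    using P that zeta_series_sums[OF that] sums_unique2 by blast
qed

lemma zeta_reg_eq_zeta:
  assumes "Re s > 0" "s \<noteq> 1"
  shows "zeta_reg s = (s - 1) * zeta s"
proof (rule analytic_continuation_open[where s = "{s. Re s > 1}" and s' = "{s. Re s > 0} - {1}"
      and f = zeta_reg and g = "\<lambda>s. (s - 1) * zeta s"])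
  show "{s. Re s > 1} \<noteq> {}" by (auto intro!: exI[of _ 2])
  show "connected ({s. Re s > 0} - {1::complex})"
    by (intro connected_open_delete open_Re_gt convex_connected convex_halfspace_Re_gt) simp
  show "zeta_reg holomorphic_on {s. Re s > 0} - {1}"
    using holomorphic_zeta_reg by (rule holomorphic_on_subset) auto
  show "(\<lambda>s. (s - 1) * zeta s) holomorphic_on {s. Re s > 0} - {1}"
    using zeta_holomorphic by (intro holomorphic_intros) (auto intro: holomorphic_on_subset)
  show "zeta_reg z = (z - 1) * zeta z" if "z \<in> {s. Re s > 1}" for z
    using that by (simp add: zeta_reg_eq_series zeta_eq_series)
qed (use assms open_Re_gt in \<open>auto intro!: open_Diff\<close>)

lemma zeta_reg_1: "zeta_reg 1 = 1"
  by (simp add: zeta_reg_def zeta_term_def del: of_nat_Suc)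

section \<open>Dirichlet series and non-vanishing\<close>

lemma moebius_mu_prime_mult:
  assumes p: "prime (p::nat)" "\<not> p dvd d" and d: "d > 0"
  shows "moebius_mu (p * d) = - moebius_mu d"
proof -
  have cop: "coprime p d" using p by (rule prime_imp_coprime)
  have sq: "squarefree (p * d) \<longleftrightarrow> squarefree d"
    using squarefree_mult_coprime[OF cop] squarefree_prime[OF p(1)] squarefree_multD by blast
  have "prime_factors (p * d) = insert p (prime_factors d)"
    using p d by (subst prime_factors_product) (auto simp: prime_factorization_prime)
  moreover have "p \<notin> prime_factors d" using p by auto
  ultimately have "card (prime_factors (p * d)) = Suc (card (prime_factors d))" by simp
  then show ?thesis by (simp add: moebius_mu_def sq)
qed

text \<open>For a prime \<open>p\<close> dividing \<open>n\<close>, multiplication by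
  \<open>p\<close> matches the squarefree divisors not divisible by \<open>p\<close> with the
  divisible ones and reverses the sign of \<open>moebius_mu\<close>.\<close>

lemma sum_moebius_mu_divisors:
  assumes n: "n > 0"
  shows "(\<Sum>d | d dvd n. moebius_mu d) = (if n = 1 then 1 else 0)"
proof (cases "n = 1")
  case True
  then show ?thesis by (simp add: moebius_mu_def)
next
  case False
  then obtain p where p: "prime p" "p dvd n" using prime_factor_nat by blast
  have fin: "finite {d. d dvd n}" using n by simp
  let ?A = "{d. d dvd n \<and> squarefree d \<and> \<not> p dvd d}"
  let ?B = "{d. d dvd n \<and> squarefree d \<and> p dvd d}"
  have AB: "finite ?A" "finite ?B" using fin by (auto elim: finite_subset[rotated])
  have B: "?B = (\<lambda>d. p * d) ` ?A"
  proof (intro equalityI subsetI)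
    fix x assume x: "x \<in> ?B"
    then obtain d where d: "x = p * d" by blast
    have "squarefree d" using x d squarefree_multD by blast
    moreover have "\<not> p dvd d"
    proof
      assume "p dvd d"
      then have "p\<^sup>2 dvd x" using d by (simp add: power2_eq_square mult_dvd_mono)
      then have "is_unit p" using x by (simp add: squarefree_def)
      then show False using p(1) by simp
    qed
    moreover have "d dvd n" using x d dvd_mult_right by blast
    ultimately show "x \<in> (\<lambda>d. p * d) ` ?A" using d by blast
  next
    fix x assume "x \<in> (\<lambda>d. p * d) ` ?A"
    then obtain d where d: "x = p * d" "d dvd n" "squarefree d" "\<not> p dvd d" by blast
    have cop: "coprime p d" using p(1) d(4) by (rule prime_imp_coprime)
    have "p * d dvd n" using cop p(2) d(2) by (rule divides_mult[rotated 2])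
    moreover have "squarefree (p * d)"
      using squarefree_mult_coprime[OF cop] squarefree_prime[OF p(1)] d by blast
    ultimately show "x \<in> ?B" using d by simp
  qed
  have inj: "inj_on (\<lambda>d. p * d) ?A" using p by (auto intro!: inj_onI simp: prime_gt_0_nat)
  have "(\<Sum>d | d dvd n. moebius_mu d) = (\<Sum>d\<in>?A \<union> ?B. moebius_mu d)"
    using fin by (intro sum.mono_neutral_right) (auto simp: moebius_mu_def)
  also have "\<dots> = (\<Sum>d\<in>?A. moebius_mu d) + (\<Sum>d\<in>?B. moebius_mu d)"
    using AB by (intro sum.union_disjoint) auto
  also have "(\<Sum>d\<in>?B. moebius_mu d) = (\<Sum>d\<in>?A. moebius_mu (p * d))"
    unfolding B by (rule sum.reindex_cong[OF inj]) simp_all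
  also have "\<dots> = (\<Sum>d\<in>?A. - moebius_mu d)"
    using p n by (intro sum.cong refl moebius_mu_prime_mult) (auto intro!: Nat.gr0I)
  finally show ?thesis using False by (simp add: sum_negf)
qed

lemma abs_moebius_mu_le: "\<bar>moebius_mu n\<bar> \<le> 1"
  by (simp add: moebius_mu_def power_abs)

text \<open>Dirichlet series are indexed from 0, with \<open>n\<close>-th term belonging to \<open>n + 1\<close>.\<close>
lemma dirichlet_series_mult:
  fixes f g :: "nat \<Rightarrow> complex" and s :: complex
  defines "F \<equiv> \<lambda>n. f (Suc n) / of_nat (Suc n) powr s" and "G \<equiv> \<lambda>n. g (Suc n) / of_nat (Suc n) powr s"
  assumes f: "summable (\<lambda>n. cmod (F n))" and g: "summable (\<lambda>n. cmod (G n))"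
  shows "(\<lambda>n. (\<Sum>d | d dvd Suc n. f d * g (Suc n div d)) / of_nat (Suc n) powr s) sums (suminf F * suminf G)"
proof -
  let ?FG = "suminf F * suminf G"
  define F' where "F' n = f n / of_nat n powr s" for n
  define G' where "G' n = g n / of_nat n powr s" for n
  let ?A = "{0<..} :: nat set"
  have bij: "bij_betw Suc UNIV ?A"
    by (rule bij_betwI[where g = "\<lambda>n. n - 1"]) auto
  have hs: "(h has_sum (\<Sum>n. h (Suc n))) ?A" if "summable (\<lambda>n. norm (h (Suc n)))" for h :: "nat \<Rightarrow> 'b::banach"
    using norm_summable_imp_has_sum[OF that summable_sums[OF summable_norm_cancel[OF that]]]
      has_sum_reindex_bij_betw[OF bij, of h] by simp
  have F': "(F' has_sum suminf F) ?A" using hs[of F'] f by (simp add: F_def F'_def)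
  have G': "(G' has_sum suminf G) ?A" using hs[of G'] g by (simp add: G_def G'_def)
  have nF: "((\<lambda>n. cmod (F' n)) has_sum (\<Sum>n. cmod (F n))) ?A"
    using hs[of "\<lambda>n. cmod (F' n)"] f by (simp add: F_def F'_def)
  have nG: "((\<lambda>n. cmod (G' n)) has_sum (\<Sum>n. cmod (G n))) ?A"
    using hs[of "\<lambda>n. cmod (G' n)"] g by (simp add: G_def G'_def)
  have "(\<lambda>(m, k). cmod (F' m) * cmod (G' k)) summable_on (?A \<times> ?A)"
  proof (rule summable_on_SigmaI[where g = "\<lambda>m. cmod (F' m) * (\<Sum>n. cmod (G n))"])
    show "((\<lambda>k. case (m, k) of (m, k) \<Rightarrow> cmod (F' m) * cmod (G' k)) has_sum cmod (F' m) * (\<Sum>n. cmod (G n))) ?A" for m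
      using has_sum_cmult_right[OF nG, of "cmod (F' m)"] by simp
    show "(\<lambda>m. cmod (F' m) * (\<Sum>n. cmod (G n))) summable_on ?A"
      using has_sum_cmult_left[OF nF] has_sum_imp_summable by blast
  qed auto
  then have "(\<lambda>x. norm (case x of (m, k) \<Rightarrow> F' m * G' k)) summable_on (?A \<times> ?A)"
    by (simp add: case_prod_unfold norm_mult)
  then have sm: "(\<lambda>(m, k). F' m * G' k) summable_on (?A \<times> ?A)" by (rule abs_summable_summable)
  have "((\<lambda>(m, k). F' m * G' k) has_sum (?FG)) (?A \<times> ?A)"
  proof (rule has_sum_SigmaI[OF _ _ sm])
    show "((\<lambda>k. case (m, k) of (m, k) \<Rightarrow> F' m * G' k) has_sum F' m * suminf G) ?A" for m
      using has_sum_cmult_right[OF G', of "F' m"] by simp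
    show "((\<lambda>m. F' m * suminf G) has_sum ?FG) ?A"
      using has_sum_cmult_left[OF F', of "suminf G"] .
  qed
  \<comment> \<open>Absolute summability allows the pairs to be collected by their product:
    \<open>(m, k)\<close> becomes \<open>(n, d)\<close> with n = m k and d = m.\<close>
  also have "?this \<longleftrightarrow> ((\<lambda>(n, d). F' d * G' (n div d)) has_sum (?FG)) (Sigma ?A (\<lambda>n. {d. d dvd n}))"
    by (rule has_sum_reindex_bij_witness[of _ "\<lambda>(n, d). (d, n div d)" "\<lambda>(a, b). (a * b, a)"])
       (auto elim!: dvdE)
  finally have "((\<lambda>(n, d). F' d * G' (n div d)) has_sum (?FG)) (Sigma ?A (\<lambda>n. {d. d dvd n}))" .
  moreover have "((\<lambda>d. case (n, d) of (n, d) \<Rightarrow> F' d * G' (n div d)) has_sum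
      (\<Sum>d | d dvd n. f d * g (n div d)) / of_nat n powr s) {d. d dvd n}" if n: "n \<in> ?A" for n
  proof (rule has_sum_finiteI)
    show "finite {d. d dvd n}" using n by simp
    have "F' d * G' (n div d) = f d * g (n div d) / of_nat n powr s" if d: "d dvd n" for d
    proof -
      obtain e where e: "n = d * e" using d by blast
      have "d > 0" "e > 0" using n e by auto
      moreover have "(of_nat n :: complex) powr s = of_nat d powr s * of_nat e powr s"
        unfolding e of_nat_mult by (rule powr_times_real) auto
      ultimately show ?thesis by (simp add: F'_def G'_def e)
    qed
    then show "(\<Sum>d | d dvd n. f d * g (n div d)) / of_nat n powr s = (\<Sum>d | d dvd n. case (n, d) of (n, d) \<Rightarrow> F' d * G' (n div d))"
      by (simp add: sum_divide_distrib)
  qed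
  ultimately have "((\<lambda>n. (\<Sum>d | d dvd n. f d * g (n div d)) / of_nat n powr s) has_sum (?FG)) ?A"
    by (rule has_sum_SigmaD)
  then have "((\<lambda>n. (\<Sum>d | d dvd Suc n. f d * g (Suc n div d)) / of_nat (Suc n) powr s) has_sum (?FG)) UNIV"
    using has_sum_reindex_bij_betw[OF bij, of "\<lambda>n. (\<Sum>d | d dvd n. f d * g (n div d)) / of_nat n powr s"] by simp
  then show ?thesis by (rule has_sum_imp_sums)
qed

lemma norm_summable_moebius_series:
  assumes "Re s > 1"
  shows "summable (\<lambda>n. cmod (of_int (moebius_mu (Suc n)) / of_nat (Suc n) powr s))"
proof (rule summable_comparison_test'[OF norm_summable_zeta_series[OF assms]])
  show "norm (cmod (of_int (moebius_mu (Suc n)) / of_nat (Suc n) powr s)) \<le> cmod (1 / of_nat (Suc n) powr s)" for n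
    using abs_moebius_mu_le[of "Suc n"] by (simp add: norm_divide divide_right_mono del: of_nat_Suc flip: of_int_abs)
qed

lemma moebius_series_times_zeta:
  assumes s: "Re s > 1"
  shows "zeta_series s * (\<Sum>n. of_int (moebius_mu (Suc n)) / of_nat (Suc n) powr s) = 1"
proof -
  let ?M = "\<Sum>n. of_int (moebius_mu (Suc n)) / of_nat (Suc n) powr s"
  have "(\<lambda>n. (\<Sum>d | d dvd Suc n. of_int (moebius_mu d) * 1) / of_nat (Suc n) powr s) sums
      ((?M) * zeta_series s)"
    unfolding zeta_series_def
    by (rule dirichlet_series_mult[where g = "\<lambda>_. 1"])
       (use norm_summable_moebius_series[OF s] norm_summable_zeta_series[OF s] in auto)
  moreover have "(\<Sum>d | d dvd Suc n. of_int (moebius_mu d) * 1) / of_nat (Suc n) powr s = (if n = 0 then 1 else 0 :: complex)" for n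
    using sum_moebius_mu_divisors[of "Suc n"] by (cases "n = 0") (simp_all flip: of_int_sum)
  ultimately have "(\<lambda>n. if n = 0 then 1 else 0) sums
      ((?M) * zeta_series s)" by simp
  then show ?thesis using sums_unique2[OF _ sums_single[of 0 "\<lambda>_. 1"]] by (simp add: mult.commute)
qed

lemma zeta_series_nonzero: "Re s > 1 \<Longrightarrow> zeta_series s \<noteq> 0"
  using moebius_series_times_zeta[of s] by auto

section \<open>Non-vanishing of zeta on the line Re s = 1\<close>

lemma zeta_series_has_derivative:
  "\<exists>g'. \<forall>s. Re s > 1 \<longrightarrow> (\<lambda>n. - (of_real (ln (real (Suc n))) / of_nat (Suc n) powr s)) sums g' s \<and>
     (zeta_series has_field_derivative g' s) (at s)"
proof -
  let ?S = "{s. Re s > 1}"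
  define f where "f n s = 1 / of_nat (Suc n) powr s" for n and s :: complex
  define f' where "f' n s = - (of_real (ln (real (Suc n))) / of_nat (Suc n) powr s)" for n and s :: complex
  have "\<exists>g g'. \<forall>x\<in>?S. ((\<lambda>n. f n x) sums g x) \<and> ((\<lambda>n. f' n x) sums g' x) \<and>
          (g has_field_derivative g' x) (at x)"
  proof (rule series_and_derivative_comparison_local[OF open_Re_gt])
    show "(f n has_field_derivative f' n x) (at x)" if "x \<in> ?S" for n x
    proof -
      have nz: "of_nat (Suc n) \<noteq> (0::complex)" by (simp del: of_nat_Suc)
      have "Ln (of_nat (Suc n)) = of_real (ln (real (Suc n)))"
        using Ln_of_real[of "real (Suc n)"] by simp
      then have "((\<lambda>s. of_nat (Suc n) powr (- s)) has_field_derivative f' n x) (at x)"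
        unfolding f'_def using nz
        by (auto intro!: derivative_eq_intros simp: powr_minus_divide simp del: of_nat_Suc)
      then show ?thesis by (simp add: f_def[abs_def] powr_minus_divide del: of_nat_Suc)
    qed
    fix x assume "x \<in> ?S"
    then have x: "Re x > 1" by simp
    define c where "c = (Re x - 1) / 2"
    have c: "c > 0" using x by (simp add: c_def)
    show "\<exists>d h. 0 < d \<and> summable h \<and> (\<forall>\<^sub>F n in sequentially. \<forall>y\<in>ball x d \<inter> ?S. norm (f n y) \<le> h n)"
    proof (intro exI conjI eventuallyI ballI)
      show "0 < c" by fact
      show "summable (\<lambda>n. real (Suc n) powr (- (1 + c)))" using c by (intro summable_Suc_powr) simp
      fix n y assume "y \<in> ball x c \<inter> ?S"
      then have "cmod (y - x) < c" by (simp add: dist_norm norm_minus_commute)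
      then have "Re y \<ge> 1 + c" using abs_Re_le_cmod[of "y - x"] by (simp add: c_def field_simps)
      then have "real (Suc n) powr (- Re y) \<le> real (Suc n) powr (- (1 + c))" by (intro powr_mono) auto
      then show "norm (f n y) \<le> real (Suc n) powr (- (1 + c))"
        by (simp add: f_def norm_divide norm_Suc_powr powr_minus_divide del: of_nat_Suc)
    qed
  qed
  then obtain g g' where g: "\<And>x. x \<in> ?S \<Longrightarrow> (\<lambda>n. f n x) sums g x" "\<And>x. x \<in> ?S \<Longrightarrow> (\<lambda>n. f' n x) sums g' x"
    "\<And>x. x \<in> ?S \<Longrightarrow> (g has_field_derivative g' x) (at x)" by blast
  have "g x = zeta_series x" if "x \<in> ?S" for x
    using g(1)[OF that] zeta_series_sums[of x] that sums_unique2 by (force simp: f_def)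
  then have "(zeta_series has_field_derivative g' x) (at x)" if "x \<in> ?S" for x
    using g(3)[OF that] that open_Re_gt by (auto intro: has_field_derivative_transform_within_open)
  then show ?thesis using g(2) by (auto simp: f'_def intro!: exI[of _ g'])
qed

text \<open>The divisor sums of \<open>mangoldt\<close> are logarithms, so the product of its
  Dirichlet series with \<open>zeta_series\<close> is minus the derivative of
  \<open>zeta_series\<close>.\<close>

lemma mangoldt_series:
  assumes s: "Re s > 1"
  shows "summable (\<lambda>n. mangoldt (Suc n) / of_nat (Suc n) powr s :: complex)"
    and "(\<Sum>n. mangoldt (Suc n) / of_nat (Suc n) powr s) = - (deriv zeta_series s / zeta_series s)"
    and "zeta_series field_differentiable (at s)"
proof -
  let ?P = "\<Sum>n. mangoldt (Suc n) / of_nat (Suc n) powr s"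
  obtain g' where g': "\<And>s. Re s > 1 \<Longrightarrow> (\<lambda>n. - (of_real (ln (real (Suc n))) / of_nat (Suc n) powr s)) sums g' s"
    "\<And>s. Re s > 1 \<Longrightarrow> (zeta_series has_field_derivative g' s) (at s)"
    using zeta_series_has_derivative by blast
  show "zeta_series field_differentiable (at s)" using g'(2)[OF s] field_differentiable_def by blast
  have d: "deriv zeta_series s = g' s" using g'(2)[OF s] by (rule DERIV_imp_deriv)
  \<comment> \<open>At the real point \<open>Re s\<close> the terms of the derivative series all
    have one sign, so its convergence there is absolute convergence at \<open>s\<close>. The
    logarithmic series in turn majorizes the one with \<open>mangoldt\<close>.\<close>
  let ?t = "complex_of_real (Re s)"
  have "(\<lambda>n. - (- (of_real (ln (real (Suc n))) / of_nat (Suc n) powr ?t))) sums (- g' ?t)"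
    using s by (intro sums_minus g'(1)) simp
  from sums_summable[OF sums_Re[OF this]]
  have "summable (\<lambda>n. Re (- (- (of_real (ln (real (Suc n))) / of_nat (Suc n) powr ?t))))" .
  moreover have "Re (- (- (of_real (ln (real (Suc n))) / of_nat (Suc n) powr ?t))) = ln (real (Suc n)) / real (Suc n) powr Re s" for n
    using powr_of_real[of "real (Suc n)" "Re s"] by simp
  ultimately have sl: "summable (\<lambda>n. ln (real (Suc n)) / real (Suc n) powr Re s)" by (simp only:)
  have sm: "summable (\<lambda>n. cmod (mangoldt (Suc n) / of_nat (Suc n) powr s))"
  proof (rule summable_comparison_test'[OF sl])
    fix n :: nat
    have "(mangoldt (Suc n) :: real) \<le> (\<Sum>d | d dvd Suc n. mangoldt d)"
      by (rule member_le_sum) (auto simp: mangoldt_nonneg)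
    also have "\<dots> = ln (real (Suc n))" using mangoldt_sum[of "Suc n", where 'a = real] by simp
    finally show "norm (cmod (mangoldt (Suc n) / of_nat (Suc n) powr s)) \<le> ln (real (Suc n)) / real (Suc n) powr Re s"
      by (simp add: norm_divide norm_Suc_powr divide_right_mono mangoldt_nonneg del: of_nat_Suc)
  qed
  then show "summable (\<lambda>n. mangoldt (Suc n) / of_nat (Suc n) powr s :: complex)" by (rule summable_norm_cancel)
  have "(\<lambda>n. (\<Sum>d | d dvd Suc n. mangoldt d * 1) / of_nat (Suc n) powr s) sums
      ((?P) * zeta_series s)"
    unfolding zeta_series_def
    by (rule dirichlet_series_mult[where g = "\<lambda>_. 1"]) (use sm norm_summable_zeta_series[OF s] in auto)
  then have "(\<lambda>n. of_real (ln (real (Suc n))) / of_nat (Suc n) powr s) sums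
      ((?P) * zeta_series s)"
    using mangoldt_sum[where 'a = complex] by (simp del: of_nat_Suc)
  moreover have "(\<lambda>n. of_real (ln (real (Suc n))) / of_nat (Suc n) powr s) sums (- g' s)"
    using sums_minus[OF g'(1)[OF s]] by simp
  ultimately have "(?P) * zeta_series s = - g' s"
    by (rule sums_unique2)
  then show "(?P) = - (deriv zeta_series s / zeta_series s)"
    using zeta_series_nonzero[OF s] d by (simp add: field_simps)
qed

text \<open>Termwise this is 3 + 4 cos u + cos 2u = 2 (1 + cos u)^2, where the unimodular number
  \<open>w\<close> stands for exp(i u).\<close>

lemma mangoldt_series_3_4_1:
  fixes \<sigma> t :: real
  assumes \<sigma>: "\<sigma> > 1"
  defines "P \<equiv> \<lambda>s. \<Sum>n. mangoldt (Suc n) / of_nat (Suc n) powr s :: complex"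
  shows "0 \<le> Re (3 * P (of_real \<sigma>) + 4 * P (Complex \<sigma> t) + P (Complex \<sigma> (2 * t)))"
proof -
  let ?P = "3 * P (of_real \<sigma>) + 4 * P (Complex \<sigma> t) + P (Complex \<sigma> (2 * t))"
  have sm: "summable (\<lambda>n. mangoldt (Suc n) / of_nat (Suc n) powr s :: complex)" if "Re s = \<sigma>" for s
    using mangoldt_series(1)[of s] that \<sigma> by simp
  define T where "T n s = (mangoldt (Suc n) / of_nat (Suc n) powr s :: complex)" for n s
  let ?L = "\<lambda>n. 3 * T n (of_real \<sigma>) + 4 * T n (Complex \<sigma> t) + T n (Complex \<sigma> (2 * t))"
  have "(\<lambda>n. ?L n) sums
      (?P)"
    unfolding T_def P_def by (intro sums_add sums_mult summable_sums sm) auto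
  then have sums: "(\<lambda>n. Re (?L n)) sums
      Re (?P)" by (rule sums_Re)
  have nonneg: "0 \<le> Re (?L n)" for n
  proof -
    let ?N = "of_nat (Suc n) :: complex"
    have N: "?N \<noteq> 0" by (simp del: of_nat_Suc)
    define w where "w = ?N powr (- (\<i> * of_real t))"
    have w: "cmod w = 1" using norm_Suc_powr[of n "- (\<i> * of_real t)"] by (simp add: w_def del: of_nat_Suc)
    define r where "r = mangoldt (Suc n) * real (Suc n) powr (- \<sigma>)"
    have r: "r \<ge> 0" by (simp add: r_def mangoldt_nonneg)
    have T0: "T n (of_real \<sigma>) = of_real r"
      using powr_of_real[of "real (Suc n)" "\<sigma>"]
      by (simp add: T_def r_def powr_minus_divide)
    have T1: "T n (of_real \<sigma> + z) = of_real r * ?N powr (- z)" for z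
      using N T0 by (simp add: T_def powr_add powr_minus_divide del: of_nat_Suc flip: divide_divide_eq_left)
    have "T n (Complex \<sigma> t) = of_real r * w"
      using T1[of "\<i> * of_real t"] by (simp add: w_def Complex_eq)
    moreover have "T n (Complex \<sigma> (2 * t)) = of_real r * w\<^sup>2"
    proof -
      have "- (\<i> * of_real (2 * t)) = - (\<i> * of_real t) + - (\<i> * of_real t)" by simp
      then have "?N powr (- (\<i> * of_real (2 * t))) = w\<^sup>2"
        unfolding w_def power2_eq_square by (simp only: powr_add)
      then show ?thesis using T1[of "\<i> * of_real (2 * t)"] by (simp add: Complex_eq)
    qed
    ultimately have "Re (?L n)
        = r * (3 + 4 * Re w + ((Re w)\<^sup>2 - (Im w)\<^sup>2))"
      by (simp add: T0 algebra_simps power2_eq_square)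
    also have "(Re w)\<^sup>2 - (Im w)\<^sup>2 = 2 * (Re w)\<^sup>2 - 1"
      using w cmod_power2[of w] by simp
    also have "3 + 4 * Re w + (2 * (Re w)\<^sup>2 - 1) = 2 * (1 + Re w)\<^sup>2"
      by (simp add: power2_eq_square algebra_simps)
    finally show ?thesis using r by simp
  qed
  show ?thesis by (rule sums_le[OF nonneg sums_zero sums])
qed

text \<open>\<open>m\<close> is the multiplicity of \<open>z\<close> as a zero of \<open>F\<close>.
  Writing \<open>F u = (u - z) ^ m * g u\<close>, the logarithmic derivative at \<open>z + x\<close>
  is \<open>m / x\<close> plus a bounded term. The point \<open>w\<close> guarantees that the
  multiplicity is finite.\<close>

lemma logarithmic_derivative_limit:
  fixes F :: "complex \<Rightarrow> complex"
  assumes S: "open S" "connected S" and F: "F holomorphic_on S" and z: "z \<in> S"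
    and w: "w \<in> S" "F w \<noteq> 0"
  shows "\<exists>m::nat. ((\<lambda>x::real. of_real x * (deriv F (z + of_real x) / F (z + of_real x))) \<longlongrightarrow> of_nat m) (at_right 0)
     \<and> (F z = 0 \<longrightarrow> 0 < m)"
proof -
  obtain g r m where g: "0 < r" "ball z r \<subseteq> S" "g holomorphic_on ball z r"
     "\<And>u. u \<in> ball z r \<Longrightarrow> F u = (u - z) ^ m * g u" "\<And>u. u \<in> ball z r \<Longrightarrow> g u \<noteq> 0" "F z = 0 \<longrightarrow> 0 < m"
  proof (cases "F z = 0")
    case True
    have "\<not> F constant_on S" using True z w unfolding constant_on_def by metis
    then show ?thesis
    proof (rule holomorphic_factor_zero_nonconstant[OF F S z True])
      fix g r n
      assume "0 < n" "0 < r" "ball z r \<subseteq> S" "g holomorphic_on ball z r"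
        and eq: "\<And>w. w \<in> ball z r \<Longrightarrow> F w = (w - z) ^ n * g w"
        and nz: "\<And>w. w \<in> ball z r \<Longrightarrow> g w \<noteq> 0"
      show ?thesis by (rule that[of r g n]) (fact | use \<open>0 < n\<close> in simp)+
    qed
  next
    case False
    have "continuous_on S F" using F by (rule holomorphic_on_imp_continuous_on)
    then have "open {u \<in> S. F u \<noteq> 0}"
      using continuous_open_preimage[of S F "- {0}"] S open_Compl[OF closed_singleton[of "0::complex"]]
      by (simp add: vimage_def Int_def)
    then obtain r where r: "r > 0" "ball z r \<subseteq> {u \<in> S. F u \<noteq> 0}"
      using z False unfolding open_contains_ball by blast
    show ?thesis
      by (rule that[of r F 0]) (use r F False in \<open>auto intro: holomorphic_on_subset\<close>)
  qed
  have z0: "z \<in> ball z r" using g(1) by simp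
  have dg: "(\<lambda>u. deriv g u / g u) holomorphic_on ball z r"
    using g(3,5) by (intro holomorphic_intros) auto
  have "isCont (\<lambda>u. deriv g u / g u) z"
    using holomorphic_on_imp_continuous_on[OF dg] z0 continuous_on_eq_continuous_at by blast
  then have lim: "((\<lambda>x::real. deriv g (z + of_real x) / g (z + of_real x)) \<longlongrightarrow> deriv g z / g z) (at_right 0)"
  proof (rule isCont_tendsto_compose)
    have "((\<lambda>x::real. z + of_real x) \<longlongrightarrow> z + of_real 0) (at_right 0)" by (intro tendsto_intros)
    then show "((\<lambda>x::real. z + of_real x) \<longlongrightarrow> z) (at_right 0)" by simp
  qed
  have "((\<lambda>x::real. of_nat m + of_real x * (deriv g (z + of_real x) / g (z + of_real x))) \<longlongrightarrow>
      of_nat m + of_real 0 * (deriv g z / g z)) (at_right 0)"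
    by (intro tendsto_intros lim)
  moreover have "\<forall>\<^sub>F x in at_right 0. of_nat m + of_real x * (deriv g (z + of_real x) / g (z + of_real x))
      = of_real x * (deriv F (z + of_real x) / F (z + of_real x))"

  proof -
    have "\<forall>\<^sub>F x in at_right (0::real). x \<in> {0<..<r}"
      using g(1) by (rule eventually_at_right_real)
    then show ?thesis
    proof eventually_elim
      case (elim x)
      let ?u = "z + of_real x"
      have u: "?u \<in> ball z r" using elim by (simp add: dist_norm)
      have "(g has_field_derivative deriv g ?u) (at ?u)"
        using holomorphic_derivI[OF g(3) open_ball u] .
      then have "((\<lambda>u. (u - z) ^ m * g u) has_field_derivative
         (of_nat m * (?u - z) ^ (m - 1) * g ?u + (?u - z) ^ m * deriv g ?u)) (at ?u)"
        by (auto intro!: derivative_eq_intros simp: algebra_simps)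
      then have "(F has_field_derivative
         (of_nat m * (?u - z) ^ (m - 1) * g ?u + (?u - z) ^ m * deriv g ?u)) (at ?u)"
        by (rule has_field_derivative_transform_within_open[OF _ open_ball u]) (simp add: g(4))
      then have d: "deriv F ?u = of_nat m * of_real x ^ (m - 1) * g ?u + of_real x ^ m * deriv g ?u"
        by (simp add: DERIV_imp_deriv)
      have x: "complex_of_real x \<noteq> 0" using elim by simp
      have "of_real x * deriv F ?u = (of_nat m * g ?u + of_real x * deriv g ?u) * of_real x ^ m"
        unfolding d by (cases m) (simp_all add: algebra_simps)
      then show ?case using g(4)[OF u] g(5)[OF u] x by (simp add: field_simps)
    qed
  qed
  ultimately have "((\<lambda>x::real. of_real x * (deriv F (z + of_real x) / F (z + of_real x))) \<longlongrightarrow> of_nat m) (at_right 0)"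
    by (simp add: tendsto_cong)
  then show ?thesis using g(6) by blast
qed

text \<open>Multiplied by \<open>x\<close>, the 3-4-1 expression at abscissa \<open>1 + x\<close>
  tends to 3 (1 - m0) - 4 m1 - m2 as \<open>x\<close> decreases to 0, where the 1 stems from the
  pole of zeta. Nonnegativity of the limit forces 4 m1 \<le> 3, whereas a zero at \<open>s\<close>
  means m1 \<ge> 1.\<close>

lemma zeta_reg_nonzero_on_1_line:
  assumes s: "Re s = 1"
  shows "zeta_reg s \<noteq> 0"
proof
  assume zero: "zeta_reg s = 0"
  define t where "t = Im s"
  have st: "s = Complex 1 t" using s by (simp add: t_def complex_eq_iff)
  have t: "t \<noteq> 0"
  proof
    assume "t = 0"
    then have "s = 1" using st by (simp add: complex_eq_iff)
    then show False using zero zeta_reg_1 by simp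
  qed
  let ?L = "\<lambda>z x. of_real x * (deriv zeta_reg (z + of_real x) / zeta_reg (z + of_real x))"
  have conn: "connected {s. Re s > 0}" by (intro convex_connected convex_halfspace_Re_gt)
  have lim: "\<exists>m::nat. (?L z \<longlongrightarrow> of_nat m) (at_right 0) \<and> (zeta_reg z = 0 \<longrightarrow> 0 < m)" if "Re z > 0" for z
    by (rule logarithmic_derivative_limit[OF open_Re_gt conn holomorphic_zeta_reg, of z 1]) (use that zeta_reg_1 in auto)
  obtain m0 m1 m2 :: nat where m: "(?L 1 \<longlongrightarrow> of_nat m0) (at_right 0)"
    "(?L s \<longlongrightarrow> of_nat m1) (at_right 0)" "0 < m1"
    "(?L (Complex 1 (2 * t)) \<longlongrightarrow> of_nat m2) (at_right 0)"
    using lim[of 1] lim[of s] lim[of "Complex 1 (2 * t)"] zero s by auto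
  define P where "P s = (\<Sum>n. mangoldt (Suc n) / of_nat (Suc n) powr s :: complex)" for s
  \<comment> \<open>Since \<open>zeta_series\<close> is \<open>zeta_reg\<close> divided by the
    factor vanishing at 1, its logarithmic derivative splits into the pole term and that of the
    regular function.\<close>
  have PL: "of_real x * P (z + of_real x) = of_real x / (z + of_real x - 1) - ?L z x"
    if z: "Re z = 1" and x: "x > 0" for z x
  proof -
    let ?u = "z + of_real x"
    have u1: "Re ?u > 1" using z x by simp
    then have "?u \<noteq> 1" by (metis less_irrefl one_complex.sel(1))
    note u = u1 this
    have nz: "zeta_series ?u \<noteq> 0" using zeta_series_nonzero u by blast
    have "((\<lambda>s. (s - 1) * zeta_series s) has_field_derivative (zeta_series ?u + (?u - 1) * deriv zeta_series ?u)) (at ?u)"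
      using field_differentiable_derivI[OF mangoldt_series(3)[OF u(1)]]
      by (auto intro!: derivative_eq_intros)
    then have "(zeta_reg has_field_derivative (zeta_series ?u + (?u - 1) * deriv zeta_series ?u)) (at ?u)"
      by (rule has_field_derivative_transform_within_open[OF _ open_Re_gt[of 1]]) (use u zeta_reg_eq_series in auto)
    then have "deriv zeta_reg ?u / zeta_reg ?u = (zeta_series ?u + (?u - 1) * deriv zeta_series ?u) / ((?u - 1) * zeta_series ?u)"
      using zeta_reg_eq_series[OF u(1)] by (simp add: DERIV_imp_deriv)
    also have "\<dots> = 1 / (?u - 1) + deriv zeta_series ?u / zeta_series ?u"
      using nz u(2) by (simp add: add_divide_distrib)
    finally have "P ?u = 1 / (?u - 1) - deriv zeta_reg ?u / zeta_reg ?u"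
      using mangoldt_series(2)[OF u(1)] by (simp add: P_def)
    then show ?thesis by (simp add: right_diff_distrib)
  qed
  define H where "H x = 3 * (of_real x / (1 + of_real x - 1) - ?L 1 x)
      + 4 * (of_real x / (s + of_real x - 1) - ?L s x)
      + (of_real x / (Complex 1 (2 * t) + of_real x - 1) - ?L (Complex 1 (2 * t)) x)" for x :: real
  have Hnn: "\<forall>\<^sub>F x in at_right 0. 0 \<le> Re (H x)"
    using eventually_at_right_less[of 0]
  proof eventually_elim
    case (elim x)
    have e: "1 + of_real x = complex_of_real (1 + x)" "s + of_real x = Complex (1 + x) t"
      "Complex 1 (2 * t) + of_real x = Complex (1 + x) (2 * t)"
      by (simp_all add: st complex_eq_iff)
    have Pe: "of_real x * P (1 + of_real x) = of_real x / (1 + of_real x - 1) - ?L 1 x"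
      "of_real x * P (s + of_real x) = of_real x / (s + of_real x - 1) - ?L s x"
      "of_real x * P (Complex 1 (2 * t) + of_real x)
        = of_real x / (Complex 1 (2 * t) + of_real x - 1) - ?L (Complex 1 (2 * t)) x"
      using elim s by (intro PL; simp)+
    have "H x = 3 * (of_real x * P (1 + of_real x)) + 4 * (of_real x * P (s + of_real x))
        + of_real x * P (Complex 1 (2 * t) + of_real x)"
      by (simp only: H_def Pe)
    then have "H x = of_real x * (3 * P (of_real (1 + x)) + 4 * P (Complex (1 + x) t) + P (Complex (1 + x) (2 * t)))"
      unfolding e by (simp add: algebra_simps)
    moreover have "0 \<le> Re (3 * P (of_real (1 + x)) + 4 * P (Complex (1 + x) t) + P (Complex (1 + x) (2 * t)))"
      using mangoldt_series_3_4_1[of "1 + x" t] elim unfolding P_def by simp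
    ultimately show ?case using elim by simp
  qed
  have q0: "((\<lambda>x::real. of_real x / (1 + of_real x - 1) :: complex) \<longlongrightarrow> 1) (at_right 0)"
  proof (rule tendsto_eventually)
    show "\<forall>\<^sub>F x::real in at_right 0. of_real x / (1 + of_real x - 1) = (1::complex)"
      using eventually_at_right_less[of 0] by eventually_elim simp
  qed
  have q: "((\<lambda>x::real. of_real x / (z + of_real x - 1)) \<longlongrightarrow> 0) (at_right 0)" if "z \<noteq> 1" for z :: complex
  proof -
    have "((\<lambda>x::real. of_real x / (z + of_real x - 1)) \<longlongrightarrow> of_real 0 / (z + of_real 0 - 1)) (at_right 0)"
      using that by (intro tendsto_intros) auto
    then show ?thesis by simp
  qed
  have "(H \<longlongrightarrow> 3 * (1 - of_nat m0) + 4 * (0 - of_nat m1) + (0 - of_nat m2)) (at_right 0)"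
    unfolding H_def[abs_def]
    by (intro tendsto_intros m q0 q) (use t in \<open>auto simp: st complex_eq_iff\<close>)
  then have "((\<lambda>x. Re (H x)) \<longlongrightarrow> Re (3 * (1 - of_nat m0) + 4 * (0 - of_nat m1) + (0 - of_nat m2))) (at_right 0)"
    by (rule tendsto_Re)
  from tendsto_lowerbound[OF this Hnn]
  have "0 \<le> Re (3 * (1 - of_nat m0) + 4 * (0 - of_nat m1) + (0 - of_nat m2))" by simp
  also have "\<dots> = 3 - real (3 * m0 + 4 * m1 + m2)" by simp
  finally have "3 * m0 + 4 * m1 + m2 \<le> 3" by simp
  then show False using m(3) by simp
qed

lemma zeta_reg_nonzero:
  assumes "GRH" "1 / 2 < Re s"
  shows "zeta_reg s \<noteq> 0"
proof -
  consider "Re s < 1" | "Re s = 1" | "Re s > 1" by linarith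
  then show ?thesis
  proof cases
    case 1
    have "s \<notin> nontrivial_zeros zeta" using assms by (auto simp: GRH_def)
    then have "zeta s \<noteq> 0" using 1 assms by (auto simp: nontrivial_zeros_def)
    moreover have "s \<noteq> 1" using 1 by auto
    ultimately show ?thesis using zeta_reg_eq_zeta[of s] assms by simp
  next
    case 2
    then show ?thesis by (rule zeta_reg_nonzero_on_1_line)
  next
    case 3
    then show ?thesis using zeta_reg_eq_series zeta_series_nonzero by force
  qed
qed

section \<open>Growth of the reciprocal of zeta\<close>

text \<open>Expressed through \<open>zeta_reg\<close>, the reciprocal is holomorphic at 1 too, where
  the pole of zeta becomes an ordinary zero.\<close>

definition recip_zeta :: "complex \<Rightarrow> complex" where
  "recip_zeta s = (s - 1) / zeta_reg s"

lemma recip_zeta_sums: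
  assumes s: "Re s > 1"
  shows "(\<lambda>n. of_int (moebius_mu (Suc n)) / of_nat (Suc n) powr s) sums recip_zeta s"
proof -
  have "s \<noteq> 1" using s by auto
  then have "recip_zeta s = 1 / zeta_series s"
    using zeta_reg_eq_series[OF s] by (simp add: recip_zeta_def)
  also have "\<dots> = (\<Sum>n. of_int (moebius_mu (Suc n)) / of_nat (Suc n) powr s)"
    using moebius_series_times_zeta[OF s] zeta_series_nonzero[OF s] by (metis nonzero_mult_div_cancel_left)
  finally have "recip_zeta s = (\<Sum>n. of_int (moebius_mu (Suc n)) / of_nat (Suc n) powr s)" .
  then show ?thesis
    using summable_sums[OF summable_norm_cancel[OF norm_summable_moebius_series[OF s]]] by simp
qed

lemma holomorphic_recip_zeta:
  assumes "GRH" shows "recip_zeta holomorphic_on {s. Re s > 1 / 2}"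
  unfolding recip_zeta_def[abs_def]
proof (intro holomorphic_intros)
  show "zeta_reg holomorphic_on {s. Re s > 1 / 2}"
    by (rule holomorphic_on_subset[OF holomorphic_zeta_reg]) auto
qed (use zeta_reg_nonzero[OF assms] in auto)

lemma norm_series_le_of_Re_ge:
  assumes "Re s \<ge> 3 / 2" "\<And>n. cmod (a n) \<le> 1"
  shows "cmod (\<Sum>n. a n / of_nat (Suc n) powr s) \<le> (\<Sum>n. real (Suc n) powr (- 3 / 2))"
proof (rule norm_suminf_le)
  show "summable (\<lambda>n. real (Suc n) powr (- 3 / 2))" using summable_Suc_powr[of "3 / 2"] by simp
  fix n
  have "cmod (a n / of_nat (Suc n) powr s) \<le> 1 / real (Suc n) powr Re s"
    using assms(2)[of n] by (simp add: norm_divide norm_Suc_powr divide_right_mono del: of_nat_Suc)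
  also have "\<dots> = real (Suc n) powr (- Re s)" by (simp add: powr_minus_divide)
  also have "\<dots> \<le> real (Suc n) powr (- 3 / 2)" using assms(1) by (intro powr_mono) auto
  finally show "cmod (a n / of_nat (Suc n) powr s) \<le> real (Suc n) powr (- 3 / 2)" .
qed

lemma norm_minus_1_le_norm:
  assumes "1 / 2 \<le> Re s" shows "cmod (s - 1) \<le> cmod s"
proof -
  have "(cmod (s - 1))\<^sup>2 \<le> (cmod s)\<^sup>2"
    using assms unfolding cmod_power2 by (simp add: power2_eq_square algebra_simps)
  then show ?thesis by (rule power2_le_imp_le) simp
qed

text \<open>On the disc of radius 1/2 about \<open>z = 2 + i Im s\<close> the quotient
  \<open>V u / V z\<close> is bounded independently of the height, so the first \<open>K\<close>
  Taylor coefficients of its logarithm cost a constant \<open>A\<close>. On the disc of radius 3/2,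
  which touches the critical line, the bound \<open>exp B\<close> grows linearly with the height,
  but \<open>B\<close> enters only through the tail \<open>B * \<kappa> K\<close>. With
  \<open>K\<close> chosen such that \<open>\<kappa> K < \<eta>\<close>, the factor
  \<open>exp (B * \<eta>)\<close> is the claimed power of the height.\<close>

theorem recip_zeta_growth:
  assumes RH: "GRH" and \<delta>: "0 < \<delta>" "\<delta> < 1" and \<eta>: "0 < \<eta>"
  shows "\<exists>C>0. \<forall>s. 1 / 2 + \<delta> \<le> Re s \<longrightarrow> Re s \<le> 2 \<longrightarrow> cmod (recip_zeta s) \<le> C * (\<bar>Im s\<bar> + 3) powr \<eta>"
proof -
  define M where "M = (\<Sum>n. real (Suc n) powr (- 3 / 2))"
  have smM: "summable (\<lambda>n. real (Suc n) powr (- 3 / 2))" using summable_Suc_powr[of "3 / 2"] by simp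
  have "(\<Sum>n<1. real (Suc n) powr (- 3 / 2)) \<le> M"
    unfolding M_def by (rule sum_le_suminf[OF smM]) auto
  then have M1: "M \<ge> 1" by simp
  \<comment> \<open>\<open>\<rho>\<close> is the distance from 2 to the abscissa
    \<open>1 / 2 + \<delta>\<close>, and \<open>R'\<close> is the midpoint of \<open>\<rho>\<close>
    and \<open>3 / 2\<close>.\<close>
  define R' where "R' = 3 / 2 - \<delta> / 2"
  define \<rho> where "\<rho> = 3 / 2 - \<delta>"
  have R': "0 < \<rho>" "\<rho> < R'" "R' < 3 / 2" using \<delta> by (auto simp: R'_def \<rho>_def)
  define \<kappa> where "\<kappa> K = 2 * R' / (3 / 2 - R') * (\<rho> / R') ^ K / (1 - \<rho> / R')" for K
  have "(\<lambda>K. 2 * R' / (3 / 2 - R') * (\<rho> / R') ^ K / (1 - \<rho> / R')) \<longlonglongrightarrow> 2 * R' / (3 / 2 - R') * 0 / (1 - \<rho> / R')"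
    using R' by (intro tendsto_intros LIMSEQ_power_zero) auto
  then have "\<kappa> \<longlonglongrightarrow> 0" by (simp add: \<kappa>_def[abs_def])
  then have "eventually (\<lambda>K. \<kappa> K < \<eta>) sequentially" using \<eta> by (rule order_tendstoD)
  then obtain K where K: "\<kappa> K < \<eta>" by (metis eventually_sequentially order_refl)
  \<comment> \<open>On the small disc \<open>V u\<close> is at most \<open>M\<close> and
    \<open>1 / V z\<close> at most \<open>2 * M\<close>; \<open>exp b \<ge> b + 1\<close> makes the
    bound strict.\<close>
  define b where "b = 2 * M\<^sup>2"
  have b: "b > 0" "2 * M\<^sup>2 < exp b"
    using M1 exp_ge_add_one_self[of b] unfolding b_def by (simp, linarith)
  define A where "A = (\<Sum>n<K. 2 * b * (2 * \<rho> / (1 / 2)) ^ n)"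
  define C where "C = 2 * M * (exp A * (exp \<eta> * (8 * M\<^sup>2) powr \<eta>))"
  have "cmod (recip_zeta s) \<le> C * (\<bar>Im s\<bar> + 3) powr \<eta>" if s: "1 / 2 + \<delta> \<le> Re s" "Re s \<le> 2" for s
  proof -
    define z where "z = Complex 2 (Im s)"
    define V where "V u = zeta_reg u / u" for u
    have Re_ball: "Re u > 2 - r" if "u \<in> ball z r" for u r
      using that abs_Re_le_cmod[of "z - u"] by (simp add: z_def dist_norm)
    have half: "Re u > 1 / 2" if "u \<in> ball z (3 / 2)" for u using Re_ball[OF that] by simp
    have nz: "V u \<noteq> 0" if "u \<in> ball z (3 / 2)" for u
      using zeta_reg_nonzero[OF RH half[OF that]] half[OF that] by (auto simp: V_def)
    have hol: "V holomorphic_on ball z (3 / 2)"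
      unfolding V_def[abs_def] using half
      by (intro holomorphic_intros holomorphic_on_subset[OF holomorphic_zeta_reg]) force+
    have V_series: "V u = (u - 1) / u * zeta_series u" if "Re u > 1" for u
      using zeta_reg_eq_series[OF that] by (simp add: V_def)
    have Vz: "cmod (1 / V z) \<le> 2 * M"
    proof -
      have "cmod z \<le> cmod (z - 1) + 1" using norm_triangle_sub[of z 1] by simp
      moreover have "1 \<le> cmod (z - 1)" using abs_Re_le_cmod[of "z - 1"] by (simp add: z_def)
      ultimately have le: "cmod z \<le> 2 * cmod (z - 1)" "0 < cmod (z - 1)" by auto
      have ser: "1 / zeta_series z = (\<Sum>n. of_int (moebius_mu (Suc n)) / of_nat (Suc n) powr z)"
        using moebius_series_times_zeta[of z] zeta_series_nonzero[of z] by (simp add: z_def field_simps)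
      have "cmod (1 / zeta_series z) \<le> M"
        unfolding ser M_def
        by (rule norm_series_le_of_Re_ge) (use abs_moebius_mu_le in \<open>auto simp: z_def simp flip: of_int_abs\<close>)
      moreover have "cmod (z / (z - 1)) \<le> 2" using le by (simp add: norm_divide field_simps)
      ultimately have "cmod (z / (z - 1)) * cmod (1 / zeta_series z) \<le> 2 * M"
        by (intro mult_mono) auto
      moreover have "1 / V z = z / (z - 1) * (1 / zeta_series z)"
        using V_series[of z] by (simp add: z_def)
      ultimately show ?thesis by (simp only: norm_mult)
    qed
    have small: "cmod (V u / V z) < exp b" if "u \<in> ball z (1 / 2)" for u
    proof -
      have u: "Re u \<ge> 3 / 2" using Re_ball[OF that] by simp
      have "cmod (zeta_series u) \<le> M"
        unfolding zeta_series_def M_def by (rule norm_series_le_of_Re_ge[OF u]) simp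
      moreover have "cmod ((u - 1) / u) \<le> 1"
        using norm_minus_1_le_norm[of u] u by (auto simp: norm_divide divide_le_eq_1)
      ultimately have "cmod ((u - 1) / u) * cmod (zeta_series u) \<le> 1 * M"
        by (intro mult_mono) auto
      moreover have "V u = (u - 1) / u * zeta_series u" using V_series[of u] u by simp
      ultimately have "cmod (V u) \<le> M" by (simp only: norm_mult mult_1)
      then have "cmod (V u * (1 / V z)) \<le> M * (2 * M)"
        unfolding norm_mult using Vz M1 by (intro mult_mono) auto
      then show ?thesis using b(2) by (simp add: power2_eq_square)
    qed
    \<comment> \<open>The product 8 M^2 arises from \<open>4 * M\<close> in the bound for
      \<open>V u\<close> and \<open>2 * M\<close> in that for \<open>1 / V z\<close>. The summand 1
      makes the inequality strict.\<close>
    define B where "B = ln (8 * M\<^sup>2 * (\<bar>Im s\<bar> + 3)) + 1"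
    have M8: "8 * M\<^sup>2 * (\<bar>Im s\<bar> + 3) > 1"
    proof -
      have "1 \<le> M\<^sup>2" using M1 by (rule one_le_power)
      then have "8 * 3 \<le> 8 * M\<^sup>2 * (\<bar>Im s\<bar> + 3)" by (intro mult_mono) auto
      then show ?thesis by simp
    qed
    have B: "B > 0" using M8 by (simp add: B_def add_pos_pos)
    have large: "cmod (V u / V z) < exp B" if "u \<in> ball z (3 / 2)" for u
    proof -
      have u: "1 / 2 \<le> Re u" using half[OF that] by simp
      have u2: "1 / 2 \<le> cmod u" using u complex_Re_le_cmod[of u] by linarith
      have "cmod u \<le> cmod z + cmod (u - z)" by (rule norm_triangle_sub)
      also have "cmod (u - z) < 3 / 2" using that by (simp add: dist_norm norm_minus_commute)
      also have "cmod z \<le> 2 + \<bar>Im s\<bar>" using cmod_le[of z] by (simp add: z_def)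
      finally have u3: "cmod (u - 1) \<le> \<bar>Im s\<bar> + 5" using norm_triangle_ineq4[of u 1] by simp
      have "cmod (V u) \<le> (1 + cmod (u - 1) * cmod u * M) / cmod u"
        using norm_zeta_reg_le[OF u] unfolding V_def norm_divide M_def by (rule divide_right_mono) simp
      also have "\<dots> = 1 / cmod u + cmod (u - 1) * M"
        using u2 by (auto simp: add_divide_distrib)
      also have "\<dots> \<le> 2 + (\<bar>Im s\<bar> + 5) * M"
      proof (intro add_mono mult_right_mono u3)
        have "1 \<le> 2 * cmod u" "0 < cmod u" using u2 by auto
        then show "1 / cmod u \<le> 2" by (simp add: pos_divide_le_eq)
      qed (use M1 in auto)
      also have "2 \<le> 1 * M + \<bar>Im s\<bar> * M + M" proof -
        have "0 \<le> \<bar>Im s\<bar> * M" using M1 by simp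
        then show ?thesis using M1 by linarith
      qed
      finally have "cmod (V u) \<le> (M + \<bar>Im s\<bar> * M + M) + (\<bar>Im s\<bar> + 5) * M" by simp
      also have "\<dots> \<le> 4 * M * (\<bar>Im s\<bar> + 3)" using M1 by (simp add: algebra_simps)
      finally have "cmod (V u * (1 / V z)) \<le> (4 * M * (\<bar>Im s\<bar> + 3)) * (2 * M)"
        unfolding norm_mult using Vz M1 by (intro mult_mono) auto
      also have "\<dots> = 8 * M\<^sup>2 * (\<bar>Im s\<bar> + 3)" by (simp add: power2_eq_square)
      also have "\<dots> = exp (B - 1)" unfolding B_def using M8 by (subst add_diff_cancel_right', subst exp_ln) auto
      also have "\<dots> < exp B" by simp
      finally show ?thesis by simp
    qed
    have sz: "cmod (s - z) \<le> \<rho>"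
    proof -
      have "s - z = of_real (Re s - 2)" by (simp add: z_def complex_eq_iff)
      then have "cmod (s - z) = \<bar>Re s - 2\<bar>" by (metis norm_of_real real_norm_def)
      then show ?thesis using s by (simp add: \<rho>_def)
    qed
    have "cmod (V z / V s) \<le> exp (A + 2 * B * R' / (3 / 2 - R') * (\<rho> / R') ^ K / (1 - \<rho> / R'))"
      unfolding A_def
      using R' sz by (intro norm_log_quotient_bound[OF hol nz b(1) small B large]) auto
    also have "2 * B * R' / (3 / 2 - R') * (\<rho> / R') ^ K / (1 - \<rho> / R') = B * \<kappa> K"
      by (simp add: \<kappa>_def)
    also have "exp (A + B * \<kappa> K) \<le> exp (A + B * \<eta>)" using K B by simp
    also have "\<dots> = exp A * (exp \<eta> * (8 * M\<^sup>2 * (\<bar>Im s\<bar> + 3)) powr \<eta>)"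
      using M8 M1 by (simp add: B_def exp_add powr_def algebra_simps)
    also have "(8 * M\<^sup>2 * (\<bar>Im s\<bar> + 3)) powr \<eta> = (8 * M\<^sup>2) powr \<eta> * (\<bar>Im s\<bar> + 3) powr \<eta>"
      by (rule powr_mult)
    finally have VV: "cmod (V z / V s) \<le> exp A * (exp \<eta> * ((8 * M\<^sup>2) powr \<eta> * (\<bar>Im s\<bar> + 3) powr \<eta>))" .
    have s0: "s \<noteq> 0" using s \<delta> by auto
    have zb: "z \<in> ball z (3 / 2)" by simp
    have "cmod ((s - 1) / s) \<le> 1"
      using norm_minus_1_le_norm[of s] s \<delta> s0 by (simp add: norm_divide)
    then have "cmod ((s - 1) / s) * (cmod (1 / V z) * cmod (V z / V s))
        \<le> 1 * ((2 * M) * (exp A * (exp \<eta> * ((8 * M\<^sup>2) powr \<eta> * (\<bar>Im s\<bar> + 3) powr \<eta>))))"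
      using M1 by (intro mult_mono Vz VV mult_nonneg_nonneg) auto
    moreover have "recip_zeta s = ((s - 1) / s) * ((1 / V z) * (V z / V s))"
      using nz[OF zb] s0 by (simp add: recip_zeta_def V_def)
    ultimately have "cmod (recip_zeta s) \<le> 1 * ((2 * M) * (exp A * (exp \<eta> * ((8 * M\<^sup>2) powr \<eta> * (\<bar>Im s\<bar> + 3) powr \<eta>))))"
      by (simp only: norm_mult)
    then show ?thesis by (simp add: C_def mult_ac)
  qed
  moreover have "C > 0" using M1 by (simp add: C_def)
  ultimately show ?thesis by blast
qed

section \<open>Perron's formula and the Mertens function\<close>

text \<open>Cauchy's theorem as a change of route: a primitive on \<open>S\<close> makes the
  integral from \<open>a\<close> to \<open>b\<close> equal to the one through \<open>d\<close> and
  \<open>c\<close>.\<close>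

lemma contour_integral_four_sides:
  fixes F :: "complex \<Rightarrow> complex"
  assumes "convex S" "open S" "F holomorphic_on S" "a \<in> S" "b \<in> S" "c \<in> S" "d \<in> S"
  obtains I J K L where "(F has_contour_integral I) (linepath a b)" "(F has_contour_integral J) (linepath d c)"
    "(F has_contour_integral K) (linepath a d)" "(F has_contour_integral L) (linepath c b)" "I = K + J + L"
proof -
  obtain P where P: "\<And>x. x \<in> S \<Longrightarrow> (P has_field_derivative F x) (at x within S)"
    using holomorphic_convex_primitive'[OF assms(1-3)] by blast
  have *: "(F has_contour_integral (P v - P u)) (linepath u v)" if "u \<in> S" "v \<in> S" for u v
    using contour_integral_primitive[OF P, where g = "linepath u v"] assms(1) that
    by (simp add: closed_segment_subset)
  show thesis
    by (rule that[OF * * * *]) (use assms in auto)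
qed

text \<open>The Perron integral with kernel \<open>1 / (s (s + 1))\<close> converges absolutely, so truncation at height
  \<open>T\<close> costs only \<open>1 / T\<close>.\<close>
context
  fixes y :: real
  assumes y: "y > 0"
begin

definition perron_integrand :: "complex \<Rightarrow> complex" where
  "perron_integrand s = of_real y powr (s + 1) / (s * (s + 1))"

lemma norm_perron_integrand_le:
  assumes "y powr (Re s + 1) \<le> Y" "A \<le> cmod s" "B \<le> cmod (s + 1)" "A > 0" "B > 0"
  shows "cmod (perron_integrand s) \<le> Y / (A * B)"
proof -
  have "cmod (perron_integrand s) = y powr (Re s + 1) / (cmod s * cmod (s + 1))"
    using y norm_powr_real_powr[of "of_real y" "s + 1"]
    by (simp add: perron_integrand_def norm_divide norm_mult)
  also have "\<dots> \<le> Y / (A * B)"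
    using assms by (intro frac_le mult_mono mult_pos_pos) (auto intro: order.trans[OF powr_ge_zero])
  finally show ?thesis .
qed

lemma horizontal_perron_bound:
  assumes "\<bar>Im s\<bar> = T" "T > 0" "y powr (Re s + 1) \<le> Y"
  shows "cmod (perron_integrand s) \<le> Y / (T * T)"
  using assms abs_Im_le_cmod[of s] abs_Im_le_cmod[of "s + 1"] by (intro norm_perron_integrand_le) auto

lemma holomorphic_perron_integrand: "perron_integrand holomorphic_on {s. Re s > 0}"
  unfolding perron_integrand_def[abs_def]
proof (intro holomorphic_intros)
  fix s :: complex assume "s \<in> {s. Re s > 0}"
  then have "0 < Re s" "0 < Re (s + 1)" by auto
  then show "s * (s + 1) \<noteq> 0" by (metis mult_eq_0_iff less_irrefl zero_complex.sel(1))
qed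

text \<open>For \<open>y \<le> 1\<close> the integrand decreases to the right, where it has no pole,
  so the segment is moved to \<open>Re s = 2 + T\<close>. The factor \<open>y ^ 3\<close> is kept
  because \<open>y\<close> will be \<open>x / n\<close>, and the errors n (x / n)^3 have to be
  summable over \<open>n\<close>.\<close>

lemma perron_kernel_le_1:
  assumes "y \<le> 1" and T: "T \<ge> 2"
  shows "\<exists>I. (perron_integrand has_contour_integral I) (linepath (Complex 2 (-T)) (Complex 2 T)) \<and>
    cmod I \<le> 8 * y ^ 3 / T"
proof -
  define a b c d where "a = Complex 2 (-T)" and "b = Complex 2 T"
    and "c = Complex (2 + T) T" and "d = Complex (2 + T) (-T)"
  note abcd = a_def b_def c_def d_def
  let ?S = "{s. Re s > 0}"
  have ins: "a \<in> ?S" "b \<in> ?S" "c \<in> ?S" "d \<in> ?S" using T by (auto simp: abcd)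
  obtain I J K L where I: "(perron_integrand has_contour_integral I) (linepath a b)"
    and J: "(perron_integrand has_contour_integral J) (linepath d c)"
    and K: "(perron_integrand has_contour_integral K) (linepath a d)"
    and L: "(perron_integrand has_contour_integral L) (linepath c b)" and eq: "I = K + J + L"
    by (rule contour_integral_four_sides[OF convex_halfspace_Re_gt open_Re_gt holomorphic_perron_integrand ins])
  have y3: "y powr (u + 1) \<le> y ^ 3" if "u \<ge> 2" for u
    using powr_mono'[of 3 "u + 1" y] that y assms by simp
  have K: "cmod K \<le> y ^ 3 / (T * T) * cmod (d - a)"
  proof (rule has_contour_integral_bound_linepath[OF K])
    show "cmod (perron_integrand s) \<le> y ^ 3 / (T * T)" if "s \<in> closed_segment a d" for s
      using that T y3 by (intro horizontal_perron_bound) (auto simp: abcd closed_segment_same_Im closed_segment_eq_real_ivl)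
  qed (use y T in auto)
  have L: "cmod L \<le> y ^ 3 / (T * T) * cmod (b - c)"
  proof (rule has_contour_integral_bound_linepath[OF L])
    show "cmod (perron_integrand s) \<le> y ^ 3 / (T * T)" if "s \<in> closed_segment c b" for s
      using that T y3 by (intro horizontal_perron_bound) (auto simp: abcd closed_segment_same_Im closed_segment_eq_real_ivl)
  qed (use y T in auto)
  have J: "cmod J \<le> y ^ 3 / (T * T) * cmod (c - d)"
  proof (rule has_contour_integral_bound_linepath[OF J])
    show "cmod (perron_integrand s) \<le> y ^ 3 / (T * T)" if "s \<in> closed_segment d c" for s
    proof -
      have s: "Re s = 2 + T" using that by (simp add: abcd closed_segment_same_Re)
      show ?thesis
        using s T y3[of "2 + T"] abs_Re_le_cmod[of s] abs_Re_le_cmod[of "s + 1"]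
        by (intro norm_perron_integrand_le) auto
    qed
  qed (use y T in auto)
  have diffs: "d - a = of_real T" "b - c = of_real (- T)" "c - d = \<i> * of_real (2 * T)"
    by (auto simp: abcd complex_eq_iff)
  have len: "cmod (d - a) = T" "cmod (b - c) = T" "cmod (c - d) = 2 * T"
    using T unfolding diffs norm_mult norm_of_real norm_ii by auto
  have "cmod I \<le> cmod K + cmod J + cmod L" unfolding eq by (meson add_mono norm_triangle_ineq order.trans order_refl)
  also have "\<dots> \<le> y ^ 3 / (T * T) * T + y ^ 3 / (T * T) * (2 * T) + y ^ 3 / (T * T) * T"
    using J K L unfolding len by (intro add_mono)
  also have "\<dots> = 4 * y ^ 3 / T" using T by (simp add: field_simps)
  \<comment> \<open>The weaker constant is the one that the case \<open>y \<ge> 1\<close>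
    yields.\<close>
  also have "\<dots> \<le> 8 * y ^ 3 / T" using y T by (intro divide_right_mono) auto
  finally show ?thesis using I by (auto simp: abcd)
qed

text \<open>For \<open>y \<ge> 1\<close> the contour closes to the left and encircles the poles 0
  and -1, with residues \<open>y\<close> and \<open>-1\<close>. Partial fractions reduce each pole
  to Cauchy's integral formula.\<close>

lemma perron_kernel_ge_1:
  assumes "y \<ge> 1" and T: "T \<ge> 2"
  shows "\<exists>I. (perron_integrand has_contour_integral I) (linepath (Complex 2 (-T)) (Complex 2 T)) \<and>
    cmod (I - 2 * of_real pi * \<i> * of_real (y - 1)) \<le> 8 * y ^ 3 / T"
proof -
  define a b c d where "a = Complex (-T) (-T)" and "b = Complex 2 (-T)"
    and "c = Complex 2 T" and "d = Complex (-T) T"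
  note abcd = a_def b_def c_def d_def
  let ?R = "rectpath a c"
  have R: "?R = linepath a b +++ linepath b c +++ linepath c d +++ linepath d a"
    by (simp add: rectpath_def Let_def abcd)
  have vp: "valid_path ?R" "pathfinish ?R = pathstart ?R" by (simp_all add: R)
  have box: "0 \<in> box a c" "-1 \<in> box a c" using T by (auto simp: abcd in_box_complex_iff)
  have img: "path_image ?R = cbox a c - box a c"
    using T by (intro path_image_rectpath_cbox_minus_box) (auto simp: abcd)
  have w: "winding_number ?R 0 = 1" "winding_number ?R (-1) = 1"
    using box by (auto intro: winding_number_rectpath)
  have hol: "(\<lambda>s. of_real y powr (s + 1)) holomorphic_on UNIV" by (intro holomorphic_intros)
  have c0: "((\<lambda>s. of_real y powr (s + 1) / (s - 0)) has_contour_integral (2 * pi * \<i> * winding_number ?R 0 * of_real y powr (0 + 1))) ?R"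
    by (rule Cauchy_integral_formula_convex_simple[OF convex_UNIV hol]) (use vp img box in auto)
  have c1: "((\<lambda>s. of_real y powr (s + 1) / (s - (-1))) has_contour_integral (2 * pi * \<i> * winding_number ?R (-1) * of_real y powr (-1 + 1))) ?R"
    by (rule Cauchy_integral_formula_convex_simple[OF convex_UNIV hol]) (use vp img box in auto)
  have "((\<lambda>s. of_real y powr (s + 1) / (s - 0) - of_real y powr (s + 1) / (s - (-1))) has_contour_integral
      (2 * pi * \<i> * winding_number ?R 0 * of_real y powr (0 + 1) - 2 * pi * \<i> * winding_number ?R (-1) * of_real y powr (-1 + 1))) ?R"
    by (rule has_contour_integral_diff[OF c0 c1])
  also have "2 * pi * \<i> * winding_number ?R 0 * of_real y powr (0 + 1) - 2 * pi * \<i> * winding_number ?R (-1) * of_real y powr (-1 + 1)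
      = 2 * of_real pi * \<i> * of_real (y - 1)"
    unfolding w using y by (simp add: algebra_simps)
  finally have "((\<lambda>s. of_real y powr (s + 1) / (s - 0) - of_real y powr (s + 1) / (s - (-1))) has_contour_integral
      (2 * of_real pi * \<i> * of_real (y - 1))) ?R" .
  then have RI: "(perron_integrand has_contour_integral (2 * of_real pi * \<i> * of_real (y - 1))) ?R"
  proof (rule has_contour_integral_eq)
    fix s assume "s \<in> path_image ?R"
    then have "s \<noteq> 0" "s \<noteq> -1" using img box by auto
    then show "of_real y powr (s + 1) / (s - 0) - of_real y powr (s + 1) / (s - (-1)) = perron_integrand s"
      by (auto simp: perron_integrand_def field_simps add_eq_0_iff)
  qed
  have "perron_integrand holomorphic_on - {0, -1}"
    unfolding perron_integrand_def[abs_def]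
    by (intro holomorphic_intros) (auto simp: eq_neg_iff_add_eq_0)
  moreover have "path_image ?R \<subseteq> - {0, -1}" using img box by blast
  ultimately have "continuous_on (path_image ?R) perron_integrand"
    using holomorphic_on_imp_continuous_on continuous_on_subset by blast
  moreover have "path_image ?R = closed_segment a b \<union> closed_segment b c \<union> closed_segment c d \<union> closed_segment d a"
    by (simp add: R path_image_join Un_assoc)
  ultimately have ci: "perron_integrand contour_integrable_on (linepath a b)" "perron_integrand contour_integrable_on (linepath b c)"
      "perron_integrand contour_integrable_on (linepath c d)" "perron_integrand contour_integrable_on (linepath d a)"
    by (auto intro!: contour_integrable_continuous_linepath elim: continuous_on_subset)
  define I J K L where "I = contour_integral (linepath b c) perron_integrand"
    and "J = contour_integral (linepath d a) perron_integrand"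
    and "K = contour_integral (linepath a b) perron_integrand"
    and "L = contour_integral (linepath c d) perron_integrand"
  have eq: "2 * of_real pi * \<i> * of_real (y - 1) = K + (I + (L + J))"
    using contour_integral_unique[OF RI] ci unfolding R
    by (simp add: I_def J_def K_def L_def contour_integrable_join)
  have y3: "y powr (u + 1) \<le> y ^ 3" if "u \<le> 2" for u
    using powr_mono[of "u + 1" 3 y] that y assms by simp
  have K: "cmod K \<le> y ^ 3 / (T * T) * cmod (b - a)"
    unfolding K_def
  proof (rule contour_integral_bound_linepath[OF ci(1)])
    show "cmod (perron_integrand s) \<le> y ^ 3 / (T * T)" if "s \<in> closed_segment a b" for s
      using that T y3 by (intro horizontal_perron_bound) (auto simp: abcd closed_segment_same_Im closed_segment_eq_real_ivl)
  qed (use y T in auto)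
  have L: "cmod L \<le> y ^ 3 / (T * T) * cmod (d - c)"
    unfolding L_def
  proof (rule contour_integral_bound_linepath[OF ci(3)])
    show "cmod (perron_integrand s) \<le> y ^ 3 / (T * T)" if "s \<in> closed_segment c d" for s
      using that T y3 by (intro horizontal_perron_bound) (auto simp: abcd closed_segment_same_Im closed_segment_eq_real_ivl)
  qed (use y T in auto)
  \<comment> \<open>On \<open>Re s = - T\<close> the distance of \<open>s\<close> from the pole -1
    is at least \<open>T - 1\<close>, hence at least \<open>T / 2\<close> for
    \<open>T \<ge> 2\<close>.\<close>
  have J: "cmod J \<le> y ^ 3 / (T * (T / 2)) * cmod (a - d)"
    unfolding J_def
  proof (rule contour_integral_bound_linepath[OF ci(4)])
    show "cmod (perron_integrand s) \<le> y ^ 3 / (T * (T / 2))" if "s \<in> closed_segment d a" for s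
    proof -
      have s: "Re s = - T" using that by (simp add: abcd closed_segment_same_Re)
      show ?thesis
        using s T y3[of "- T"] abs_Re_le_cmod[of s] abs_Re_le_cmod[of "s + 1"]
        by (intro norm_perron_integrand_le) auto
    qed
  qed (use y T in auto)
  have diffs: "b - a = of_real (2 + T)" "d - c = of_real (- 2 - T)" "a - d = \<i> * of_real (- 2 * T)"
    by (auto simp: abcd complex_eq_iff)
  have len: "cmod (b - a) \<le> 2 * T" "cmod (d - c) \<le> 2 * T" "cmod (a - d) \<le> 2 * T"
    using T unfolding diffs norm_mult norm_of_real norm_ii by auto
  have y0: "0 \<le> y ^ 3 / (T * T)" "0 \<le> y ^ 3 / (T * (T / 2))" using y T by auto
  have "I - 2 * of_real pi * \<i> * of_real (y - 1) = - (K + J + L)" unfolding eq by simp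
  then have "cmod (I - 2 * of_real pi * \<i> * of_real (y - 1)) = cmod (K + J + L)" by (simp only: norm_minus_cancel)
  also have "\<dots> \<le> cmod K + cmod J + cmod L" by (meson add_mono norm_triangle_ineq order.trans order_refl)
  also have "\<dots> \<le> y ^ 3 / (T * T) * (2 * T) + y ^ 3 / (T * (T / 2)) * (2 * T) + y ^ 3 / (T * T) * (2 * T)"
    by (intro add_mono order.trans[OF J mult_left_mono[OF len(3) y0(2)]]
        order.trans[OF K mult_left_mono[OF len(1) y0(1)]] order.trans[OF L mult_left_mono[OF len(2) y0(1)]])
  also have "\<dots> = 8 * y ^ 3 / T" using T by (simp add: field_simps)
  finally have "cmod (I - 2 * of_real pi * \<i> * of_real (y - 1)) \<le> 8 * y ^ 3 / T" .
  moreover have "(perron_integrand has_contour_integral I) (linepath b c)"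
    unfolding I_def using ci(2) by (rule has_contour_integral_integral)
  ultimately show ?thesis unfolding abcd by blast
qed

lemma perron_kernel:
  assumes T: "T \<ge> 2"
  shows "\<exists>I. (perron_integrand has_contour_integral I) (linepath (Complex 2 (-T)) (Complex 2 T)) \<and>
    cmod (I - 2 * of_real pi * \<i> * of_real (max 0 (y - 1))) \<le> 8 * y ^ 3 / T"
  using perron_kernel_le_1[of T] perron_kernel_ge_1[of T] T by (cases "y \<le> 1") (auto simp: max_def)

end

lemma line_2_bounds:
  assumes "s \<in> closed_segment (Complex 2 (-T)) (Complex 2 T)"
  shows "Re s = 2" "2 \<le> cmod s" "3 \<le> cmod (s + 1)"
proof -
  show "Re s = 2" using assms by (simp add: closed_segment_same_Re)
  then show "2 \<le> cmod s" "3 \<le> cmod (s + 1)"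
    using abs_Re_le_cmod[of s] abs_Re_le_cmod[of "s + 1"] by auto
qed

text \<open>The Dirichlet series of \<open>recip_zeta\<close> is integrated termwise. The term of
  \<open>n\<close> is \<open>n * moebius_mu n\<close> times the Perron kernel at
  \<open>x / n\<close>: its main part is \<open>moebius_mu n * max 0 (x - n)\<close>, its error at
  most 8 x^3 / (T n^2), and \<open>Z\<close> is the sum of the 1 / n^2.\<close>

lemma perron_moebius:
  fixes X :: nat and T :: real
  assumes X: "X > 0" and T: "T \<ge> 2"
  defines "Z \<equiv> \<Sum>n. real (Suc n) powr (- 2)"
  shows "\<exists>J. ((\<lambda>s. perron_integrand (real X) s * recip_zeta s) has_contour_integral J)
      (linepath (Complex 2 (-T)) (Complex 2 T)) \<and>
    cmod (J - 2 * of_real pi * \<i> * of_int (\<Sum>n=1..X. moebius_mu n * (int X - int n))) \<le> 8 * Z * real X ^ 3 / T"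
proof -
  let ?l = "linepath (Complex 2 (-T)) (Complex 2 T)"
  let ?S = "closed_segment (Complex 2 (-T)) (Complex 2 T)"
  define x where "x = real X"
  have x: "x > 0" using X by (simp add: x_def)
  have smZ: "summable (\<lambda>n. real (Suc n) powr (- 2))" using summable_Suc_powr[of 2] by simp
  define f where "f n s = perron_integrand x s * (of_int (moebius_mu (Suc n)) / of_nat (Suc n) powr s)" for n s
  \<comment> \<open>A crude bound suffices: its purpose is uniform convergence on a segment of
    finite length.\<close>
  have pb: "cmod (perron_integrand x s) \<le> x powr 3" if "s \<in> ?S" for s
    using norm_perron_integrand_le[OF x, of s "x powr 3" 1 1] line_2_bounds[OF that] x
    by (auto intro: order.trans)
  have fb: "cmod (f n s) \<le> x powr 3 * real (Suc n) powr (- 2)" if "s \<in> ?S" for n s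
  proof -
    have "cmod (of_int (moebius_mu (Suc n)) / of_nat (Suc n) powr s) \<le> 1 / real (Suc n) powr 2"
      using abs_moebius_mu_le[of "Suc n"] unfolding norm_divide norm_Suc_powr line_2_bounds(1)[OF that]
      by (intro divide_right_mono) (auto simp flip: of_int_abs)
    also have "\<dots> = real (Suc n) powr (- 2)" by (simp add: powr_minus_divide)
    finally show ?thesis unfolding f_def norm_mult using pb[OF that] by (intro mult_mono) auto
  qed
  have "uniform_limit ?S (\<lambda>N s. \<Sum>n<N. f n s) (\<lambda>s. \<Sum>n. f n s) sequentially"
    by (rule Weierstrass_m_test[OF fb summable_mult[OF smZ]])
  moreover have "continuous_on ?S (f n)" for n
  proof -
    have "f n holomorphic_on {s. Re s > 0}"
      unfolding f_def[abs_def]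
      by (intro holomorphic_intros holomorphic_perron_integrand[OF x]) (simp del: of_nat_Suc)
    moreover have "?S \<subseteq> {s. Re s > 0}" using line_2_bounds(1) by fastforce
    ultimately show ?thesis using holomorphic_on_imp_continuous_on continuous_on_subset by blast
  qed
  ultimately obtain J where J: "((\<lambda>s. \<Sum>n. f n s) has_contour_integral J) ?l"
    "(\<lambda>n. contour_integral ?l (f n)) sums J"
    by (rule contour_integral_sums_linepath)
  have J1: "((\<lambda>s. perron_integrand x s * recip_zeta s) has_contour_integral J) ?l"
  proof (rule has_contour_integral_eq[OF J(1)])
    fix s assume "s \<in> path_image ?l"
    then have "Re s > 1" using line_2_bounds(1) by simp
    then show "(\<Sum>n. f n s) = perron_integrand x s * recip_zeta s"
      using sums_mult[OF recip_zeta_sums, of s "perron_integrand x s"] by (simp add: f_def sums_iff)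
  qed
  define e where "e n = contour_integral ?l (f n)
      - 2 * of_real pi * \<i> * of_real (of_int (moebius_mu (Suc n)) * max 0 (x - real (Suc n)))" for n
  have eb: "cmod (e n) \<le> 8 * x ^ 3 / T * real (Suc n) powr (- 2)" for n
  proof -
    define m where "m = real (Suc n)"
    have m: "m > 0" by (simp add: m_def)
    have xm: "x / m > 0" using x m by simp
    obtain I where I: "(perron_integrand (x / m) has_contour_integral I) ?l"
      "cmod (I - 2 * of_real pi * \<i> * of_real (max 0 (x / m - 1))) \<le> 8 * (x / m) ^ 3 / T"
      using perron_kernel[OF xm T] by blast
    define c where "c = complex_of_real (of_int (moebius_mu (Suc n)) * m)"
    \<comment> \<open>The powers regroup as x^(s + 1) m^(-s) = m (x / m)^(s + 1).\<close>
    have fc: "f n s = c * perron_integrand (x / m) s" for s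
    proof -
      have "of_real x powr (s + 1) = (of_real (x / m) * of_real m) powr (s + 1)" using m by simp
      also have "\<dots> = of_real (x / m) powr (s + 1) * of_real m powr (s + 1)"
        by (rule powr_times_real) (use xm m in auto)
      also have "of_real m powr (s + 1) = of_real m powr s * of_real m"
        using m by (simp add: powr_add)
      finally have "of_real x powr (s + 1) / of_real m powr s = of_real (x / m) powr (s + 1) * of_real m"
        using m by (simp add: field_simps)
      moreover have "f n s = of_int (moebius_mu (Suc n)) / (s * (s + 1)) * (of_real x powr (s + 1) / of_real m powr s)"
        by (simp add: f_def perron_integrand_def[OF x] m_def)
      ultimately show ?thesis by (simp add: c_def perron_integrand_def[OF xm])
    qed
    have "(f n has_contour_integral c * I) ?l"
      unfolding fc[abs_def] by (rule has_contour_integral_lmul[OF I(1)])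
    then have ci: "contour_integral ?l (f n) = c * I" by (rule contour_integral_unique)
    have "m * max 0 (x / m - 1) = max 0 (x - m)" using m by (auto simp: max_def field_simps)
    then have "e n = c * (I - 2 * of_real pi * \<i> * of_real (max 0 (x / m - 1)))"
      unfolding e_def ci c_def m_def[symmetric] by (simp add: algebra_simps flip: of_real_mult)
    moreover have "cmod c \<le> m"
    proof -
      have "\<bar>real_of_int (moebius_mu (Suc n))\<bar> \<le> 1" using abs_moebius_mu_le[of "Suc n"] by (simp flip: of_int_abs)
      then have "\<bar>real_of_int (moebius_mu (Suc n))\<bar> * m \<le> 1 * m" using m by (intro mult_right_mono) auto
      then show ?thesis using m unfolding c_def norm_of_real abs_mult by simp
    qed
    ultimately have "cmod (e n) \<le> m * (8 * (x / m) ^ 3 / T)"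
      using I(2) m by (simp only: norm_mult) (intro mult_mono; simp)
    also have "\<dots> = 8 * x ^ 3 / T * (1 / m ^ 2)"
      using m by (simp add: power_divide field_simps power2_eq_square power3_eq_cube)
    also have "1 / m ^ 2 = m powr (- 2)" using m by (simp add: powr_minus_divide powr_realpow)
    finally show ?thesis by (simp add: m_def)
  qed
  have sm: "(\<Sum>n<X. of_real (of_int (moebius_mu (Suc n)) * max 0 (x - real (Suc n)))) = (of_int (\<Sum>n=1..X. moebius_mu n * (int X - int n)) :: complex)"
  proof -
    have "(\<Sum>n=1..X. moebius_mu n * (int X - int n)) = (\<Sum>n<X. moebius_mu (Suc n) * (int X - int (Suc n)))"
      by (rule sum.reindex_bij_witness[of _ Suc "\<lambda>n. n - 1"]) auto
    moreover have "of_real (of_int (moebius_mu (Suc n)) * max 0 (x - real (Suc n))) = (of_int (moebius_mu (Suc n) * (int X - int (Suc n))) :: complex)" if "n < X" for n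
      using that by (simp add: x_def max_def)
    ultimately show ?thesis by (simp only: of_int_sum) (intro sum.cong; simp)
  qed
  have "(\<lambda>n. of_real (of_int (moebius_mu (Suc n)) * max 0 (x - real (Suc n))) :: complex) sums
      (\<Sum>n<X. of_real (of_int (moebius_mu (Suc n)) * max 0 (x - real (Suc n))))"
    by (rule sums_finite) (auto simp: x_def max_def)
  then have "e sums (J - 2 * of_real pi * \<i> * of_int (\<Sum>n=1..X. moebius_mu n * (int X - int n)))"
    unfolding e_def[abs_def] sm by (intro sums_diff J(2) sums_mult)
  then have "J - 2 * of_real pi * \<i> * of_int (\<Sum>n=1..X. moebius_mu n * (int X - int n)) = suminf e"
    by (rule sums_unique)
  also have "cmod \<dots> \<le> (\<Sum>n. 8 * x ^ 3 / T * real (Suc n) powr (- 2))"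
    by (rule norm_suminf_le[OF eb summable_mult[OF smZ]])
  also have "\<dots> = 8 * x ^ 3 / T * Z"
    unfolding Z_def by (rule suminf_mult[OF smZ])
  finally show ?thesis using J1 by (auto simp: x_def mult_ac)
qed

section \<open>The bound for the Mertens function\<close>

lemma sum_weighted_eq_sum_partial_sums:
  fixes a :: "nat \<Rightarrow> int"
  shows "(\<Sum>n=1..X. a n * (int X - int n)) = (\<Sum>j<X. \<Sum>n=1..j. a n)"
proof (induction X)
  case (Suc X)
  have "(\<Sum>n=1..Suc X. a n * (int (Suc X) - int n)) = (\<Sum>n=1..X. a n * (int X - int n) + a n)"
    by (simp add: algebra_simps)
  then show ?case using Suc by (simp add: sum.distrib)
qed simp

text \<open>The mean value bound carries the factor \<open>h\<close> and is the better one at small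
  height; the trivial bound has no factor \<open>s + 1\<close> and takes over once
  \<open>cmod (s + 1)\<close> exceeds about \<open>x / h\<close>.\<close>

lemma powr_difference_bounds:
  fixes x h :: real
  assumes x: "x > 0" and h: "0 \<le> h" "h \<le> x" and s: "0 \<le> Re s"
  shows "cmod (of_real (x + h) powr (s + 1) - of_real x powr (s + 1)) \<le> cmod (s + 1) * h * (2 * x) powr Re s"
    and "cmod (of_real (x + h) powr (s + 1) - of_real x powr (s + 1)) \<le> 2 * (2 * x) powr (Re s + 1)"
proof -
  let ?S = "closed_segment (complex_of_real x) (complex_of_real (x + h))"
  have "cmod (of_real (x + h) powr (s + 1) - of_real x powr (s + 1)) \<le> cmod (s + 1) * (2 * x) powr Re s * cmod (of_real (x + h) - of_real x)"
  proof (rule field_differentiable_bound[where S = ?S and f = "\<lambda>u. u powr (s + 1)" and f' = "\<lambda>u. (s + 1) * u powr s"])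
    fix u assume "u \<in> ?S"
    then obtain t where t: "u = of_real t" "x \<le> t" "t \<le> x + h"
      using mem_closed_segment_of_real[of u x "x + h"] h by auto
    have "u \<notin> \<real>\<^sub>\<le>\<^sub>0" using t x by (simp add: complex_nonpos_Reals_iff)
    from has_field_derivative_powr[OF this, of "s + 1"]
    show "((\<lambda>u. u powr (s + 1)) has_field_derivative (s + 1) * u powr s) (at u within ?S)"
      by (auto intro: has_field_derivative_at_within)
    have "cmod (u powr s) = t powr Re s" using t x norm_powr_real_powr[of u s] by simp
    also have "\<dots> \<le> (2 * x) powr Re s" using t x h s by (intro powr_mono2) auto
    finally show "cmod ((s + 1) * u powr s) \<le> cmod (s + 1) * (2 * x) powr Re s"
      by (simp add: norm_mult mult_left_mono)
  qed auto
  also have "cmod (complex_of_real (x + h) - of_real x) = h" using h by simp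
  finally show "cmod (of_real (x + h) powr (s + 1) - of_real x powr (s + 1)) \<le> cmod (s + 1) * h * (2 * x) powr Re s"
    by (simp add: mult_ac)
  have "cmod (of_real t powr (s + 1)) \<le> (2 * x) powr (Re s + 1)" if "0 < t" "t \<le> 2 * x" for t
    using that s norm_powr_real_powr[of "of_real t" "s + 1"] by (simp add: powr_mono2)
  from add_mono[OF this[of "x + h"] this[of x]]
  show "cmod (of_real (x + h) powr (s + 1) - of_real x powr (s + 1)) \<le> 2 * (2 * x) powr (Re s + 1)"
    using x h norm_triangle_ineq4[of "of_real (x + h) powr (s + 1)" "of_real x powr (s + 1)"] by simp
qed

text \<open>The bound is independent of \<open>T\<close>, so the contribution of the vertical side
  survives the passage of \<open>T\<close> to infinity.\<close>

lemma integral_powr_decay_le: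
  fixes \<eta> T :: real
  assumes \<eta>: "\<eta> > 0" and T: "T \<ge> 0"
  shows "\<exists>I. ((\<lambda>t. (\<bar>t\<bar> + 3) powr (- \<eta> - 1)) has_integral I) {-T..T} \<and> I \<le> 2 / \<eta>"
proof -
  have up: "((\<lambda>t. (\<bar>t\<bar> + 3) powr (- \<eta> - 1)) has_integral (- ((T + 3) powr (- \<eta>) / \<eta>) - - ((0 + 3) powr (- \<eta>) / \<eta>))) {0..T}"
  proof (rule fundamental_theorem_of_calculus[OF T])
    fix t assume t: "t \<in> {0..T}"
    have "((\<lambda>t. - ((t + 3) powr (- \<eta>) / \<eta>)) has_real_derivative (\<bar>t\<bar> + 3) powr (- \<eta> - 1)) (at t within {0..T})"
      using t \<eta> by (auto intro!: derivative_eq_intros simp: algebra_simps)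
    then show "((\<lambda>t. - ((t + 3) powr (- \<eta>) / \<eta>)) has_vector_derivative (\<bar>t\<bar> + 3) powr (- \<eta> - 1)) (at t within {0..T})"
      by (simp add: has_real_derivative_iff_has_vector_derivative)
  qed
  have down: "((\<lambda>t. (\<bar>t\<bar> + 3) powr (- \<eta> - 1)) has_integral ((3 - 0) powr (- \<eta>) / \<eta> - (3 - (- T)) powr (- \<eta>) / \<eta>)) {-T..0}"
  proof (rule fundamental_theorem_of_calculus)
    fix t assume t: "t \<in> {-T..0}"
    have "((\<lambda>t. (3 - t) powr (- \<eta>) / \<eta>) has_real_derivative (\<bar>t\<bar> + 3) powr (- \<eta> - 1)) (at t within {-T..0})"
      using t \<eta> by (auto intro!: derivative_eq_intros simp: algebra_simps)
    then show "((\<lambda>t. (3 - t) powr (- \<eta>) / \<eta>) has_vector_derivative (\<bar>t\<bar> + 3) powr (- \<eta> - 1)) (at t within {-T..0})"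
      by (simp add: has_real_derivative_iff_has_vector_derivative)
  qed (use T in simp)
  note I = has_integral_combine[OF _ _ down up]
  have "3 powr (- \<eta>) \<le> (1::real)" using \<eta> powr_mono[of "- \<eta>" 0 3] by simp
  then have "3 powr (- \<eta>) / \<eta> \<le> 1 / \<eta>" using \<eta> by (intro divide_right_mono) auto
  moreover have "0 \<le> (T + 3) powr (- \<eta>) / \<eta>" using \<eta> by simp
  ultimately have "((3 - 0) powr (- \<eta>) / \<eta> - (3 - (- T)) powr (- \<eta>) / \<eta>) + (- ((T + 3) powr (- \<eta>) / \<eta>) - - ((0 + 3) powr (- \<eta>) / \<eta>)) \<le> 2 / \<eta>"
    by (simp add: add.commute)
  then show ?thesis using I T by (intro exI conjI) auto
qed

lemma le_of_forall_le_add_div: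
  fixes a b c :: real
  assumes "\<And>T. T \<ge> 2 \<Longrightarrow> a \<le> b + c / T"
  shows "a \<le> b"
proof (rule tendsto_lowerbound)
  have "((\<lambda>T::real. b + c / T) \<longlongrightarrow> b + 0) at_top"
    by (intro tendsto_intros tendsto_divide_0[OF tendsto_const] filterlim_at_top_imp_at_infinity filterlim_ident)
  then show "((\<lambda>T::real. b + c / T) \<longlongrightarrow> b) at_top" by simp
  show "\<forall>\<^sub>F T in at_top. a \<le> b + c / T"
    using eventually_ge_at_top[of 2] by eventually_elim (rule assms)
qed simp

text \<open>The bound for the increment of \<open>M1\<close> over \<open>k\<close> steps contains
  the factor \<open>h = k\<close>, inherited from the mean value bound for the kernel. This
  increment is \<open>h * M N\<close> up to an error \<open>h * h\<close>, because \<open>M\<close>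
  moves by at most 1 per step. Division by \<open>h\<close> leaves the error \<open>h\<close>, which
  stays within \<open>sqrt x\<close>.\<close>

theorem mertens_bound:
  fixes \<kappa> :: real
  assumes RH: "GRH" and \<kappa>: "0 < \<kappa>" "\<kappa> < 1"
  shows "\<exists>C>0. \<forall>N\<ge>1. \<bar>real_of_int (\<Sum>n=1..N. moebius_mu n)\<bar> \<le> C * real N powr (1 / 2 + \<kappa>)"
proof -
  \<comment> \<open>The split is fixed by \<open>\<sigma> + 2 * \<eta> = 1 / 2 + \<kappa>\<close>:
    half of \<open>\<kappa>\<close> keeps the contour away from the critical line, the other half
    pays for the interpolation.\<close>
  define \<delta> where "\<delta> = \<kappa> / 2"
  define \<eta> where "\<eta> = \<kappa> / 4"
  define \<sigma> where "\<sigma> = 1 / 2 + \<delta>"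
  have \<delta>: "0 < \<delta>" "\<delta> < 1" and \<eta>: "0 < \<eta>" "\<eta> < 1 / 2" using \<kappa> by (auto simp: \<delta>_def \<eta>_def)
  have \<sigma>: "1 / 2 < \<sigma>" "\<sigma> \<le> 1" using \<kappa> by (auto simp: \<sigma>_def \<delta>_def)
  obtain C where C: "C > 0" and growth: "\<And>s. \<sigma> \<le> Re s \<Longrightarrow> Re s \<le> 2 \<Longrightarrow> cmod (recip_zeta s) \<le> C * (\<bar>Im s\<bar> + 3) powr \<eta>"
    using recip_zeta_growth[OF RH \<delta> \<eta>(1)] unfolding \<sigma>_def by blast
  define Z where "Z = (\<Sum>n. real (Suc n) powr (- 2))"
  \<comment> \<open>392 = 14 * 28 collects the constants on the vertical line,
    \<open>2 / \<eta>\<close> bounds the integral of the decay factor, and the 1 takes up the error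
    \<open>h\<close>.\<close>
  define D where "D = 1 + 392 * C * (2 / \<eta>)"
  have main: "\<bar>real_of_int (\<Sum>n=1..N. moebius_mu n)\<bar> \<le> D * real N powr (1 / 2 + \<kappa>)" if N: "N \<ge> 1" for N :: nat
  proof -
    define x where "x = real N"
    have x: "x \<ge> 1" using N by (simp add: x_def)
    define k where "k = nat \<lfloor>sqrt x\<rfloor>"
    define h where "h = real k"
    have sx: "1 \<le> sqrt x" using x by simp
    have h: "1 \<le> h" "h \<le> sqrt x"
    proof -
      have "1 \<le> \<lfloor>sqrt x\<rfloor>" using sx by simp
      then show "1 \<le> h" "h \<le> sqrt x" unfolding h_def k_def by linarith+
    qed
    have "sqrt x * 1 \<le> sqrt x * sqrt x" using sx by (intro mult_left_mono) auto
    then have hx: "h \<le> x" using h x by simp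
    have x0: "x > 0" and h0: "0 \<le> h" and xh: "x + h > 0" using x h by auto
    define Q where "Q s = (of_real (x + h) powr (s + 1) - of_real x powr (s + 1)) / (s * (s + 1))" for s :: complex
    define G where "G s = Q s * recip_zeta s" for s
    have pos: "Re s > 1 / 2 \<Longrightarrow> s \<noteq> 0 \<and> s + 1 \<noteq> 0" for s :: complex
      by (auto simp: complex_eq_iff)
    have Ghol: "G holomorphic_on {s. Re s > 1 / 2}"
      unfolding G_def[abs_def] Q_def[abs_def]
      by (intro holomorphic_intros holomorphic_recip_zeta[OF RH]) (use pos in auto)
    have Q1: "cmod (Q s) \<le> h * (2 * x) powr Re s / cmod s" if "Re s > 1 / 2" for s
    proof -
      have "cmod (Q s) \<le> cmod (s + 1) * h * (2 * x) powr Re s / (cmod s * cmod (s + 1))"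
        using powr_difference_bounds(1)[OF x0 h0 hx, of s] that
        unfolding Q_def norm_divide norm_mult by (intro divide_right_mono) auto
      then show ?thesis using pos[OF that] by simp
    qed
    have Q2: "cmod (Q s) \<le> 2 * (2 * x) powr (Re s + 1) / (cmod s * cmod (s + 1))" if "Re s > 1 / 2" for s
      using powr_difference_bounds(2)[OF x0 h0 hx, of s] that
      unfolding Q_def norm_divide norm_mult by (intro divide_right_mono) auto
    text \<open>Interpolation between the two bounds gains the factor \<open>w powr (- 2 * \<eta>)\<close> needed for
      absolute convergence at the price of \<open>x powr (2 * \<eta>)\<close>.\<close>
    have vertical: "cmod (G s) \<le> 392 * C * h * x powr (1 / 2 + \<kappa>) * (\<bar>Im s\<bar> + 3) powr (- \<eta> - 1)" if s: "Re s = \<sigma>" for s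
    proof -
      define w where "w = \<bar>Im s\<bar> + 3"
      have w: "w \<ge> 3" by (simp add: w_def)
      have re: "Re s > 1 / 2" using s \<sigma> by simp
      \<comment> \<open>The real part exceeds \<open>1 / 2\<close>, so the summand 3 is at most
        \<open>6 * cmod s\<close>.\<close>
      have sw: "w \<le> 7 * cmod s" using abs_Im_le_cmod[of s] abs_Re_le_cmod[of s] re by (simp add: w_def)
      have s0: "cmod s > 0" using pos[OF re] by simp
      have "1 / cmod s \<le> 7 / w" using sw w s0 by (simp add: field_simps)
      define A where "A = 7 * h * (2 * x) powr \<sigma> / w"
      have A: "A \<ge> 0" using w h by (simp add: A_def)
      have QA: "cmod (Q s) \<le> A"
      proof -
        have "h * (2 * x) powr \<sigma> * (1 / cmod s) \<le> h * (2 * x) powr \<sigma> * (7 / w)"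
          using \<open>1 / cmod s \<le> 7 / w\<close> h by (intro mult_left_mono) auto
        then show ?thesis using Q1[OF re] s by (simp add: A_def mult_ac)
      qed
      \<comment> \<open>The trivial bound gains a further factor \<open>1 / w\<close> but has no
        \<open>h\<close>; inserting \<open>h \<ge> 1\<close> turns both bounds into multiples of
        \<open>A\<close>, with ratio \<open>28 * x / w\<close>.\<close>
      have QB: "cmod (Q s) \<le> A * (28 * x / w)"
      proof -
        have "(cmod s)\<^sup>2 \<le> (cmod (s + 1))\<^sup>2" using re unfolding cmod_power2 by (simp add: power2_eq_square algebra_simps)
        then have ss: "cmod s \<le> cmod (s + 1)" by (rule power2_le_imp_le) simp
        have "2 * (2 * x) powr (\<sigma> + 1) / (cmod s * cmod (s + 1)) \<le> 2 * (2 * x) powr (\<sigma> + 1) / (cmod s * cmod s)"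
          using s0 ss by (intro divide_left_mono mult_left_mono mult_pos_pos) auto
        also have "\<dots> = 2 * (2 * x) powr (\<sigma> + 1) * ((1 / cmod s) * (1 / cmod s))" by simp
        also have "\<dots> \<le> 2 * (2 * x) powr (\<sigma> + 1) * ((7 / w) * (7 / w))"
          using \<open>1 / cmod s \<le> 7 / w\<close> w by (intro mult_left_mono mult_mono) auto
        also have "\<dots> = 1 * (7 * (2 * x) powr \<sigma> / w * (28 * x / w))"
          using x0 by (simp add: powr_add field_simps)
        also have "\<dots> \<le> h * (7 * (2 * x) powr \<sigma> / w * (28 * x / w))"
          using h x0 w by (intro mult_right_mono) auto
        finally show ?thesis using Q2[OF re] s by (simp add: A_def mult_ac)
      qed
      have "cmod (Q s) \<le> A * (28 * x / w) powr (2 * \<eta>)"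
      proof (cases "28 * x / w \<ge> 1")
        case True
        then have "1 \<le> (28 * x / w) powr (2 * \<eta>)" using \<eta> by (intro ge_one_powr_ge_zero) auto
        then have "A * 1 \<le> A * (28 * x / w) powr (2 * \<eta>)" using A by (intro mult_left_mono) auto
        then show ?thesis using QA by simp
      next
        case False
        have "(28 * x / w) powr 1 \<le> (28 * x / w) powr (2 * \<eta>)" using False x0 w \<eta> by (intro powr_mono') auto
        moreover have "0 < 28 * x / w" using x0 w by simp
        ultimately have "28 * x / w \<le> (28 * x / w) powr (2 * \<eta>)" using x0 w by simp
        then have "A * (28 * x / w) \<le> A * (28 * x / w) powr (2 * \<eta>)" using A by (intro mult_left_mono) auto
        then show ?thesis using QB by simp
      qed
      also have "(28 * x / w) powr (2 * \<eta>) \<le> 28 * x powr (2 * \<eta>) * w powr (- (2 * \<eta>))"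
      proof -
        have "(28 * x / w) powr (2 * \<eta>) = 28 powr (2 * \<eta>) * x powr (2 * \<eta>) * w powr (- (2 * \<eta>))"
          using x0 w by (simp add: powr_mult powr_divide powr_minus_divide)
        moreover have "28 powr (2 * \<eta>) \<le> (28::real)" using powr_mono[of "2 * \<eta>" 1 28] \<eta> by simp
        ultimately show ?thesis by (simp add: mult_right_mono)
      qed
      also have "A \<le> 14 * h * x powr \<sigma> * w powr (- 1)"
      proof -
        have "2 powr \<sigma> \<le> (2::real)" using powr_mono[of \<sigma> 1 2] \<sigma> by simp
        then have "7 * h / w * (2 powr \<sigma> * x powr \<sigma>) \<le> 7 * h / w * (2 * x powr \<sigma>)"
          using h w by (intro mult_left_mono mult_right_mono) auto
        then show ?thesis using x0 w by (simp add: A_def powr_mult powr_minus_divide)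
      qed
      finally have "cmod (Q s) \<le> (14 * h * x powr \<sigma> * w powr (- 1)) * (28 * x powr (2 * \<eta>) * w powr (- (2 * \<eta>)))"
        using A by (simp add: mult_left_mono mult_right_mono)
      then have "cmod (Q s) * cmod (recip_zeta s) \<le> ((14 * h * x powr \<sigma> * w powr (- 1)) * (28 * x powr (2 * \<eta>) * w powr (- (2 * \<eta>)))) * (C * w powr \<eta>)"
        using growth[of s] s \<sigma> h by (intro mult_mono) (auto simp: w_def)
      also have "\<dots> = 392 * C * h * (x powr \<sigma> * x powr (2 * \<eta>)) * (w powr (- 1) * w powr (- (2 * \<eta>)) * w powr \<eta>)" by simp
      also have "x powr \<sigma> * x powr (2 * \<eta>) = x powr (1 / 2 + \<kappa>)"
      proof -
        have "\<sigma> + 2 * \<eta> = 1 / 2 + \<kappa>" by (simp add: \<sigma>_def \<delta>_def \<eta>_def)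
        then show ?thesis by (simp only: powr_add[symmetric])
      qed
      also have "w powr (- 1) * w powr (- (2 * \<eta>)) * w powr \<eta> = w powr (- \<eta> - 1)"
      proof -
        have "- 1 + - (2 * \<eta>) + \<eta> = - \<eta> - 1" by simp
        then show ?thesis by (simp only: powr_add[symmetric])
      qed
      finally show ?thesis by (simp add: G_def norm_mult w_def)
    qed
    define I0 where "I0 = 392 * C * h * x powr (1 / 2 + \<kappa>) * (2 / \<eta>)"
    define M1 where "M1 X = real_of_int (\<Sum>n=1..X. moebius_mu n * (int X - int n))" for X
    define E where "E = 16 * Z * (2 * x) ^ 3 + 24 * C * (2 * x) ^ 3"
    have step: "2 * pi * \<bar>M1 (N + k) - M1 N\<bar> \<le> I0 + E / T" if T: "T \<ge> 2" for T
    proof -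
      define a b c d where "a = Complex 2 (-T)" and "b = Complex 2 T"
        and "c = Complex \<sigma> T" and "d = Complex \<sigma> (-T)"
      note abcd = a_def b_def c_def d_def
      let ?S = "{s. Re s > 1 / 2}"
      have ins: "a \<in> ?S" "b \<in> ?S" "c \<in> ?S" "d \<in> ?S" using \<sigma> by (auto simp: abcd)
      obtain I J K L where I: "(G has_contour_integral I) (linepath a b)"
        and J: "(G has_contour_integral J) (linepath d c)"
        and K: "(G has_contour_integral K) (linepath a d)"
        and L: "(G has_contour_integral L) (linepath c b)" and eq: "I = K + J + L"
        by (rule contour_integral_four_sides[OF convex_halfspace_Re_gt open_Re_gt Ghol ins])
      \<comment> \<open>On the horizontal sides linear growth of \<open>recip_zeta\<close> is
        affordable: the kernel supplies 1 / T^2, so 1 / T remains.\<close>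
      have hb: "cmod (G s) \<le> 6 * C * (2 * x) ^ 3 / T" if "\<bar>Im s\<bar> = T" "\<sigma> \<le> Re s" "Re s \<le> 2" for s
      proof -
        have re: "Re s > 1 / 2" using that \<sigma> by simp
        have "T * T \<le> cmod s * cmod (s + 1)"
          using that abs_Im_le_cmod[of s] abs_Im_le_cmod[of "s + 1"] T by (intro mult_mono) auto
        moreover have "(2 * x) powr (Re s + 1) \<le> (2 * x) ^ 3"
          using powr_mono[of "Re s + 1" 3 "2 * x"] that x by simp
        ultimately have "2 * (2 * x) powr (Re s + 1) / (cmod s * cmod (s + 1)) \<le> 2 * (2 * x) ^ 3 / (T * T)"
          using x T by (intro frac_le) auto
        then have q: "cmod (Q s) \<le> 2 * (2 * x) ^ 3 / (T * T)" using Q2[OF re] by simp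
        have "(\<bar>Im s\<bar> + 3) powr \<eta> \<le> (T + 3) powr 1" unfolding that(1) using T \<eta> by (intro powr_mono) auto
        also have "\<dots> \<le> 3 * T" using T by simp
        finally have "C * (\<bar>Im s\<bar> + 3) powr \<eta> \<le> C * (3 * T)" using C by (intro mult_left_mono) auto
        then have "cmod (recip_zeta s) \<le> C * (3 * T)" using growth[of s] that by simp
        then have "cmod (Q s) * cmod (recip_zeta s) \<le> 2 * (2 * x) ^ 3 / (T * T) * (C * (3 * T))"
          using q x T by (intro mult_mono) auto
        also have "\<dots> = 6 * C * (2 * x) ^ 3 / T" using T by (simp add: field_simps)
        finally show ?thesis by (simp add: G_def norm_mult)
      qed
      have B0: "0 \<le> 6 * C * (2 * x) ^ 3 / T" using C x T by simp
      have K: "cmod K \<le> 6 * C * (2 * x) ^ 3 / T * cmod (d - a)"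
      proof (rule has_contour_integral_bound_linepath[OF K B0])
        fix s assume "s \<in> closed_segment a d"
        then have "\<bar>Im s\<bar> = T" "\<sigma> \<le> Re s" "Re s \<le> 2" using T \<sigma>
          by (auto simp: abcd closed_segment_same_Im closed_segment_eq_real_ivl)
        then show "cmod (G s) \<le> 6 * C * (2 * x) ^ 3 / T" by (rule hb)
      qed
      have L: "cmod L \<le> 6 * C * (2 * x) ^ 3 / T * cmod (b - c)"
      proof (rule has_contour_integral_bound_linepath[OF L B0])
        fix s assume "s \<in> closed_segment c b"
        then have "\<bar>Im s\<bar> = T" "\<sigma> \<le> Re s" "Re s \<le> 2" using T \<sigma>
          by (auto simp: abcd closed_segment_same_Im closed_segment_eq_real_ivl)
        then show "cmod (G s) \<le> 6 * C * (2 * x) ^ 3 / T" by (rule hb)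
      qed
      have diffs: "d - a = of_real (\<sigma> - 2)" "b - c = of_real (2 - \<sigma>)"
        by (auto simp: abcd complex_eq_iff)
      have len: "cmod (d - a) \<le> 2" "cmod (b - c) \<le> 2"
        using \<sigma> unfolding diffs norm_of_real by auto
      have KL: "cmod K + cmod L \<le> 24 * C * (2 * x) ^ 3 / T"
        using order.trans[OF K mult_left_mono[OF len(1) B0]] order.trans[OF L mult_left_mono[OF len(2) B0]] by simp
      have J: "cmod J \<le> I0"
      proof -
        have hi: "((\<lambda>t. G (Complex \<sigma> t)) has_integral (- \<i> * J)) {-T..T}"
          using J T has_contour_integral_linepath_same_Re_iff[of d \<sigma> c "-T" T G J] by (simp add: abcd)
        obtain I1 where I1: "((\<lambda>t. (\<bar>t\<bar> + 3) powr (- \<eta> - 1)) has_integral I1) {-T..T}" "I1 \<le> 2 / \<eta>"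
          using integral_powr_decay_le[OF \<eta>(1), of T] T by auto
        let ?K = "392 * C * h * x powr (1 / 2 + \<kappa>)"
        have K0: "?K \<ge> 0" using C h by simp
        have hk: "((\<lambda>t. ?K * (\<bar>t\<bar> + 3) powr (- \<eta> - 1)) has_integral ?K * I1) {-T..T}"
          by (rule has_integral_mult_right[OF I1(1)])
        have "norm (integral {-T..T} (\<lambda>t. G (Complex \<sigma> t))) \<le> integral {-T..T} (\<lambda>t. ?K * (\<bar>t\<bar> + 3) powr (- \<eta> - 1))"
          using hi hk by (intro integral_norm_bound_integral) (auto intro: order.trans[OF vertical])
        then have "cmod (- \<i> * J) \<le> ?K * I1" unfolding integral_unique[OF hi] integral_unique[OF hk] .
        also have "\<dots> \<le> I0" unfolding I0_def using I1(2) K0 by (intro mult_left_mono)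
        finally show ?thesis by (simp add: norm_mult)
      qed
      have Ib: "cmod I \<le> I0 + 24 * C * (2 * x) ^ 3 / T"
        using norm_triangle_ineq[of "K + J" L] norm_triangle_ineq[of K J] KL J unfolding eq by linarith
      let ?p = "2 * complex_of_real pi * \<i>"
      obtain P1 where P1: "((\<lambda>s. perron_integrand (real (N + k)) s * recip_zeta s) has_contour_integral P1) (linepath a b)"
        "cmod (P1 - ?p * of_real (M1 (N + k))) \<le> 8 * Z * real (N + k) ^ 3 / T"
        using perron_moebius[of "N + k" T] N T unfolding Z_def M1_def a_def b_def by auto
      obtain P0 where P0: "((\<lambda>s. perron_integrand (real N) s * recip_zeta s) has_contour_integral P0) (linepath a b)"
        "cmod (P0 - ?p * of_real (M1 N)) \<le> 8 * Z * real N ^ 3 / T"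
        using perron_moebius[of N T] N T unfolding Z_def M1_def a_def b_def by auto
      have xh': "real (N + k) = x + h" by (simp add: x_def h_def)
      have "(G has_contour_integral (P1 - P0)) (linepath a b)"
      proof (rule has_contour_integral_eq[OF has_contour_integral_diff[OF P1(1) P0(1)]])
        show "perron_integrand (real (N + k)) s * recip_zeta s - perron_integrand (real N) s * recip_zeta s = G s" for s
          using perron_integrand_def[OF xh] perron_integrand_def[OF x0]
          unfolding xh' G_def Q_def by (simp add: x_def diff_divide_distrib left_diff_distrib)
      qed
      then have "I = P1 - P0" using I contour_integral_unique by metis
      then have "2 * of_real pi * \<i> * of_real (M1 (N + k) - M1 N) =
          I - (P1 - ?p * of_real (M1 (N + k))) + (P0 - ?p * of_real (M1 N))"
        by (simp add: algebra_simps)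
      also have "cmod \<dots> \<le> cmod I + cmod (P1 - ?p * of_real (M1 (N + k))) + cmod (P0 - ?p * of_real (M1 N))"
        by (meson add_mono norm_triangle_ineq norm_triangle_ineq4 order.trans order_refl)
      also have "\<dots> \<le> (I0 + 24 * C * (2 * x) ^ 3 / T) + 8 * Z * (2 * x) ^ 3 / T + 8 * Z * (2 * x) ^ 3 / T"
      proof (intro add_mono Ib order.trans[OF P1(2)] order.trans[OF P0(2)] divide_right_mono mult_left_mono power_mono)
        show "0 \<le> 8 * Z" using summable_Suc_powr[of 2] by (auto simp: Z_def intro!: suminf_nonneg)
        then show "0 \<le> 8 * Z" .
      qed (use T x hx in \<open>auto simp: x_def h_def\<close>)
      also have "\<dots> = I0 + E / T" by (simp add: E_def add_divide_distrib)
      finally show ?thesis by (simp add: norm_mult del: of_real_diff)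
    qed
    have "2 * pi * \<bar>M1 (N + k) - M1 N\<bar> \<le> I0" using step by (rule le_of_forall_le_add_div)
    moreover have "1 * \<bar>M1 (N + k) - M1 N\<bar> \<le> (2 * pi) * \<bar>M1 (N + k) - M1 N\<bar>"
      using pi_ge_two by (intro mult_right_mono) auto
    ultimately have dM: "\<bar>M1 (N + k) - M1 N\<bar> \<le> I0" by simp
    define M where "M j = real_of_int (\<Sum>n=1..j. moebius_mu n)" for j
    have M1M: "M1 X = (\<Sum>j<X. M j)" for X
      unfolding M1_def M_def sum_weighted_eq_sum_partial_sums by simp
    have Mdiff: "\<bar>M (N + i) - M N\<bar> \<le> real i" for i
    proof (induction i)
      case (Suc i)
      have "M (N + Suc i) = M (N + i) + of_int (moebius_mu (N + Suc i))" by (simp add: M_def)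
      moreover have "\<bar>real_of_int (moebius_mu (N + Suc i))\<bar> \<le> 1"
        using abs_moebius_mu_le[of "N + Suc i"] by (simp flip: of_int_abs)
      ultimately show ?case using Suc by simp
    qed simp
    have "M1 (N + k) = M1 N + (\<Sum>i<k. M (N + i))" unfolding M1M
      by (induction k) (simp_all add: add.assoc)
    then have "M1 (N + k) - M1 N = (\<Sum>i<k. (M (N + i) - M N)) + h * M N"
      by (simp add: sum_subtractf h_def)
    moreover have "\<bar>\<Sum>i<k. (M (N + i) - M N)\<bar> \<le> h * h"
    proof -
      have "\<bar>\<Sum>i<k. (M (N + i) - M N)\<bar> \<le> (\<Sum>i<k. \<bar>M (N + i) - M N\<bar>)" by (rule sum_abs)
      also have "\<dots> \<le> (\<Sum>i<k. h)" unfolding h_def by (intro sum_mono order.trans[OF Mdiff]) auto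
      finally show ?thesis by (simp add: h_def)
    qed
    ultimately have "\<bar>h * M N\<bar> \<le> h * h + I0" using dM by linarith
    also have "I0 = h * (392 * C * (2 / \<eta>) * x powr (1 / 2 + \<kappa>))" by (simp add: I0_def)
    finally have "h * \<bar>M N\<bar> \<le> h * (h + 392 * C * (2 / \<eta>) * x powr (1 / 2 + \<kappa>))"
      using h by (simp add: abs_mult distrib_left)
    then have "\<bar>M N\<bar> \<le> h + 392 * C * (2 / \<eta>) * x powr (1 / 2 + \<kappa>)" using h by simp
    also have "h \<le> x powr (1 / 2 + \<kappa>)"
      using h(2) powr_mono[of "1 / 2" "1 / 2 + \<kappa>" x] x \<kappa> by (simp add: powr_half_sqrt)
    finally show ?thesis by (simp add: M_def D_def x_def algebra_simps)
  qed
  have "D > 0" using C \<eta> by (simp add: D_def add_pos_pos)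
  then show ?thesis using main by blast
qed

section \<open>The sum over the Moebius function\<close>

lemma le_ennreal_of_SUP_finite:
  fixes c :: "'a \<Rightarrow> real"
  assumes "(SUP x\<in>A. ennreal (c x)) < \<infinity>"
  shows "\<exists>D\<ge>0. \<forall>x\<in>A. c x \<le> D"
proof -
  obtain D where D: "D \<ge> 0" "(SUP x\<in>A. ennreal (c x)) = ennreal D"
    using assms by (cases "SUP x\<in>A. ennreal (c x)") auto
  have "c x \<le> D" if "x \<in> A" for x
  proof -
    have "ennreal (c x) \<le> ennreal D" unfolding D(2)[symmetric] by (rule SUP_upper[OF that])
    then show ?thesis using D(1) by (simp add: ennreal_le_iff)
  qed
  then show ?thesis using D(1) by blast
qed

text \<open>Twice the increment of step \<open>h\<close> is the increment of step
  \<open>2 * h\<close> minus a second difference. After \<open>j\<close> doublings the trivial bound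
  \<open>2 * K\<close> has been divided by \<open>2 ^ j\<close>, and each doubling has cost
  \<open>D * h / 2\<close>.\<close>

lemma zygmund_increment_dyadic:
  fixes f :: "real \<Rightarrow> complex"
  assumes K: "\<And>x. cmod (f x) \<le> K"
    and D: "\<And>x h. h > 0 \<Longrightarrow> cmod (f x - 2 * f (x + h) + f (x + 2 * h)) \<le> D * h"
    and h: "h > 0"
  shows "cmod (f (x + h) - f x) \<le> 2 * K / 2 ^ j + real j / 2 * D * h"
  using h
proof (induction j arbitrary: h)
  case 0
  show ?case using norm_triangle_ineq4[of "f (x + h)" "f x"] K[of "x + h"] K[of x] by simp
next
  case (Suc j)
  have "2 * (f (x + h) - f x) = (f (x + 2 * h) - f x) - (f x - 2 * f (x + h) + f (x + 2 * h))"
    by (simp add: algebra_simps)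
  then have "cmod (2 * (f (x + h) - f x)) \<le> cmod (f (x + 2 * h) - f x) + cmod (f x - 2 * f (x + h) + f (x + 2 * h))"
    by (simp only: norm_triangle_ineq4)
  also have "\<dots> \<le> (2 * K / 2 ^ j + real j / 2 * D * (2 * h)) + D * h"
    using Suc.prems by (intro add_mono Suc.IH D) auto
  finally have "2 * cmod (f (x + h) - f x) \<le> (2 * K / 2 ^ j + real j / 2 * D * (2 * h)) + D * h"
    by (simp only: norm_mult norm_numeral)
  then show ?case by (simp add: field_simps)
qed

lemma ln_ge_1:
  assumes "4 \<le> (N::nat)" shows "1 \<le> ln (real N)"
proof -
  have "exp 1 \<le> real N" using exp_le assms by linarith
  then show ?thesis using ln_ge_iff[of "real N" 1] assms by simp
qed

lemma ex_power_2_ge: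
  assumes "4 \<le> (N::nat)"
  shows "\<exists>j. real N \<le> 2 ^ j \<and> real j \<le> 3 * ln (real N)"
proof -
  define j where "j = nat \<lceil>ln (real N) / ln 2\<rceil>"
  have l2: "ln 2 \<ge> 2 / (3::real)" by (rule ln2_ge_two_thirds)
  have lN: "ln (real N) \<ge> 1" using assms by (rule ln_ge_1)
  have pos: "0 < ln (real N) / ln 2" using lN l2 by simp
  have j: "ln (real N) / ln 2 \<le> real j" "real j \<le> ln (real N) / ln 2 + 1"
    using pos unfolding j_def by linarith+
  have "ln (real N) \<le> real j * ln 2" using j(1) l2 by (simp add: field_simps)
  also have "\<dots> = ln (2 ^ j)" by (simp add: ln_realpow)
  finally have "real N \<le> 2 ^ j" using assms by simp
  moreover have "ln (real N) / ln 2 \<le> 3 / 2 * ln (real N)"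
  proof -
    have "ln (real N) * (2 / 3) \<le> ln (real N) * ln 2" using lN l2 by (intro mult_left_mono) auto
    then show ?thesis using l2 by (simp add: pos_divide_le_eq)
  qed
  then have "real j \<le> 3 * ln (real N)" using j(2) lN by linarith
  ultimately show ?thesis by blast
qed

text \<open>For \<open>\<delta> = 1\<close> the Lipschitz condition can fail by a logarithm: the
  dyadic bound with about \<open>ln N\<close> doublings at step \<open>1 / N\<close> gives
  \<open>ln N / N\<close>. For \<open>\<delta> > 1\<close> the derivative is bounded, which gives
  \<open>1 / N\<close>; the factor \<open>ln N\<close>, at least 1 for \<open>N \<ge> 4\<close>, is
  inserted to have one form for both ranges.\<close>

lemma holder_zygmund_increment:
  assumes f: "f \<in> holder_zygmund \<delta>"
  shows "\<exists>B>0. (\<forall>x. cmod (f x) \<le> B) \<and>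
    (\<forall>N::nat. 4 \<le> N \<longrightarrow> (\<forall>x. cmod (f (x + 1 / real N) - f x) \<le> B * ln (real N) / real N))"
proof -
  obtain K where K: "\<And>x. cmod (f x) \<le> K" using f by (auto simp: holder_zygmund_def bounded_iff)
  have K0: "K \<ge> 0" using order.trans[OF norm_ge_zero K] .
  consider "\<delta> = 1" "difference_seminorm 2 1 f < \<infinity>"
    | "f C1_differentiable_on UNIV" "sup_norm (\<lambda>x. vector_derivative f (at x)) < \<infinity>"
    using f by (auto simp: holder_zygmund_def holder_norm_def less_top)
  then have "\<exists>E\<ge>0. \<forall>N::nat. 4 \<le> N \<longrightarrow> (\<forall>x. cmod (f (x + 1 / real N) - f x) \<le> E * ln (real N) / real N)"
  proof cases
    case 1
    \<comment> \<open>The nested suprema are flattened to one over pairs, so that a single constant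
      \<open>D\<close> serves all \<open>x\<close> and \<open>h\<close>.\<close>
    have "(SUP z\<in>UNIV \<times> - {0}. ennreal (case z of (x, h) \<Rightarrow> cmod (forward_difference 2 h f x) / \<bar>h\<bar> powr 1)) < \<infinity>"
    proof -
      have "(SUP z\<in>UNIV \<times> - {0}. ennreal (case z of (x, h) \<Rightarrow> cmod (forward_difference 2 h f x) / \<bar>h\<bar> powr 1))
          \<le> difference_seminorm 2 1 f"
        unfolding difference_seminorm_def
        by (rule SUP_least) (auto intro!: SUP_upper2)
      then show ?thesis using 1(2) by (rule le_less_trans)
    qed
    from le_ennreal_of_SUP_finite[OF this]
    obtain D where D: "D \<ge> 0" "\<And>x h. h \<noteq> 0 \<Longrightarrow> cmod (forward_difference 2 h f x) / \<bar>h\<bar> powr 1 \<le> D"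
      by auto
    have D2: "cmod (f x - 2 * f (x + h) + f (x + 2 * h)) \<le> D * h" if "h > 0" for x h
    proof -
      have "forward_difference 2 h f x = f x - 2 * f (x + h) + f (x + 2 * h)"
        by (simp add: forward_difference_def eval_nat_numeral algebra_simps)
      then show ?thesis using D(2)[of h x] that by (simp add: pos_divide_le_eq)
    qed
    show ?thesis
    proof (intro exI[of _ "2 * K + 2 * D"] conjI allI impI)
      fix N :: nat and x assume N: "4 \<le> N"
      obtain j where j: "real N \<le> 2 ^ j" "real j \<le> 3 * ln (real N)" using ex_power_2_ge[OF N] by blast
      have "cmod (f (x + 1 / real N) - f x) \<le> 2 * K / 2 ^ j + real j / 2 * D * (1 / real N)"
        using N by (intro zygmund_increment_dyadic[OF K D2]) auto
      also have "\<dots> \<le> 2 * K / real N + 3 * ln (real N) / 2 * D * (1 / real N)"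
        using j N K0 D(1) by (intro add_mono divide_left_mono mult_right_mono divide_right_mono) auto
      also have "\<dots> = (2 * K + 3 / 2 * D * ln (real N)) / real N" by (simp add: add_divide_distrib)
      also have "\<dots> \<le> ((2 * K + 2 * D) * ln (real N)) / real N"
      proof (rule divide_right_mono)
        have "2 * K * 1 \<le> 2 * K * ln (real N)" using ln_ge_1[OF N] K0 by (intro mult_left_mono) auto
        moreover have "3 / 2 * D * ln (real N) \<le> 2 * D * ln (real N)"
          using ln_ge_1[OF N] D(1) by (intro mult_right_mono) auto
        ultimately show "2 * K + 3 / 2 * D * ln (real N) \<le> (2 * K + 2 * D) * ln (real N)"
          by (simp add: distrib_right)
      qed simp
      finally show "cmod (f (x + 1 / real N) - f x) \<le> (2 * K + 2 * D) * ln (real N) / real N" .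
    qed (use K0 D in auto)
  next
    case 2
    obtain f' where f': "\<And>x. (f has_vector_derivative f' x) (at x)"
      using 2(1) by (auto simp: C1_differentiable_on_def)
    obtain D where D: "D \<ge> 0" "\<And>x. cmod (f' x) \<le> D"
      using le_ennreal_of_SUP_finite[OF 2(2)[unfolded sup_norm_def]] vector_derivative_at[OF f'] by auto
    show ?thesis
    proof (intro exI[of _ D] conjI allI impI D(1))
      fix N :: nat and x assume N: "4 \<le> N"
      have lt: "x < x + 1 / real N" using N by simp
      have "\<exists>u\<in>{x<..<x + 1 / real N}. norm (f (x + 1 / real N) - f x) \<le> norm ((x + 1 / real N - x) *\<^sub>R f' u)"
      proof (rule mvt_general[OF lt])
        show "continuous_on {x..x + 1 / real N} f"
          using f' by (meson continuous_at_imp_continuous_on has_vector_derivative_continuous)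
        show "(f has_derivative (\<lambda>h. h *\<^sub>R f' u)) (at u)" for u
          using f' by (simp add: has_vector_derivative_def)
      qed
      then obtain u where "cmod (f (x + 1 / real N) - f x) \<le> cmod ((1 / real N) *\<^sub>R f' u)" by auto
      also have "\<dots> \<le> 1 / real N * (D * ln (real N))"
      proof -
        have "D * 1 \<le> D * ln (real N)" using ln_ge_1[OF N] D by (intro mult_left_mono) auto
        then have "cmod (f' u) \<le> D * ln (real N)" using D(2)[of u] by simp
        then show ?thesis by (simp add: divide_right_mono)
      qed
      finally show "cmod (f (x + 1 / real N) - f x) \<le> D * ln (real N) / real N" by simp
    qed
  qed
  then obtain E where E: "E \<ge> 0" "\<And>N x. 4 \<le> N \<Longrightarrow> cmod (f (x + 1 / real N) - f x) \<le> E * ln (real N) / real N"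
    by blast
  show ?thesis
  proof (intro exI[of _ "K + E + 1"] conjI allI impI)
    show "cmod (f x) \<le> K + E + 1" for x using K[of x] E(1) by linarith
    fix N :: nat and x assume N: "4 \<le> N"
    have "E * ln (real N) / real N \<le> (K + E + 1) * ln (real N) / real N"
      using K0 ln_ge_1[OF N] by (intro divide_right_mono mult_right_mono) auto
    then show "cmod (f (x + 1 / real N) - f x) \<le> (K + E + 1) * ln (real N) / real N"
      using E(2)[OF N, of x] by linarith
  qed (use K0 E in auto)
qed

section \<open>Partial summation against the Mertens function\<close>

lemma abel_summation:
  fixes a h :: "nat \<Rightarrow> complex"
  shows "(\<Sum>m=1..P. a m * h m) = (\<Sum>n=1..P. a n) * h P + (\<Sum>m\<in>{1..<P}. (\<Sum>n=1..m. a n) * (h m - h (Suc m)))"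
proof (induction P)
  case (Suc P)
  show ?case
  proof (cases "P = 0")
    case False
    then have "{1..<Suc P} = insert P {1..<P}" by auto
    then show ?thesis using Suc False by (simp add: algebra_simps)
  qed simp
qed simp

text \<open>The increments of \<open>ln m * f\<close> come in two kinds. At most
  \<open>b * N\<close> increments of \<open>f\<close>, each of size \<open>B * l / N\<close> and
  weighted by a logarithm, add up to b B l^2; the increments of the logarithm telescope to at most
  \<open>l\<close>. Since \<open>n\<close> merely translates the argument of \<open>f\<close>, the
  bound is uniform in \<open>n\<close>.\<close>

lemma moebius_log_sum_bound:
  fixes f :: "real \<Rightarrow> complex" and n k N P :: nat
  assumes C: "C > 0" "\<And>j. j \<ge> 1 \<Longrightarrow> \<bar>real_of_int (\<Sum>n=1..j. moebius_mu n)\<bar> \<le> C * real j powr \<alpha>"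
    and \<alpha>: "\<alpha> \<ge> 0" and B: "B > 0" "\<And>x. cmod (f x) \<le> B"
    and inc: "\<And>x. cmod (f (x + 1 / real N) - f x) \<le> B * ln (real N) / real N"
    and b: "b \<ge> 1" and N: "N \<ge> 1" and P: "real P \<le> b * real N"
  defines "Y \<equiv> b * real N"
  shows "cmod (\<Sum>m=1..P. of_int (moebius_mu m) * (of_real (ln (real m)) * f (real (n + m) / real N)))
    \<le> 3 * C * B * b * Y powr \<alpha> * (ln Y + 1)\<^sup>2"
proof -
  let ?d = "\<lambda>m. ln (real (Suc m)) - ln (real m)"
  let ?s = "\<lambda>m. \<Sum>n=1..m. of_int (moebius_mu n)"
  define h where "h m = of_real (ln (real m)) * f (real (n + m) / real N)" for m
  \<comment> \<open>The summand 1 ensures \<open>l \<ge> 1\<close>, so that all terms can be raised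
    to the common power l^2.\<close>
  define l where "l = ln Y + 1"
  define M where "M = C * Y powr \<alpha>"
  have "1 * 1 \<le> b * real N" using b N by (intro mult_mono) auto
  then have Y: "Y \<ge> 1" by (simp add: Y_def)
  have M0: "M \<ge> 0" using C by (simp add: M_def)
  have l: "l \<ge> 1" using Y by (simp add: l_def)
  have NY: "ln (real N) \<le> l"
  proof -
    have "1 * real N \<le> Y" using b unfolding Y_def by (intro mult_right_mono) auto
    then have "ln (real N) \<le> ln Y" using N by simp
    then show ?thesis by (simp add: l_def)
  qed
  have mb: "cmod (?s m) \<le> M" if "m \<le> P" for m
  proof (cases "m = 0")
    case False
    have "cmod (?s m) = \<bar>real_of_int (\<Sum>n=1..m. moebius_mu n)\<bar>"
      by (simp flip: of_int_sum)
    also have "\<dots> \<le> C * real m powr \<alpha>" using C(2)[of m] False by simp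
    also have "\<dots> \<le> M" unfolding M_def Y_def using that P C \<alpha> by (intro mult_left_mono powr_mono2) auto
    finally show ?thesis .
  qed (use M0 in simp)
  have lm: "0 \<le> ln (real m)" "ln (real m) \<le> l" if "1 \<le> m" "m \<le> P" for m
  proof -
    show "0 \<le> ln (real m)" using that by simp
    have "ln (real m) \<le> ln Y" using that P by (simp add: Y_def)
    then show "ln (real m) \<le> l" by (simp add: l_def)
  qed
  \<comment> \<open>For \<open>P = 0\<close> the convention \<open>ln 0 = 0\<close> makes
    \<open>h P\<close> vanish.\<close>
  have hP: "cmod (h P) \<le> l * B"
  proof (cases "P = 0")
    case False
    then show ?thesis unfolding h_def norm_mult using lm[of P] l B by (intro mult_mono) auto
  qed (use l B in \<open>simp add: h_def\<close>)
  have hd: "cmod (h m - h (Suc m)) \<le> l * (B * l / real N) + (?d m) * B" if m: "m \<in> {1..<P}" for m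
  proof -
    let ?x = "real (n + m) / real N"
    have e: "real (n + Suc m) / real N = ?x + 1 / real N" by (simp add: add_divide_distrib)
    have "h m - h (Suc m) = - (of_real (ln (real m)) * (f (?x + 1 / real N) - f ?x))
        - of_real (?d m) * f (?x + 1 / real N)"
      unfolding h_def e by (simp add: algebra_simps)
    also have "cmod \<dots> \<le> cmod (of_real (ln (real m)) * (f (?x + 1 / real N) - f ?x))
        + cmod (of_real (?d m) * f (?x + 1 / real N))"
      using norm_triangle_ineq4 norm_minus_cancel by metis
    also have "\<dots> \<le> l * (B * l / real N) + (?d m) * B"
    proof (intro add_mono)
      have "B * ln (real N) / real N \<le> B * l / real N" using NY B by (intro divide_right_mono mult_left_mono) auto
      then have "cmod (f (?x + 1 / real N) - f ?x) \<le> B * l / real N" using inc[of ?x] by linarith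
      then show "cmod (of_real (ln (real m)) * (f (?x + 1 / real N) - f ?x)) \<le> l * (B * l / real N)"
        unfolding norm_mult using lm[of m] m l by (intro mult_mono) auto
      have "0 \<le> ?d m" using m by simp
      then show "cmod (of_real (?d m) * f (?x + 1 / real N)) \<le> (?d m) * B"
        unfolding norm_mult norm_of_real using B by (intro mult_mono) auto
    qed
    finally show ?thesis .
  qed
  have tel: "(\<Sum>m\<in>{1..<P}. ?d m) \<le> l"
  proof (cases "P = 0")
    case False
    have "(\<Sum>m\<in>{1..<P}. ?d m) = ln (real P) - ln (real 1)"
      using False by (intro sum_Suc_diff') simp
    then show ?thesis using lm[of P] False by simp
  qed (use l in simp)
  have "(\<Sum>m=1..P. of_int (moebius_mu m) * h m)
      = (?s P) * h P + (\<Sum>m\<in>{1..<P}. (?s m) * (h m - h (Suc m)))"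
    by (rule abel_summation)
  also have "cmod \<dots> \<le> M * (l * B) + (\<Sum>m\<in>{1..<P}. M * (l * (B * l / real N) + (?d m) * B))"
  proof (intro order.trans[OF norm_triangle_ineq] add_mono order.trans[OF norm_sum] sum_mono)
    show "cmod ((?s P) * h P) \<le> M * (l * B)"
      unfolding norm_mult using mb[of P] hP M0 by (intro mult_mono) auto
    show "cmod ((?s m) * (h m - h (Suc m))) \<le> M * (l * (B * l / real N) + (?d m) * B)"
      if "m \<in> {1..<P}" for m
      unfolding norm_mult using mb[of m] hd[OF that] M0 that by (intro mult_mono) auto
  qed
  also have "\<dots> = M * (l * B) + M * (real (P - 1) * (l * (B * l / real N)) + (\<Sum>m\<in>{1..<P}. ?d m) * B)"
    by (simp only: sum_distrib_left[symmetric] sum.distrib sum_constant sum_distrib_right[symmetric] card_atLeastLessThan)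
       (simp add: mult.left_commute)
  also have "\<dots> \<le> M * (l * B) + M * (b * (l * B * l) + l * B)"
  proof (intro add_left_mono mult_left_mono add_mono mult_right_mono tel)
    have "real (P - 1) * (l * (B * l / real N)) \<le> (b * real N) * (l * (B * l / real N))"
      using P l B by (intro mult_right_mono) auto
    then show "real (P - 1) * (l * (B * l / real N)) \<le> b * (l * B * l)" using N by simp
  qed (use M0 B in auto)
  also have "\<dots> \<le> M * (B * b * l\<^sup>2) + M * (B * b * l\<^sup>2 + B * b * l\<^sup>2)"
  proof -
    have "1 * l \<le> b * l\<^sup>2" using b l by (intro mult_mono) (auto simp: power2_eq_square)
    then have "B * l \<le> B * (b * l\<^sup>2)" using B by (intro mult_left_mono) auto
    then have "l * B \<le> B * b * l\<^sup>2" by (simp add: mult_ac)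
    then show ?thesis using M0 by (intro add_mono mult_left_mono) (auto simp: power2_eq_square)
  qed
  also have "\<dots> = 3 * C * B * b * Y powr \<alpha> * (ln Y + 1)\<^sup>2" by (simp add: M_def l_def)
  finally show ?thesis by (simp add: h_def)
qed

section \<open>The average over characters\<close>

lemma mangoldt_le_ln: "n > 0 \<Longrightarrow> (mangoldt n :: real) \<le> ln (real n)"
proof -
  assume n: "n > 0"
  have "(mangoldt n :: real) \<le> (\<Sum>d | d dvd n. mangoldt d)"
    by (rule member_le_sum) (use n in \<open>auto simp: mangoldt_nonneg\<close>)
  then show ?thesis using mangoldt_sum[of n, where 'a = real] n by simp
qed

text \<open>Only powers of primes \<open>p\<close> dividing \<open>q\<close> contribute. Their
  exponents are at most \<open>2 * l\<close>, because \<open>ln p \<ge> 1 / 2\<close>, and for each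
  exponent the values \<open>ln p\<close> add up to at most \<open>ln q\<close>.\<close>

lemma mangoldt_sum_not_coprime_le:
  fixes q k :: nat and l :: real
  assumes q: "q > 0" and k: "k \<ge> 1" and l: "ln (real q) \<le> l" "ln (real k) \<le> l"
  shows "(\<Sum>n | n \<in> {1..k} \<and> \<not> coprime n q. mangoldt n) \<le> 2 * l\<^sup>2"
proof -
  define J where "J = nat \<lfloor>2 * l\<rfloor>"
  have "0 \<le> ln (real k)" using k by simp
  then have l0: "l \<ge> 0" using l(2) by linarith
  let ?T = "{n. n \<in> {1..k} \<and> \<not> coprime n q}"
  let ?P = "prime_factors q \<times> {1..J}"
  have sub: "{n \<in> ?T. (mangoldt n :: real) \<noteq> 0} \<subseteq> (\<lambda>(p, j). p ^ j) ` ?P"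
  proof
    fix n assume n: "n \<in> {n \<in> ?T. (mangoldt n :: real) \<noteq> 0}"
    then have "primepow n" by (auto simp: mangoldt_def split: if_splits)
    then obtain p j where pj: "prime p" "j > 0" "n = p ^ j" by (auto simp: primepow_def)
    have "\<not> coprime p q" using n pj by simp
    then have "p dvd q" using pj(1) prime_imp_coprime by blast
    then have p: "p \<in> prime_factors q" using pj q by (simp add: prime_factors_dvd)
    have "p \<ge> 2" using pj(1) by (rule prime_ge_2_nat)
    then have "ln 2 \<le> ln (real p)" by simp
    then have "1 / 2 \<le> ln (real p)" using ln2_ge_two_thirds by linarith
    then have "real j * (1 / 2) \<le> real j * ln (real p)" by (intro mult_left_mono) auto
    also have "\<dots> = ln (real n)" using pj \<open>p \<ge> 2\<close> by (simp add: ln_realpow)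
    also have "\<dots> \<le> ln (real k)" using n by auto
    finally have "real j \<le> 2 * l" using l by simp
    then have "j \<le> J" unfolding J_def by linarith
    then show "n \<in> (\<lambda>(p, j). p ^ j) ` ?P" using p pj by force
  qed
  have fin: "finite ?P" by simp
  have "(\<Sum>n\<in>?T. mangoldt n :: real) = (\<Sum>n\<in>{n \<in> ?T. (mangoldt n :: real) \<noteq> 0}. mangoldt n)"
    by (rule sum.mono_neutral_right) auto
  also have "\<dots> \<le> (\<Sum>n\<in>(\<lambda>(p, j). p ^ j) ` ?P. mangoldt n)"
    using sub fin by (intro sum_mono2) (auto simp: mangoldt_nonneg)
  also have "\<dots> \<le> sum (mangoldt \<circ> (\<lambda>(p, j). p ^ j)) ?P"
    by (rule sum_image_le[OF fin]) (rule mangoldt_nonneg)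
  also have "\<dots> = (\<Sum>(p, j)\<in>?P. mangoldt p)"
    by (intro sum.cong refl) (auto simp: in_prime_factors_imp_prime)
  also have "\<dots> = real J * (\<Sum>p\<in>prime_factors q. mangoldt p)"
    by (simp add: sum.cartesian_product[symmetric] sum_distrib_left)
  also have "\<dots> \<le> (2 * l) * l"
  proof (intro mult_mono)
    show "real J \<le> 2 * l" using l0 unfolding J_def by linarith
    have "(\<Sum>p\<in>prime_factors q. mangoldt p :: real) \<le> (\<Sum>d | d dvd q. mangoldt d)"
      using q by (intro sum_mono2) (auto simp: mangoldt_nonneg)
    also have "\<dots> = ln (real q)" using mangoldt_sum[of q, where 'a = real] q by simp
    finally show "(\<Sum>p\<in>prime_factors q. mangoldt p :: real) \<le> l" using l by simp
  qed (use l0 in \<open>auto intro!: sum_nonneg simp: mangoldt_nonneg\<close>)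
  finally show ?thesis by (simp add: power2_eq_square)
qed

text \<open>At \<open>n\<close> coprime to \<open>q\<close> the inducing character coincides with
  \<open>chi\<close>, and \<open>character_sum_mean\<close> applies. At the other \<open>n\<close>
  it may be nonzero although \<open>chi\<close> vanishes; these terms are bounded absolutely, which
  costs \<open>2 * G * l\<^sup>2\<close> per character.\<close>

lemma character_average_bound:
  fixes g :: "nat \<Rightarrow> complex" and q k :: nat and Y G :: real
  assumes q: "1 < q" and X: "finite X" "\<And>chi. chi \<in> X \<Longrightarrow> dirichlet_character q chi"
    and g: "\<And>n. n \<in> {1..k} \<Longrightarrow> cmod (g n) \<le> G" and G: "G \<ge> 0"
    and k: "1 \<le> k" "real k \<le> Y" and qY: "real q \<le> Y"
  defines "l \<equiv> ln Y + 1"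
  shows "(\<Sum>chi\<in>X. cmod (\<Sum>n=1..k. mangoldt n * inducing_character q chi n * g n))
    \<le> real (totient q) * (2 * Y * l * G / sqrt (real q) + 2 * G * l\<^sup>2)"
proof -
  let ?c = "\<lambda>chi n. mangoldt n * inducing_character q chi n * g n"
  let ?A = "{n\<in>{1..k}. coprime n q}" and ?T = "{n\<in>{1..k}. \<not> coprime n q}"
  define a where "a n = mangoldt n * g n" for n
  have Y1: "Y \<ge> 1" using k by linarith
  have l1: "l \<ge> 1" using Y1 by (simp add: l_def)
  have lk: "ln (real n) \<le> l" if "n \<in> {1..k}" for n
  proof -
    have "ln (real n) \<le> ln Y" using that k by simp
    then show ?thesis by (simp add: l_def)
  qed
  have lq: "ln (real q) \<le> l"
  proof -
    have "ln (real q) \<le> ln Y" using q qY by simp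
    then show ?thesis by (simp add: l_def)
  qed
  have am: "cmod (a n) \<le> l * G" if "n \<in> {1..k}" for n
  proof -
    have "(mangoldt n :: real) \<le> l" using mangoldt_le_ln[of n] lk[OF that] that by simp
    then show ?thesis unfolding a_def norm_mult norm_mangoldt using g[OF that] l1
      by (intro mult_mono) auto
  qed
  have split: "cmod (\<Sum>n=1..k. ?c chi n)
      \<le> cmod (\<Sum>n\<in>?A. a n * chi n) + 2 * G * l\<^sup>2" if "chi \<in> X" for chi
  proof -
    note ind = inducing_character_props[OF X(2)[OF that]]
    have "{1..k} = ?A \<union> ?T" by auto
    then have "(\<Sum>n=1..k. ?c chi n)
        = (\<Sum>n\<in>?A. ?c chi n) + (\<Sum>n\<in>?T. ?c chi n)"
      by (subst \<open>{1..k} = ?A \<union> ?T\<close>, intro sum.union_disjoint) auto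
    also have "(\<Sum>n\<in>?A. ?c chi n) = (\<Sum>n\<in>?A. a n * chi n)"
      using ind(1) by (intro sum.cong refl) (simp add: a_def)
    finally have "cmod (\<Sum>n=1..k. ?c chi n)
        \<le> cmod (\<Sum>n\<in>?A. a n * chi n) + cmod (\<Sum>n\<in>?T. ?c chi n)"
      by (simp only: norm_triangle_ineq)
    also have "cmod (\<Sum>n\<in>?T. ?c chi n) \<le> (\<Sum>n\<in>?T. mangoldt n * G)"
    proof (rule order.trans[OF norm_sum sum_mono])
      fix n assume n: "n \<in> ?T"
      have "cmod (?c chi n) \<le> (mangoldt n * 1) * G"
        unfolding norm_mult norm_mangoldt using ind(2)[of n] g[of n] n
        by (intro mult_mono) (auto simp: mangoldt_nonneg)
      then show "cmod (?c chi n) \<le> mangoldt n * G" by simp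
    qed
    also have "\<dots> = (\<Sum>n\<in>?T. mangoldt n) * G" by (simp add: sum_distrib_right)
    also have "\<dots> \<le> (2 * l\<^sup>2) * G"
      using mangoldt_sum_not_coprime_le[of q k l] q k lq lk[of k] G by (intro mult_right_mono) auto
    finally show ?thesis by (simp add: mult_ac)
  qed
  have S: "(\<Sum>n\<in>?A. (cmod (a n))\<^sup>2) \<le> Y * (l * G)\<^sup>2"
  proof -
    have "(\<Sum>n\<in>?A. (cmod (a n))\<^sup>2) \<le> (\<Sum>n\<in>?A. (l * G)\<^sup>2)"
      using am by (intro sum_mono power_mono) auto
    also have "\<dots> = real (card ?A) * (l * G)\<^sup>2" by simp
    also have "\<dots> \<le> Y * (l * G)\<^sup>2"
    proof (rule mult_right_mono)
      have "card ?A \<le> card {1..k}" by (intro card_mono) auto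
      then show "real (card ?A) \<le> Y" using k by simp
    qed simp
    finally show ?thesis .
  qed
  \<comment> \<open>The constant 4 is a perfect square, so that the root below becomes
    \<open>2 * Y * l * G / sqrt q\<close>.\<close>
  have kq: "real k / real q + 1 \<le> 4 * Y / real q"
  proof -
    have "real k / real q \<le> Y / real q" using k by (intro divide_right_mono) auto
    moreover have "1 \<le> Y / real q" using qY q by simp
    ultimately show ?thesis by simp
  qed
  have "sqrt ((real k / real q + 1) * (\<Sum>n\<in>?A. (cmod (a n))\<^sup>2)) \<le> sqrt ((4 * Y / real q) * (Y * (l * G)\<^sup>2))"
    using kq S q Y1 by (intro real_sqrt_le_mono mult_mono) (auto intro!: sum_nonneg)
  also have "(4 * Y / real q) * (Y * (l * G)\<^sup>2) = (2 * Y * l * G)\<^sup>2 / real q"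
    by (simp add: power2_eq_square)
  also have "sqrt \<dots> = 2 * Y * l * G / sqrt (real q)"
    using Y1 l1 G by (simp add: real_sqrt_divide)
  finally have sq: "sqrt ((real k / real q + 1) * (\<Sum>n\<in>?A. (cmod (a n))\<^sup>2)) \<le> 2 * Y * l * G / sqrt (real q)" .
  note mean = character_sum_mean(1)[OF q X, where a = a and k = k]
  have "(\<Sum>chi\<in>X. cmod (\<Sum>n=1..k. ?c chi n))
      \<le> (\<Sum>chi\<in>X. cmod (\<Sum>n\<in>?A. a n * chi n) + 2 * G * l\<^sup>2)"
    by (intro sum_mono split)
  also have "\<dots> = (\<Sum>chi\<in>X. cmod (\<Sum>n\<in>?A. a n * chi n)) + real (card X) * (2 * G * l\<^sup>2)"
    by (simp add: sum.distrib)
  also have "\<dots> \<le> real (totient q) * (2 * Y * l * G / sqrt (real q)) + real (totient q) * (2 * G * l\<^sup>2)"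
  proof (intro add_mono mult_right_mono)
    show "(\<Sum>chi\<in>X. cmod (\<Sum>n\<in>?A. a n * chi n)) \<le> real (totient q) * (2 * Y * l * G / sqrt (real q))"
      using mean mult_left_mono[OF sq, of "real (totient q)"] by linarith
  qed (use character_sum_mean(2)[OF q X] G in auto)
  finally show ?thesis by (simp add: distrib_left)
qed

section \<open>Summation over the moduli\<close>

lemma sum_inverse_sqrt_le: "(\<Sum>q=1..n. 1 / sqrt (real q)) \<le> 2 * sqrt (real n)"
proof (induction n)
  case (Suc n)
  let ?a = "sqrt (real n)" and ?b = "sqrt (real (Suc n))"
  have b: "?b > 0" by simp
  have ab: "?a \<le> ?b" by simp
  have "(?b - ?a) * (?b + ?a) = 1" by (simp add: algebra_simps flip: power2_eq_square)
  then have "1 \<le> (?b - ?a) * (2 * ?b)" using ab mult_left_mono[of "?b + ?a" "2 * ?b" "?b - ?a"] by simp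
  then have "1 / ?b \<le> 2 * (?b - ?a)" by (simp only: pos_divide_le_eq[OF b] mult_ac)
  then show ?case using Suc by simp
qed simp

text \<open>The inequality \<open>ln u \<le> u - 1\<close> at
  \<open>u = Y powr \<kappa>\<close>.\<close>

lemma ln_add_1_le_powr:
  fixes Y \<kappa> :: real
  assumes Y: "Y \<ge> 1" and \<kappa>: "0 < \<kappa>" "\<kappa> \<le> 1"
  shows "ln Y + 1 \<le> Y powr \<kappa> / \<kappa>"
proof -
  have "ln (Y powr \<kappa>) \<le> Y powr \<kappa> - 1" using Y by (intro ln_le_minus_one) auto
  then have "\<kappa> * ln Y + 1 \<le> Y powr \<kappa>" using Y by (simp add: ln_powr)
  then have "\<kappa> * (ln Y + 1) \<le> Y powr \<kappa>" using \<kappa> by (simp add: distrib_left)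
  then show ?thesis using \<kappa> by (simp add: pos_le_divide_eq mult.commute)
qed

theorem theorem28:
  fixes \<delta> \<epsilon> \<theta> \<beta> :: real and f :: "real \<Rightarrow> complex"
  assumes "GRH" and "weak_Gonek_Hejhal"
    and "1 \<le> \<delta>" and "\<delta> < 2"
    and "0 < \<epsilon>" and "\<epsilon> < (if 3 / 2 \<le> \<delta> then (\<delta> - 1) / 2 else 1 / 4)"
    and "\<theta> = (if 3 / 2 \<le> \<delta> then \<delta> - 1 - 2 * \<epsilon> else 1 / 2 - 2 * \<epsilon>)"
    and "0 < \<beta>"
    and "support_on UNIV f \<subseteq> {0..<\<beta>}"
    and "f \<in> holder_zygmund \<delta>"
  shows "\<exists>C::real. \<forall>N::nat. 4 \<le> N \<longrightarrow> (\<exists>k::nat. 0 < k \<and> real N * \<beta> = real k) \<longrightarrow>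
    (\<Sum>q | 1 < q \<and> real q \<le> real N powr \<theta> \<and> coprime N q.
       1 / real (totient q) *
       cmod (\<Sum>chi | dirichlet_character q chi \<and> chi \<noteq> principal_character q.
         cnj (inducing_character q chi N) *
         (\<Sum>n::nat | 0 < n \<and> real n \<le> real N * \<beta>.
            \<Sum>m::nat | 0 < m \<and> real m \<le> real N * \<beta> - real n.
              mangoldt n * inducing_character q chi n * of_int (moebius_mu m) *
              of_real (ln (real m)) * f (real (n + m) / real N))))
    \<le> C * real N powr (2 - \<epsilon>)"
proof -
  \<comment> \<open>In the two ranges of \<open>\<delta>\<close> the sum
    \<open>\<theta> + 2 * \<epsilon>\<close> equals \<open>\<delta> - 1\<close> and
    \<open>1 / 2\<close> respectively.\<close>
  have \<theta>: "0 < \<theta>" "\<theta> < 1" "\<theta> + 2 * \<epsilon> < 1" using assms by (auto split: if_splits)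
  \<comment> \<open>One \<open>\<kappa>\<close> is lost in the Mertens bound and four in
    \<open>l ^ 4\<close>. With a tenth of the gap the total exponent
    \<open>1 + (1 / 2 + \<kappa>) + \<theta> / 2 + 4 * \<kappa>\<close> is exactly
    \<open>2 - \<epsilon>\<close>.\<close>
  define \<kappa> where "\<kappa> = (1 - \<theta> - 2 * \<epsilon>) / 10"
  have \<kappa>: "0 < \<kappa>" "\<kappa> < 1" using \<theta> assms(5) by (auto simp: \<kappa>_def)
  define \<alpha> where "\<alpha> = 1 / 2 + \<kappa>"
  obtain C where C: "C > 0" "\<And>j. j \<ge> 1 \<Longrightarrow> \<bar>real_of_int (\<Sum>n=1..j. moebius_mu n)\<bar> \<le> C * real j powr \<alpha>"
    using mertens_bound[OF assms(1) \<kappa>] unfolding \<alpha>_def by blast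
  obtain B where B: "B > 0" "\<And>x. cmod (f x) \<le> B"
    "\<And>N x. 4 \<le> N \<Longrightarrow> cmod (f (x + 1 / real N) - f x) \<le> B * ln (real N) / real N"
    using holder_zygmund_increment[OF assms(10)] by blast
  \<comment> \<open>With this \<open>b\<close> the quantity \<open>Y = b * N\<close> dominates both
    \<open>N\<close> and \<open>k = N * \<beta>\<close>.\<close>
  define b where "b = max 1 \<beta>"
  have b: "b \<ge> 1" "\<beta> \<le> b" by (auto simp: b_def)
  \<comment> \<open>18 = 3 * (4 + 2): the constant of \<open>G\<close> times those of the two terms
    of the sum over \<open>q\<close>. The denominator comes from bounding \<open>l ^ 4\<close> by
    \<open>(Y powr \<kappa> / \<kappa>) ^ 4\<close>.\<close>
  define D where "D = 18 * C * B * b / \<kappa> ^ 4"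
  have D: "D \<ge> 0" using C B b \<kappa> by (simp add: D_def)
  show ?thesis
  proof (intro exI[of _ "D * b powr (2 - \<epsilon>)"] allI impI, elim exE conjE)
    fix N k :: nat
    assume N: "4 \<le> N" and k: "0 < k" "real N * \<beta> = real k"
    define Y where "Y = b * real N"
    define l where "l = ln Y + 1"
    define G where "G = 3 * C * B * b * Y powr \<alpha> * l\<^sup>2"
    have NY: "real N \<le> Y" using b mult_right_mono[of 1 b "real N"] by (simp add: Y_def)
    have Y1: "Y \<ge> 1" using NY N by simp
    have l: "l \<ge> 1" using Y1 by (simp add: l_def)
    have G: "G \<ge> 0" using C B b by (simp add: G_def)
    have kY: "real k \<le> Y" using b mult_right_mono[of \<beta> b "real N"] k(2) by (simp add: Y_def mult.commute)
    define g where "g n = (\<Sum>m=1..k - n. of_int (moebius_mu m) * (of_real (ln (real m)) * f (real (n + m) / real N)))" for n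
    have gG: "cmod (g n) \<le> G" for n
      unfolding g_def G_def l_def Y_def
    proof (rule moebius_log_sum_bound[where f = f and C = C and \<alpha> = \<alpha> and B = B])
      show "cmod (f (x + 1 / real N) - f x) \<le> B * ln (real N) / real N" for x by (rule B(3)[OF N])
    qed (use C B(1,2) b kY N \<kappa> in \<open>auto simp: \<alpha>_def Y_def of_nat_diff\<close>)
    let ?w = "\<lambda>q chi n m. mangoldt n * inducing_character q chi n * of_int (moebius_mu m) *
      of_real (ln (real m)) * f (real (n + m) / real N)"
    let ?D = "\<lambda>q chi. \<Sum>n::nat | 0 < n \<and> real n \<le> real N * \<beta>.
      \<Sum>m::nat | 0 < m \<and> real m \<le> real N * \<beta> - real n. ?w q chi n m"
    \<comment> \<open>Because \<open>N * \<beta>\<close> is the integer \<open>k\<close>, the real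
      summation ranges are those up to \<open>k\<close> and \<open>k - n\<close>.\<close>
    have inner: "?D q chi = (\<Sum>n=1..k. mangoldt n * inducing_character q chi n * g n)" for q chi
    proof (rule sum.cong)
      show "{n::nat. 0 < n \<and> real n \<le> real N * \<beta>} = {1..k}" unfolding k(2) by auto
      fix n assume n: "n \<in> {1..k}"
      have "{m::nat. 0 < m \<and> real m \<le> real N * \<beta> - real n} = {1..k - n}"
        using n unfolding k(2) by (auto simp: of_nat_diff)
      then show "(\<Sum>m::nat | 0 < m \<and> real m \<le> real N * \<beta> - real n. ?w q chi n m)
          = mangoldt n * inducing_character q chi n * g n"
        by (simp add: g_def sum_distrib_left mult.assoc)
    qed
    let ?Q = "{q. 1 < q \<and> real q \<le> real N powr \<theta> \<and> coprime N q}"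
    let ?X = "\<lambda>q. {chi. dirichlet_character q chi \<and> chi \<noteq> principal_character q}"
    let ?S = "\<lambda>q chi. \<Sum>n=1..k. mangoldt n * inducing_character q chi n * g n"
    define R where "R = nat \<lfloor>real N powr \<theta>\<rfloor>"
    have R: "real R \<le> real N powr \<theta>" unfolding R_def by simp
    have QR: "?Q \<subseteq> {1..R}" unfolding R_def by (auto simp: le_nat_floor)
    have finQ: "finite ?Q" using QR finite_subset by blast
    have N\<theta>: "real N powr \<theta> \<le> Y powr \<theta>" using NY \<theta> by (intro powr_mono2) auto
    \<comment> \<open>The weight \<open>1 / totient q\<close> cancels the factor
      \<open>totient q\<close> of the average over characters, and the value at \<open>N\<close> has
      modulus at most 1.\<close>
    have per_q: "1 / real (totient q) * cmod (\<Sum>chi\<in>?X q. cnj (inducing_character q chi N) * ?S q chi)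
        \<le> 2 * Y * l * G * (1 / sqrt (real q)) + 2 * G * l\<^sup>2" if q: "q \<in> ?Q" for q
    proof (cases "finite (?X q)")
      case True
      have q1: "1 < q" using q by simp
      have "real N powr \<theta> \<le> real N powr 1" using N \<theta> by (intro powr_mono) auto
      then have qY: "real q \<le> Y" using q NY N by simp
      have "cmod (\<Sum>chi\<in>?X q. cnj (inducing_character q chi N) * ?S q chi) \<le> (\<Sum>chi\<in>?X q. cmod (?S q chi))"
      proof (rule order.trans[OF norm_sum sum_mono])
        fix chi assume "chi \<in> ?X q"
        then have "cmod (inducing_character q chi N) \<le> 1" using inducing_character_props(2) by blast
        then show "cmod (cnj (inducing_character q chi N) * ?S q chi) \<le> cmod (?S q chi)"
          unfolding norm_mult complex_mod_cnj by (intro mult_left_le_one_le) auto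
      qed
      also have "\<dots> \<le> real (totient q) * (2 * Y * l * G / sqrt (real q) + 2 * G * l\<^sup>2)"
        unfolding l_def
        by (rule character_average_bound[OF q1 True]) (use gG G k kY qY in auto)
      finally show ?thesis using q1 by (simp add: pos_divide_le_eq mult.commute)
    next
      \<comment> \<open>A sum over an infinite set is 0 by convention, so this case holds without
        counting the characters modulo \<open>q\<close>.\<close>
      case False
      then show ?thesis using Y1 l G by simp
    qed
    have "(\<Sum>q\<in>?Q. 1 / real (totient q) * cmod (\<Sum>chi\<in>?X q. cnj (inducing_character q chi N) * ?S q chi))
        \<le> (\<Sum>q\<in>?Q. 2 * Y * l * G * (1 / sqrt (real q)) + 2 * G * l\<^sup>2)"
      by (intro sum_mono per_q)
    also have "\<dots> \<le> (\<Sum>q=1..R. 2 * Y * l * G * (1 / sqrt (real q)) + 2 * G * l\<^sup>2)"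
      using QR Y1 l G by (intro sum_mono2) auto
    also have "\<dots> = 2 * Y * l * G * (\<Sum>q=1..R. 1 / sqrt (real q)) + real R * (2 * G * l\<^sup>2)"
      by (simp only: sum.distrib sum_distrib_left[symmetric] sum_constant card_atLeastAtMost) simp
    \<comment> \<open>The number of moduli is at most
      \<open>Y powr \<theta> \<le> Y * Y powr (\<theta> / 2)\<close>, which brings the second term
      to the same power of \<open>Y\<close> as the first.\<close>
    also have "\<dots> \<le> 2 * Y * l * G * (2 * Y powr (\<theta> / 2)) + (Y * Y powr (\<theta> / 2)) * (2 * G * l\<^sup>2)"
    proof (intro add_mono mult_left_mono mult_right_mono)
      have "sqrt (real R) \<le> sqrt (Y powr \<theta>)" using R N\<theta> by (intro real_sqrt_le_mono) linarith
      also have "\<dots> = Y powr (\<theta> / 2)" by (simp add: powr_half_sqrt[symmetric] powr_powr)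
      finally show "(\<Sum>q=1..R. 1 / sqrt (real q)) \<le> 2 * Y powr (\<theta> / 2)"
        using sum_inverse_sqrt_le[of R] by linarith
      have "real R \<le> Y powr (\<theta> / 2) * Y powr (\<theta> / 2)" using R N\<theta> by (simp flip: powr_add)
      also have "\<dots> \<le> Y * Y powr (\<theta> / 2)"
        using powr_mono[of "\<theta> / 2" 1 Y] Y1 \<theta> by (intro mult_right_mono) auto
      finally show "real R \<le> Y * Y powr (\<theta> / 2)" .
    qed (use Y1 l G in auto)
    also have "\<dots> \<le> 2 * Y * l\<^sup>2 * G * (2 * Y powr (\<theta> / 2)) + (Y * Y powr (\<theta> / 2)) * (2 * G * l\<^sup>2)"
      using Y1 l G by (intro add_right_mono mult_right_mono mult_left_mono) (auto simp: power2_eq_square)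
    also have "\<dots> = 18 * C * B * b * (Y * Y powr \<alpha> * Y powr (\<theta> / 2)) * l ^ 4"
      by (simp add: G_def power2_eq_square power4_eq_xxxx)
    also have "\<dots> \<le> 18 * C * B * b * (Y * Y powr \<alpha> * Y powr (\<theta> / 2)) * (Y powr \<kappa> / \<kappa>) ^ 4"
    proof (intro mult_left_mono power_mono)
      show "l \<le> Y powr \<kappa> / \<kappa>" unfolding l_def using Y1 \<kappa> by (intro ln_add_1_le_powr) auto
    qed (use l C B b Y1 in auto)
    also have "\<dots> = D * (Y powr 1 * Y powr \<alpha> * Y powr (\<theta> / 2) * Y powr (4 * \<kappa>))"
    proof -
      have "(Y powr \<kappa>) ^ 4 = Y powr (4 * \<kappa>)" using Y1 by (simp add: powr_powr mult.commute flip: powr_realpow)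
      then show ?thesis using Y1 by (simp add: D_def power_divide)
    qed
    also have "Y powr 1 * Y powr \<alpha> * Y powr (\<theta> / 2) * Y powr (4 * \<kappa>) = Y powr (2 - \<epsilon>)"
    proof -
      have "1 + \<alpha> + \<theta> / 2 + 4 * \<kappa> = 2 - \<epsilon>" by (simp add: \<alpha>_def \<kappa>_def field_simps)
      then show ?thesis by (simp only: powr_add[symmetric])
    qed
    also have "Y powr (2 - \<epsilon>) = b powr (2 - \<epsilon>) * real N powr (2 - \<epsilon>)"
      unfolding Y_def by (rule powr_mult)
    finally have "(\<Sum>q\<in>?Q. 1 / real (totient q) * cmod (\<Sum>chi\<in>?X q. cnj (inducing_character q chi N) * ?S q chi))
        \<le> D * b powr (2 - \<epsilon>) * real N powr (2 - \<epsilon>)" by simp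
    then show "(\<Sum>q\<in>?Q. 1 / real (totient q) *
        cmod (\<Sum>chi\<in>?X q. cnj (inducing_character q chi N) * ?D q chi))
      \<le> D * b powr (2 - \<epsilon>) * real N powr (2 - \<epsilon>)"
      unfolding inner .
  qed
qed

end
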